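(* Let $M$ be a smooth manifold and let $S_1$ and $S_2$ be sprays on $M$, with complete lifts $S_1^c$ and $S_2^c$ (which are sprays on $TM$). Then the following statements are equivalent: (i) $S_1=S_2$, which means that $S_1$ and $S_2$ have the same geodesics as parameterized curves; (ii) $S_1^c$ and $S_2^c$ are projectively related, which means that $S_1$ and $S_2$ have the same Jacobi fields up to orientation preserving reparameterizations.
   Context: $M$ is a real $C^\infty$ manifold of dimension $n$; all objects are smooth. $T^0M=M$, $T^rM=T(T^{r-1}M)$, $\pi_r\colon T^{r+1}M\to T^rM$ is the canonical projection, $D$ is the tangent map. Induced local coordinates on $TM$, $TTM$ are $(x,y)$, $(x,y,X,Y)$. The slashed tangent bundles are the open sets $TM\setminus\{0\}=\{(x,y): y\neq0\}$ and, for $r\geq 2$, $T^rM\setminus\{0\}=\{\xi\in T^rM: D(\pi_0\circ\cdots\circ\pi_{r-2})(\xi)\in TM\setminus\{0\}\}$; in particular $TTM\setminus\{0\}=\{(x,y,X,Y): X\ne0\}$. For a map $c$ into $T^rM$, $\partial_{t}c$ is its derivative with respect to a variable $t$, as a map into $T^{r+1}M$; $c'=\partial_tc$ for curves. For $r\ge2$, $\kappa_r\colon T^rM\to T^rM$ is the unique diffeomorphism with $\partial_t\partial_sc(t,s)=\kappa_r\partial_s\partial_tc(t,s)$ for every map $c\colon(-\varepsilon,\varepsilon)^2\to T^{r-2}M$; in coordinates $\kappa_2(x,y,X,Y)=(x,X,y,Y)$ and $\kappa_3(x,y,X,Y,u,v,U,V)=(x,y,u,v,X,Y,U,V)$. For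 $r\ge1$, a semispray on $T^{r-1}M$ is a vector field $S\in\mathfrak{X}(T^rM\setminus\{0\})$ with $\kappa_{r+1}\circ S=S$. The Liouville vector field $\mathbb{C}_r\in\mathfrak{X}(T^rM)$ is $\mathbb{C}_r(\xi)=\partial_s(\xi+s\xi)|_{s=0}$ (fibrewise operations with respect to $\pi_{r-1}$). A spray on $T^{r-1}M$ is a semispray $S$ on $T^{r-1}M$ with $[\mathbb{C}_r,S]=S$. A spray on $M$ has the local form $S=y^i\frac{\partial}{\partial x^i}-2G^i(x,y)\frac{\partial}{\partial y^i}$ with $G^i$ positively $2$-homogeneous in $y$. The complete lift of a spray $S$ on $M$ is the vector field $S^c=D\kappa_2\circ\kappa_3\circ DS\circ\kappa_2$ on $TTM\setminus\{0\}$; it is a spray on $TM$. In coordinates $S^c=X^i\frac{\partial}{\partial x^i}+Y^i\frac{\partial}{\partial y^i}-2(G^i)^v\frac{\partial}{\partial X^i}-2(G^i)^c\frac{\partial}{\partial Y^i}$, where $(G^i)^v(x,y,X,Y)=G^i(x,X)$ and $(G^i)^c(x,y,X,Y)=\frac{\partial G^i}{\partial x^j}(x,X)y^j+\frac{\partial G^i}{\partial y^j}(x,X)Y^j$. A geodesic of a semispray $S$ on $T^{r-1}M$ is a curve $c\colon I\to T^{r-1}M$ on a maximal open interval $I$ with $c'(t)\in T^rM\setminus\{0\}$ for all $t\in I$ and $c''=S(c')$. Two sprays $S_1,S_2$ on $T^{r-1}M$ are projectively related if their geodesics coincide up to orientation preserving reparameterizations; equivalently, if there is a function $P\colon T^rM\setminus\{0\}\to\mathbb{R}$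 that is positively $1$-homogeneous ($P(\lambda\xi)=\lambda P(\xi)$ for $\lambda>0$) such that $S_1=S_2+2P\,\mathbb{C}_r$. A Jacobi field of a spray $S$ on $M$ is a vector field $J(t)=(x^i(t),y^i(t))$ along a geodesic $c=\pi_0\circ J$ of $S$ satisfying $\frac{d^2y^i}{dt^2}+2\frac{\partial G^i}{\partial y^j}(x,\frac{dx}{dt})\frac{dy^j}{dt}+2\frac{\partial G^i}{\partial x^j}(x,\frac{dx}{dt})y^j=0$; the Jacobi fields of $S$ are exactly the geodesics of $S^c$. *)

theory Defs
  imports "HOL-Analysis.Analysis"
begin

section \<open>Smooth maps between open subsets of Euclidean spaces\<close>

text \<open>For open \<open>U\<close> in a finite-dimensional space this is the class \<open>C^k\<close>.\<close>

primrec Ck_on ::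
  "nat \<Rightarrow> 'a::euclidean_space set \<Rightarrow> ('a \<Rightarrow> 'b::euclidean_space) \<Rightarrow> bool"
where
  "Ck_on 0 U f \<longleftrightarrow> continuous_on U f"
| "Ck_on (Suc k) U f \<longleftrightarrow>
     (\<forall>x\<in>U. f differentiable (at x)) \<and>
     (\<forall>v. Ck_on k U (\<lambda>x. frechet_derivative f (at x) v))"

definition smooth_on ::
  "'a::euclidean_space set \<Rightarrow> ('a \<Rightarrow> 'b::euclidean_space) \<Rightarrow> bool" where
  "smooth_on U f \<longleftrightarrow> open U \<and> (\<forall>k. Ck_on k U f)"


section \<open>Smooth manifolds\<close>

text \<open>A chart is a pair of its domain and its coordinate map; the values of the coordinate map
  outside of the domain are irrelevant. The dimension of the manifold is \<open>DIM('e)\<close>.\<close>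

type_synonym ('m, 'e) chart = "'m set \<times> ('m \<Rightarrow> 'e)"

record ('m, 'e) manifold =
  points :: "'m set"
  atlas :: "('m, 'e) chart set"

definition charts_at :: "('m, 'e) manifold \<Rightarrow> 'm \<Rightarrow> ('m, 'e) chart set" where
  "charts_at N p = {A \<in> atlas N. p \<in> fst A}"

definition chart_inv :: "('m, 'e) chart \<Rightarrow> 'e \<Rightarrow> 'm" where
  "chart_inv A = inv_into (fst A) (snd A)"

definition manifold_topology :: "('m, 'e::euclidean_space) manifold \<Rightarrow> 'm topology" where
  "manifold_topology N =
     topology (\<lambda>W. W \<subseteq> points N \<and> (\<forall>A\<in>atlas N. open (snd A ` (W \<inter> fst A))))"

definition smooth_manifold :: "('m, 'e::euclidean_space) manifold \<Rightarrow> bool" where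
  "smooth_manifold N \<longleftrightarrow>
     (\<Union>A\<in>atlas N. fst A) = points N \<and>
     (\<forall>A\<in>atlas N. inj_on (snd A) (fst A) \<and> open (snd A ` fst A)) \<and>
     (\<forall>A\<in>atlas N. \<forall>B\<in>atlas N.
        smooth_on (snd A ` (fst A \<inter> fst B)) (snd B \<circ> chart_inv A)) \<and>
     Hausdorff_space (manifold_topology N) \<and>
     second_countable (manifold_topology N)"

text \<open>The family used in \<open>manifold_topology\<close> is a topology as soon as the charts are injective.\<close>

lemma openin_manifold_topology:
  fixes N :: "('m, 'e::euclidean_space) manifold"
  assumes inj: "\<And>A. A \<in> atlas N \<Longrightarrow> inj_on (snd A) (fst A)"
  shows "openin (manifold_topology N) W \<longleftrightarrow>
           W \<subseteq> points N \<and> (\<forall>A\<in>atlas N. open (snd A ` (W \<inter> fst A)))"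
proof -
  let ?L = "\<lambda>W. W \<subseteq> points N \<and> (\<forall>A\<in>atlas N. open (snd A ` (W \<inter> fst A)))"
  have 1: "?L (S \<inter> T)" if "?L S" "?L T" for S T
  proof -
    have "snd A ` (S \<inter> T \<inter> fst A) = snd A ` (S \<inter> fst A) \<inter> snd A ` (T \<inter> fst A)"
      if "A \<in> atlas N" for A
      using inj[OF that] unfolding inj_on_def by blast
    with that show ?thesis by auto
  qed
  have 2: "?L (\<Union>K)" if "\<forall>S\<in>K. ?L S" for K
  proof -
    have "snd A ` (\<Union>K \<inter> fst A) = (\<Union>S\<in>K. snd A ` (S \<inter> fst A))" for A :: "('m, 'e) chart"
      by blast
    with that show ?thesis by auto
  qed
  have "istopology ?L"
    unfolding istopology_def using 1 2 by blast
  then show ?thesis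
    unfolding manifold_topology_def by (simp add: topology_inverse')
qed

text \<open>\<open>f\<close> is a smooth map into \<open>N'\<close> on the open subset \<open>W\<close> of \<open>N\<close>. Continuity of \<open>f\<close> is contained
  in the openness requirement of \<open>smooth_on\<close>.\<close>

definition smooth_map ::
  "('m, 'e::euclidean_space) manifold \<Rightarrow> 'm set \<Rightarrow> ('n, 'f::euclidean_space) manifold
     \<Rightarrow> ('m \<Rightarrow> 'n) \<Rightarrow> bool" where
  "smooth_map N W N' f \<longleftrightarrow>
     W \<subseteq> points N \<and> f ` W \<subseteq> points N' \<and>
     (\<forall>A\<in>atlas N. \<forall>B\<in>atlas N'.
        smooth_on (snd A ` {p \<in> W. p \<in> fst A \<and> f p \<in> fst B}) (snd B \<circ> f \<circ> chart_inv A))"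

definition diffeomorphism ::
  "('m, 'e::euclidean_space) manifold \<Rightarrow> ('n, 'f::euclidean_space) manifold
     \<Rightarrow> ('m \<Rightarrow> 'n) \<Rightarrow> bool" where
  "diffeomorphism N N' f \<longleftrightarrow>
     bij_betw f (points N) (points N') \<and>
     smooth_map N (points N) N' f \<and>
     smooth_map N' (points N') N (inv_into (points N) f)"

definition euclidean :: "('e::euclidean_space, 'e) manifold" where
  "euclidean = \<lparr>points = UNIV, atlas = {(UNIV, \<lambda>x. x)}\<rparr>"


section \<open>Tangent bundles\<close>

text \<open>A tangent vector is a base point together with the family of its components with respect to
  all charts at the base point, related by the derivatives of the changes of coordinates. The
  components are set to \<open>0\<close> for charts which do not contain the base point. All fibrewise operations
  are componentwise.\<close>

datatype ('m, 'e) tvec = TVec (base: 'm) (comp: "('m, 'e) chart \<Rightarrow> 'e")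

definition is_tangent :: "('m, 'e::euclidean_space) manifold \<Rightarrow> ('m, 'e) tvec \<Rightarrow> bool" where
  "is_tangent N \<xi> \<longleftrightarrow>
     base \<xi> \<in> points N \<and>
     (\<forall>A. A \<notin> charts_at N (base \<xi>) \<longrightarrow> comp \<xi> A = 0) \<and>
     (\<forall>A\<in>charts_at N (base \<xi>). \<forall>B\<in>charts_at N (base \<xi>).
        comp \<xi> B = frechet_derivative (snd B \<circ> chart_inv A) (at (snd A (base \<xi>))) (comp \<xi> A))"

text \<open>The induced chart \<open>(x, y)\<close> on the tangent bundle.\<close>

definition tangent_chart ::
  "('m, 'e::euclidean_space) manifold \<Rightarrow> ('m, 'e) chart \<Rightarrow> (('m, 'e) tvec, 'e \<times> 'e) chart" where
  "tangent_chart N A =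
     ({\<xi>. is_tangent N \<xi> \<and> base \<xi> \<in> fst A}, \<lambda>\<xi>. (snd A (base \<xi>), comp \<xi> A))"

definition TB ::
  "('m, 'e::euclidean_space) manifold \<Rightarrow> (('m, 'e) tvec, 'e \<times> 'e) manifold" where
  "TB N = \<lparr>points = {\<xi>. is_tangent N \<xi>}, atlas = tangent_chart N ` atlas N\<rparr>"

definition vadd :: "('m, 'e::euclidean_space) tvec \<Rightarrow> ('m, 'e) tvec \<Rightarrow> ('m, 'e) tvec" where
  "vadd \<xi> \<eta> = TVec (base \<xi>) (\<lambda>A. comp \<xi> A + comp \<eta> A)"

definition vscale :: "real \<Rightarrow> ('m, 'e::euclidean_space) tvec \<Rightarrow> ('m, 'e) tvec" where
  "vscale s \<xi> = TVec (base \<xi>) (\<lambda>A. s *\<^sub>R comp \<xi> A)"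

text \<open>\<open>velocity N c t\<close> is \<open>c'(t)\<close>, a point of \<open>TB N\<close>.\<close>

definition velocity ::
  "('m, 'e::euclidean_space) manifold \<Rightarrow> (real \<Rightarrow> 'm) \<Rightarrow> real \<Rightarrow> ('m, 'e) tvec" where
  "velocity N c t =
     TVec (c t) (\<lambda>A. if A \<in> charts_at N (c t) then vector_derivative (snd A \<circ> c) (at t) else 0)"

text \<open>The tangent map of \<open>f\<close>. The value does not depend on the chart \<open>A\<close> at the base point.\<close>

definition tangent_map ::
  "('m, 'e::euclidean_space) manifold \<Rightarrow> ('n, 'f::euclidean_space) manifold \<Rightarrow> ('m \<Rightarrow> 'n)
     \<Rightarrow> ('m, 'e) tvec \<Rightarrow> ('n, 'f) tvec" where
  "tangent_map N N' f \<xi> =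
     (let p = base \<xi>; A = (SOME A. A \<in> charts_at N p) in
      TVec (f p) (\<lambda>B. if B \<in> charts_at N' (f p)
        then frechet_derivative (snd B \<circ> f \<circ> chart_inv A) (at (snd A p)) (comp \<xi> A) else 0))"

text \<open>\<open>slashed_T M\<close> is the slashed bundle of \<open>TM\<close>. \<open>slashed_TT M\<close> is the slashed bundle of \<open>TTM\<close>; it
  is not the complement of the zero section of \<open>TTM\<close>.\<close>

definition slashed_T :: "('m, 'e::euclidean_space) manifold \<Rightarrow> ('m, 'e) tvec set" where
  "slashed_T M = {\<xi> \<in> points (TB M). \<xi> \<noteq> TVec (base \<xi>) (\<lambda>_. 0)}"

definition slashed_TT ::
  "('m, 'e::euclidean_space) manifold \<Rightarrow> (('m, 'e) tvec, 'e \<times> 'e) tvec set" where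
  "slashed_TT M = {\<xi> \<in> points (TB (TB M)). tangent_map (TB M) M base \<xi> \<in> slashed_T M}"


section \<open>The canonical involution\<close>

definition square :: "real \<Rightarrow> (real \<times> real) set" where
  "square \<epsilon> = {-\<epsilon><..<\<epsilon>} \<times> {-\<epsilon><..<\<epsilon>}"

text \<open>\<open>dt_ds N c t s\<close> and \<open>ds_dt N c t s\<close> are the iterated velocities
  \<open>\<partial>\<^sub>t \<partial>\<^sub>s c(t,s)\<close> and \<open>\<partial>\<^sub>s \<partial>\<^sub>t c(t,s)\<close>.\<close>

definition dt_ds ::
  "('m, 'e::euclidean_space) manifold \<Rightarrow> (real \<times> real \<Rightarrow> 'm) \<Rightarrow> real \<Rightarrow> real
     \<Rightarrow> (('m, 'e) tvec, 'e \<times> 'e) tvec" where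
  "dt_ds N c t s = velocity (TB N) (\<lambda>\<tau>. velocity N (\<lambda>\<sigma>. c (\<tau>, \<sigma>)) s) t"

definition ds_dt ::
  "('m, 'e::euclidean_space) manifold \<Rightarrow> (real \<times> real \<Rightarrow> 'm) \<Rightarrow> real \<Rightarrow> real
     \<Rightarrow> (('m, 'e) tvec, 'e \<times> 'e) tvec" where
  "ds_dt N c t s = velocity (TB N) (\<lambda>\<sigma>. velocity N (\<lambda>\<tau>. c (\<tau>, \<sigma>)) t) s"

text \<open>\<open>kappa N\<close> acts on \<open>TTN\<close>. Thus the involution \<open>\<kappa>\<^sub>r\<close> of \<open>T\<^sup>rM\<close> is \<open>kappa\<close> of \<open>T\<^sup>r\<^sup>-\<^sup>2M\<close>: \<open>\<kappa>\<^sub>2\<close> is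
  \<open>kappa M\<close> and \<open>\<kappa>\<^sub>3\<close> is \<open>kappa (TB M)\<close>. The first condition only fixes the values outside of \<open>TTN\<close>.\<close>

definition kappa ::
  "('m, 'e::euclidean_space) manifold
     \<Rightarrow> (('m, 'e) tvec, 'e \<times> 'e) tvec \<Rightarrow> (('m, 'e) tvec, 'e \<times> 'e) tvec" where
  "kappa N =
     (THE k. k \<in> extensional (points (TB (TB N))) \<and>
        diffeomorphism (TB (TB N)) (TB (TB N)) k \<and>
        (\<forall>\<epsilon>>0. \<forall>c. smooth_map euclidean (square \<epsilon>) N c \<longrightarrow>
           (\<forall>(t, s)\<in>square \<epsilon>. dt_ds N c t s = k (ds_dt N c t s))))"


section \<open>Sprays\<close>

definition vector_field_on ::
  "('m, 'e::euclidean_space) manifold \<Rightarrow> 'm set \<Rightarrow> ('m \<Rightarrow> ('m, 'e) tvec) \<Rightarrow> bool" where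
  "vector_field_on N W X \<longleftrightarrow> smooth_map N W (TB N) X \<and> (\<forall>p\<in>W. base (X p) = p)"

text \<open>\<open>[X, Y]\<^sup>i = X\<^sup>j \<partial>\<^sub>jY\<^sup>i - Y\<^sup>j \<partial>\<^sub>jX\<^sup>i\<close> in every chart.\<close>

definition lie_bracket ::
  "('m, 'e::euclidean_space) manifold \<Rightarrow> ('m \<Rightarrow> ('m, 'e) tvec) \<Rightarrow> ('m \<Rightarrow> ('m, 'e) tvec)
     \<Rightarrow> 'm \<Rightarrow> ('m, 'e) tvec" where
  "lie_bracket N X Y p =
     TVec p (\<lambda>A. if A \<in> charts_at N p then
         frechet_derivative (\<lambda>x. comp (Y (chart_inv A x)) A) (at (snd A p)) (comp (X p) A)
       - frechet_derivative (\<lambda>x. comp (X (chart_inv A x)) A) (at (snd A p)) (comp (Y p) A)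
       else 0)"

definition liouville ::
  "('m, 'e::euclidean_space) manifold \<Rightarrow> ('m, 'e) tvec \<Rightarrow> (('m, 'e) tvec, 'e \<times> 'e) tvec" where
  "liouville N \<xi> = velocity (TB N) (\<lambda>s. vadd \<xi> (vscale s \<xi>)) 0"

text \<open>In the following, \<open>N\<close> is \<open>T\<^sup>r\<^sup>-\<^sup>1M\<close> and \<open>W\<close> is the slashed bundle of \<open>T\<^sup>rM\<close>, that is,
  \<open>W = slashed_T M\<close> for \<open>N = M\<close> and \<open>W = slashed_TT M\<close> for \<open>N = TB M\<close>.\<close>

definition semispray ::
  "('m, 'e::euclidean_space) manifold \<Rightarrow> ('m, 'e) tvec set
     \<Rightarrow> (('m, 'e) tvec \<Rightarrow> (('m, 'e) tvec, 'e \<times> 'e) tvec) \<Rightarrow> bool" where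
  "semispray N W S \<longleftrightarrow> vector_field_on (TB N) W S \<and> (\<forall>\<xi>\<in>W. kappa N (S \<xi>) = S \<xi>)"

definition spray ::
  "('m, 'e::euclidean_space) manifold \<Rightarrow> ('m, 'e) tvec set
     \<Rightarrow> (('m, 'e) tvec \<Rightarrow> (('m, 'e) tvec, 'e \<times> 'e) tvec) \<Rightarrow> bool" where
  "spray N W S \<longleftrightarrow>
     semispray N W S \<and> (\<forall>\<xi>\<in>W. lie_bracket (TB N) (liouville N) S \<xi> = S \<xi>)"

definition complete_lift ::
  "('m, 'e::euclidean_space) manifold \<Rightarrow> (('m, 'e) tvec \<Rightarrow> (('m, 'e) tvec, 'e \<times> 'e) tvec)
     \<Rightarrow> (('m, 'e) tvec, 'e \<times> 'e) tvec
     \<Rightarrow> ((('m, 'e) tvec, 'e \<times> 'e) tvec, ('e \<times> 'e) \<times> ('e \<times> 'e)) tvec" where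
  "complete_lift M S =
     tangent_map (TB (TB M)) (TB (TB M)) (kappa M) \<circ> kappa (TB M) \<circ>
     tangent_map (TB M) (TB (TB M)) S \<circ> kappa M"


section \<open>Geodesics and Jacobi fields\<close>

text \<open>Curves are pairs of an open interval \<open>I\<close> and a total function which is only relevant on \<open>I\<close>.\<close>

definition open_interval :: "real set \<Rightarrow> bool" where
  "open_interval I \<longleftrightarrow> I \<noteq> {} \<and> open I \<and> is_interval I"

definition geodesic_on ::
  "('m, 'e::euclidean_space) manifold \<Rightarrow> ('m, 'e) tvec set
     \<Rightarrow> (('m, 'e) tvec \<Rightarrow> (('m, 'e) tvec, 'e \<times> 'e) tvec) \<Rightarrow> real set \<Rightarrow> (real \<Rightarrow> 'm) \<Rightarrow> bool" where
  "geodesic_on N W S I c \<longleftrightarrow>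
     open_interval I \<and> smooth_map euclidean I N c \<and>
     (\<forall>t\<in>I. velocity N c t \<in> W) \<and>
     (\<forall>t\<in>I. velocity (TB N) (velocity N c) t = S (velocity N c t))"

definition geodesic ::
  "('m, 'e::euclidean_space) manifold \<Rightarrow> ('m, 'e) tvec set
     \<Rightarrow> (('m, 'e) tvec \<Rightarrow> (('m, 'e) tvec, 'e \<times> 'e) tvec) \<Rightarrow> real set \<Rightarrow> (real \<Rightarrow> 'm) \<Rightarrow> bool" where
  "geodesic N W S I c \<longleftrightarrow>
     geodesic_on N W S I c \<and>
     (\<forall>J d. geodesic_on N W S J d \<and> I \<subseteq> J \<and> (\<forall>t\<in>I. d t = c t) \<longrightarrow> J = I)"

text \<open>\<open>d\<close> on \<open>J\<close> is an orientation preserving reparameterization of \<open>c\<close> on \<open>I\<close>.\<close>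

definition reparameterization ::
  "real set \<Rightarrow> (real \<Rightarrow> 'm) \<Rightarrow> real set \<Rightarrow> (real \<Rightarrow> 'm) \<Rightarrow> bool" where
  "reparameterization I c J d \<longleftrightarrow>
     (\<exists>\<sigma>. smooth_on J \<sigma> \<and> bij_betw \<sigma> J I \<and>
        (\<forall>t\<in>J. vector_derivative \<sigma> (at t) > 0 \<and> d t = c (\<sigma> t)))"


definition same_up_to_reparameterization ::
  "(real set \<Rightarrow> (real \<Rightarrow> 'm) \<Rightarrow> bool) \<Rightarrow> (real set \<Rightarrow> (real \<Rightarrow> 'm) \<Rightarrow> bool) \<Rightarrow> bool" where
  "same_up_to_reparameterization \<C>\<^sub>1 \<C>\<^sub>2 \<longleftrightarrow>
     (\<forall>I c. \<C>\<^sub>1 I c \<longrightarrow> (\<exists>J d. \<C>\<^sub>2 J d \<and> reparameterization I c J d)) \<and>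
     (\<forall>I c. \<C>\<^sub>2 I c \<longrightarrow> (\<exists>J d. \<C>\<^sub>1 J d \<and> reparameterization I c J d))"

definition projectively_related ::
  "('m, 'e::euclidean_space) manifold \<Rightarrow> ('m, 'e) tvec set
     \<Rightarrow> (('m, 'e) tvec \<Rightarrow> (('m, 'e) tvec, 'e \<times> 'e) tvec)
     \<Rightarrow> (('m, 'e) tvec \<Rightarrow> (('m, 'e) tvec, 'e \<times> 'e) tvec) \<Rightarrow> bool" where
  "projectively_related N W S\<^sub>1 S\<^sub>2 \<longleftrightarrow>
     same_up_to_reparameterization (geodesic N W S\<^sub>1) (geodesic N W S\<^sub>2)"

text \<open>The coefficients \<open>G = (G\<^sup>i)\<close> of \<open>S = y\<^sup>i \<partial>/\<partial>x\<^sup>i - 2 G\<^sup>i \<partial>/\<partial>y\<^sup>i\<close> in the chart \<open>A\<close> of \<open>M\<close>.\<close>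

definition spray_coeff ::
  "('m, 'e::euclidean_space) manifold \<Rightarrow> (('m, 'e) tvec \<Rightarrow> (('m, 'e) tvec, 'e \<times> 'e) tvec)
     \<Rightarrow> ('m, 'e) chart \<Rightarrow> 'e \<Rightarrow> 'e \<Rightarrow> 'e" where
  "spray_coeff M S A x y =
     (let B = tangent_chart M A in (- 1 / 2) *\<^sub>R snd (comp (S (chart_inv B (x, y))) B))"

definition jacobi_field ::
  "('m, 'e::euclidean_space) manifold \<Rightarrow> (('m, 'e) tvec \<Rightarrow> (('m, 'e) tvec, 'e \<times> 'e) tvec)
     \<Rightarrow> real set \<Rightarrow> (real \<Rightarrow> ('m, 'e) tvec) \<Rightarrow> bool" where
  "jacobi_field M S I J \<longleftrightarrow>
     smooth_map euclidean I (TB M) J \<and>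
     geodesic M (slashed_T M) S I (base \<circ> J) \<and>
     (\<forall>A\<in>atlas M. \<forall>t\<in>I. base (J t) \<in> fst A \<longrightarrow>
        (let x = (\<lambda>\<tau>. snd A (base (J \<tau>)));
             y = (\<lambda>\<tau>. comp (J \<tau>) A);
             x' = (\<lambda>\<tau>. vector_derivative x (at \<tau>));
             y' = (\<lambda>\<tau>. vector_derivative y (at \<tau>));
             G = spray_coeff M S A
         in vector_derivative y' (at t)
            + 2 *\<^sub>R frechet_derivative (\<lambda>w. G (x t) w) (at (x' t)) (y' t)
            + 2 *\<^sub>R frechet_derivative (\<lambda>z. G z (x' t)) (at (x t)) (y t) = 0))"

end

(*
  A geodesic c of a spray carries the Jacobi field J(t) = t c'(t). In coordinates its velocity at
  t = 0 is (x, 0, v, v) with v = c'(0). Suppose that a reparameterization J o s, with s(s0) = 0,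
  l = s'(s0) > 0 and m = s''(s0), is a geodesic of the complete lift of a second spray. The base
  component of the geodesic equation at s0 reads m v - 2 l^2 G1(x, v) = -2 G2(x, l v). By Euler's
  identity D_y G2(x, y) y = 2 G2(x, y), the fibre component reads
  m v - 4 l^2 G1(x, v) = -4 G2(x, l v). Hence m = 0, and G1(x, v) = G2(x, v) by homogeneity. The
  sprays agree because every v is the initial velocity of a maximal geodesic, by Picard-Lindeloef and
  Zorn's lemma.
*)

theory Submission
  imports Defs
begin

section \<open>Calculus of smooth maps\<close>

text \<open>Base curves alone only show that \<open>G1 - G2\<close> is a multiple of
  \<open>v\<close>, since the freedom in \<open>m\<close> absorbs such a multiple; this is
  projective equivalence of the sprays themselves. A Jacobi field supplies a second equation. At a
  zero of the field with derivative \<open>v\<close> it has the same unknowns in another proportion: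
  the product rule doubles \<open>G1\<close>, Euler's identity doubles \<open>G2\<close>, and
  \<open>m v\<close> stays single. The field \<open>t c'(t)\<close> exists along every geodesic,
  being the variation field of the geodesics \<open>c((1 + s) t)\<close>, and it lives on the whole
  interval of \<open>c\<close>. The latter matters because the relations to be compared speak of
  maximal curves only: maximality of \<open>c\<close> makes the field a maximal geodesic of the
  lift. Most of the work brings intrinsic definitions into coordinates. The involution is a definite
  description, so a spray has a coordinate form only after existence (by symmetry of second
  derivatives) and uniqueness (every point of TTM is an iterated velocity) are shown.\<close>

lemma Ck_on_cong:
  assumes "open U" "\<And>x. x \<in> U \<Longrightarrow> f x = g x" "Ck_on k U f"
  shows "Ck_on k U g"
  using assms(2,3)
proof (induction k arbitrary: f g)
  case 0
  then show ?case by (simp cong: continuous_on_cong)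
next
  case (Suc k)
  have d: "f differentiable (at x)" if "x \<in> U" for x using Suc.prems(2) that by auto
  have "g differentiable (at x)" if "x \<in> U" for x
    using d[OF that] has_derivative_transform_within_open[of f _ x UNIV U g, OF _ assms(1) that Suc.prems(1)]
    unfolding differentiable_def by blast
  moreover have "Ck_on k U (\<lambda>x. frechet_derivative g (at x) v)" for v
  proof (rule Suc.IH)
    show "Ck_on k U (\<lambda>x. frechet_derivative f (at x) v)" using Suc.prems(2) by auto
    show "frechet_derivative f (at x) v = frechet_derivative g (at x) v" if "x \<in> U" for x
      using frechet_derivative_transform_within_open[OF d[OF that] assms(1) that] Suc.prems(1)
      by metis
  qed
  ultimately show ?case by auto
qed

lemma Ck_on_subset: "Ck_on k U f \<Longrightarrow> V \<subseteq> U \<Longrightarrow> Ck_on k V f"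
  by (induction k arbitrary: f) (auto intro: continuous_on_subset)

lemma Ck_on_SucD: "Ck_on (Suc k) U f \<Longrightarrow> Ck_on k U f"
proof (induction k arbitrary: f)
  case 0
  then show ?case
    by (auto intro!: continuous_at_imp_continuous_on differentiable_imp_continuous_within)
next
  case (Suc k)
  have "Ck_on k U (\<lambda>x. frechet_derivative f (at x) v)" for v
    by (rule Suc.IH) (use Suc.prems Ck_on.simps(2)[of "Suc k" U f] in blast)
  then show ?case using Suc.prems Ck_on.simps(2)[of "Suc k" U f] Ck_on.simps(2)[of k U f] by blast
qed

lemma Ck_on_const: "Ck_on k U (\<lambda>x. c)"
  by (induction k arbitrary: c) auto

lemma frechet_derivative_eqI: "(f has_derivative f') (at x) \<Longrightarrow> frechet_derivative f (at x) v = f' v"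
  by (metis frechet_derivative_at)

text \<open>The step case of the closure properties below: any known formula for the derivative may
  stand in for \<open>frechet_derivative\<close>, which is only a choice.\<close>

lemma Ck_on_SucI:
  assumes "open U" "\<And>x. x \<in> U \<Longrightarrow> (f has_derivative f' x) (at x)" "\<And>v. Ck_on k U (\<lambda>x. f' x v)"
  shows "Ck_on (Suc k) U f"
  unfolding Ck_on.simps
proof (intro conjI ballI allI)
  show "f differentiable (at x)" if "x \<in> U" for x
    using assms(2)[OF that] unfolding differentiable_def by blast
  show "Ck_on k U (\<lambda>x. frechet_derivative f (at x) v)" for v
    using assms(1) frechet_derivative_eqI[OF assms(2), symmetric] assms(3)[of v]
    by (rule Ck_on_cong)
qed

lemma Ck_on_Suc_derivative:
  "Ck_on (Suc k) U f \<Longrightarrow> x \<in> U \<Longrightarrow> (f has_derivative frechet_derivative f (at x)) (at x)"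
  using frechet_derivative_works by auto

lemma Ck_on_add:
  assumes "open U" "Ck_on k U f" "Ck_on k U g"
  shows "Ck_on k U (\<lambda>x. f x + g x)"
  using assms(2,3)
proof (induction k arbitrary: f g)
  case 0
  then show ?case by (auto intro: continuous_intros)
next
  case (Suc k)
  show ?case
  proof (rule Ck_on_SucI[OF assms(1)])
    show "((\<lambda>x. f x + g x) has_derivative
        (\<lambda>v. frechet_derivative f (at x) v + frechet_derivative g (at x) v)) (at x)" if "x \<in> U" for x
      by (intro has_derivative_add Ck_on_Suc_derivative[OF Suc.prems(1) that]
          Ck_on_Suc_derivative[OF Suc.prems(2) that])
    show "Ck_on k U (\<lambda>x. frechet_derivative f (at x) v + frechet_derivative g (at x) v)" for v
      by (rule Suc.IH) (use Suc.prems in auto)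
  qed
qed

lemma Ck_on_sum:
  assumes "open U" "\<And>i. i \<in> A \<Longrightarrow> Ck_on k U (f i)"
  shows "Ck_on k U (\<lambda>x. \<Sum>i\<in>A. f i x)"
  using assms(2)
  by (induction A rule: infinite_finite_induct) (auto intro: Ck_on_const Ck_on_add assms(1))

lemma Ck_on_bilinear:
  assumes "bounded_bilinear h" "open U" "Ck_on k U f" "Ck_on k U g"
  shows "Ck_on k U (\<lambda>x. h (f x) (g x))"
  using assms(3,4)
proof (induction k arbitrary: f g)
  case 0
  then show ?case using bounded_bilinear.continuous_on[OF assms(1)] by auto
next
  case (Suc k)
  interpret bounded_bilinear h by fact
  show ?case
  proof (rule Ck_on_SucI[OF assms(2)])
    fix x assume "x \<in> U"
    show "((\<lambda>x. h (f x) (g x)) has_derivative (\<lambda>v. h (f x) (frechet_derivative g (at x) v) +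
        h (frechet_derivative f (at x) v) (g x))) (at x)"
      by (rule FDERIV[OF Ck_on_Suc_derivative[OF Suc.prems(1) \<open>x \<in> U\<close>]
            Ck_on_Suc_derivative[OF Suc.prems(2) \<open>x \<in> U\<close>]])
  next
    fix v
    show "Ck_on k U (\<lambda>x. h (f x) (frechet_derivative g (at x) v) +
        h (frechet_derivative f (at x) v) (g x))"
      using Suc.prems
      by (intro Ck_on_add[OF assms(2)] Suc.IH Ck_on_SucD[OF Suc.prems(1)] Ck_on_SucD[OF Suc.prems(2)])
         auto
  qed
qed

lemma Ck_on_linear:
  fixes L :: "'a::euclidean_space \<Rightarrow> 'b::euclidean_space"
  assumes "bounded_linear L"
  shows "Ck_on k U L"
proof (cases k)
  case 0
  then show ?thesis by (simp add: assms linear_continuous_on)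
next
  case (Suc j)
  have "(L has_derivative L) (at x)" for x
    by (rule bounded_linear_imp_has_derivative[OF assms])
  then have "L differentiable (at x)" "frechet_derivative L (at x) = L" for x
    by (auto simp: differentiable_def frechet_derivative_at[symmetric])
  then show ?thesis using Suc by (auto intro: Ck_on_const)
qed

lemma Ck_on_linear_compose:
  fixes L :: "'b::euclidean_space \<Rightarrow> 'c::euclidean_space"
  assumes "bounded_linear L" "open U" "Ck_on k U f"
  shows "Ck_on k U (\<lambda>x. L (f x))"
  using assms(3)
proof (induction k arbitrary: f)
  case 0
  then show ?case using assms(1) by (simp add: bounded_linear.continuous_on)
next
  case (Suc k)
  show ?case
    by (rule Ck_on_SucI[OF assms(2)
          bounded_linear.has_derivative[OF assms(1) Ck_on_Suc_derivative[OF Suc.prems]]])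
      (use Suc in auto)
qed

text \<open>\<open>Ck_on\<close> controls the derivative in each fixed direction only. The expansion
  handles directions that vary with the point, as in the chain rule and in tangent maps.\<close>

lemma frechet_derivative_basis_expansion:
  fixes f :: "'a::euclidean_space \<Rightarrow> 'b::real_normed_vector"
  assumes "f differentiable (at x)"
  shows "frechet_derivative f (at x) v = (\<Sum>b\<in>Basis. (v \<bullet> b) *\<^sub>R frechet_derivative f (at x) b)"
proof -
  interpret linear "frechet_derivative f (at x)" by (rule linear_frechet_derivative[OF assms])
  have "frechet_derivative f (at x) v = frechet_derivative f (at x) (\<Sum>b\<in>Basis. (v \<bullet> b) *\<^sub>R b)"
    by (simp add: euclidean_representation)
  then show ?thesis by (simp add: sum scale)
qed

lemma Ck_on_compose:
  assumes "open U" "open V" "Ck_on k V f" "Ck_on k U g" "g ` U \<subseteq> V"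
  shows "Ck_on k U (\<lambda>x. f (g x))"
  using assms(3,4)
proof (induction k arbitrary: f)
  case 0
  then show ?case using assms(5) continuous_on_compose2 by auto
next
  case (Suc k)
  have gV: "g x \<in> V" if "x \<in> U" for x using assms(5) that by auto
  have d: "f differentiable (at (g x))" if "x \<in> U" for x
    using Suc.prems gV[OF that] by auto
  show ?case
  proof (rule Ck_on_SucI[OF assms(1)])
    fix x assume x: "x \<in> U"
    show "((\<lambda>x. f (g x)) has_derivative (\<lambda>v. \<Sum>b\<in>Basis. (frechet_derivative g (at x) v \<bullet> b) *\<^sub>R
        frechet_derivative f (at (g x)) b)) (at x)"
      unfolding frechet_derivative_basis_expansion[OF d[OF x], symmetric]
      using diff_chain_at[OF Ck_on_Suc_derivative[OF Suc.prems(2) x]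
          Ck_on_Suc_derivative[OF Suc.prems(1) gV[OF x]]]
      by (simp add: o_def)
  next
    fix v
    show "Ck_on k U (\<lambda>x. \<Sum>b\<in>Basis. (frechet_derivative g (at x) v \<bullet> b) *\<^sub>R
        frechet_derivative f (at (g x)) b)"
      by (intro Ck_on_sum assms(1) Ck_on_bilinear[OF bounded_bilinear_scaleR]
          Ck_on_linear_compose[OF bounded_linear_inner_left] Suc.IH Ck_on_SucD[OF Suc.prems(2)])
        (use Suc.prems in auto)
  qed
qed

lemma Ck_on_local:
  assumes "\<And>x. x \<in> U \<Longrightarrow> \<exists>V. open V \<and> x \<in> V \<and> Ck_on k V f"
  shows "Ck_on k U f"
  using assms
proof (induction k arbitrary: f)
  case 0
  show ?case unfolding Ck_on.simps
  proof (rule continuous_at_imp_continuous_on, intro ballI)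
    fix x assume "x \<in> U"
    then obtain V where "open V" "x \<in> V" "Ck_on 0 V f" using 0 by blast
    then show "isCont f x" by (simp add: continuous_on_eq_continuous_at)
  qed
next
  case (Suc k)
  show ?case unfolding Ck_on.simps
  proof (intro conjI ballI allI)
    show "f differentiable (at x)" if "x \<in> U" for x
      using Suc.prems[OF that] by auto
    show "Ck_on k U (\<lambda>x. frechet_derivative f (at x) v)" for v
    proof (rule Suc.IH)
      fix x assume "x \<in> U"
      then obtain V where "open V" "x \<in> V" "Ck_on (Suc k) V f" using Suc.prems by blast
      then show "\<exists>V. open V \<and> x \<in> V \<and> Ck_on k V (\<lambda>x. frechet_derivative f (at x) v)" by auto
    qed
  qed
qed

section \<open>Closure properties of smooth maps\<close>

lemma smooth_on_open: "smooth_on U f \<Longrightarrow> open U"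
  by (simp add: smooth_on_def)

lemma smooth_on_Ck_on: "smooth_on U f \<Longrightarrow> Ck_on k U f"
  by (simp add: smooth_on_def)

lemma smooth_on_cong: "smooth_on U f \<Longrightarrow> (\<And>x. x \<in> U \<Longrightarrow> f x = g x) \<Longrightarrow> smooth_on U g"
  unfolding smooth_on_def using Ck_on_cong by blast

lemma smooth_on_subset: "smooth_on U f \<Longrightarrow> open V \<Longrightarrow> V \<subseteq> U \<Longrightarrow> smooth_on V f"
  unfolding smooth_on_def using Ck_on_subset by blast

lemma smooth_on_local:
  assumes "\<And>x. x \<in> U \<Longrightarrow> \<exists>V. x \<in> V \<and> V \<subseteq> U \<and> smooth_on V f"
  shows "smooth_on U f"
  unfolding smooth_on_def
proof (intro conjI allI)
  show "open U"
  proof (subst open_subopen, intro ballI)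
    fix x assume "x \<in> U"
    then obtain V where "x \<in> V" "V \<subseteq> U" "smooth_on V f" using assms by blast
    then show "\<exists>T. open T \<and> x \<in> T \<and> T \<subseteq> U" unfolding smooth_on_def by blast
  qed
  show "Ck_on k U f" for k
  proof (rule Ck_on_local)
    fix x assume "x \<in> U"
    then obtain V where "x \<in> V" "V \<subseteq> U" "smooth_on V f" using assms by blast
    then show "\<exists>V. open V \<and> x \<in> V \<and> Ck_on k V f" unfolding smooth_on_def by blast
  qed
qed

lemma smooth_on_const: "open U \<Longrightarrow> smooth_on U (\<lambda>x. c)"
  by (simp add: smooth_on_def Ck_on_const)

lemma smooth_on_linear: "open U \<Longrightarrow> bounded_linear L \<Longrightarrow> smooth_on U L"
  by (simp add: smooth_on_def Ck_on_linear)

lemma smooth_on_linear_compose: "bounded_linear L \<Longrightarrow> smooth_on U f \<Longrightarrow> smooth_on U (\<lambda>x. L (f x))"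
  by (simp add: smooth_on_def Ck_on_linear_compose)

lemma smooth_on_ident: "open U \<Longrightarrow> smooth_on U (\<lambda>x. x)"
  by (rule smooth_on_linear) (auto intro: bounded_linear_ident)

lemma smooth_on_add: "smooth_on U f \<Longrightarrow> smooth_on U g \<Longrightarrow> smooth_on U (\<lambda>x. f x + g x)"
  by (simp add: smooth_on_def Ck_on_add)

lemma smooth_on_Pair:
  assumes "smooth_on U f" "smooth_on U g"
  shows "smooth_on U (\<lambda>x. (f x, g x))"
proof -
  have "smooth_on U (\<lambda>x. (f x, 0) + (0, g x))"
    by (intro smooth_on_add smooth_on_linear_compose[OF _ assms(1), of "\<lambda>x. (x, 0)"]
        smooth_on_linear_compose[OF _ assms(2), of "\<lambda>x. (0, x)"] bounded_linear_Pair
        bounded_linear_ident bounded_linear_zero)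
  then show ?thesis by simp
qed

lemma smooth_on_fst: "smooth_on U f \<Longrightarrow> smooth_on U (\<lambda>x. fst (f x))"
  by (rule smooth_on_linear_compose[OF bounded_linear_fst])

lemma smooth_on_snd: "smooth_on U f \<Longrightarrow> smooth_on U (\<lambda>x. snd (f x))"
  by (rule smooth_on_linear_compose[OF bounded_linear_snd])

lemma smooth_on_scaleR:
  "smooth_on U f \<Longrightarrow> smooth_on U g \<Longrightarrow> smooth_on U (\<lambda>x. f x *\<^sub>R g x)"
  by (simp add: smooth_on_def Ck_on_bilinear[OF bounded_bilinear_scaleR])

lemma smooth_on_compose:
  assumes "smooth_on V f" "smooth_on U g" "\<And>x. x \<in> U \<Longrightarrow> g x \<in> V"
  shows "smooth_on U (\<lambda>x. f (g x))"
proof -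
  have "Ck_on k U (\<lambda>x. f (g x))" for k
    by (rule Ck_on_compose[OF smooth_on_open[OF assms(2)] smooth_on_open[OF assms(1)]
          smooth_on_Ck_on[OF assms(1)] smooth_on_Ck_on[OF assms(2)]]) (use assms(3) in blast)
  then show ?thesis using smooth_on_open[OF assms(2)] by (simp add: smooth_on_def)
qed

lemma smooth_on_differentiable: "smooth_on U f \<Longrightarrow> x \<in> U \<Longrightarrow> f differentiable (at x)"
  using smooth_on_Ck_on[of U f "Suc 0"] by simp

lemma smooth_on_has_derivative:
  "smooth_on U f \<Longrightarrow> x \<in> U \<Longrightarrow> (f has_derivative frechet_derivative f (at x)) (at x)"
  using smooth_on_differentiable frechet_derivative_works by blast

lemma smooth_on_continuous_on: "smooth_on U f \<Longrightarrow> continuous_on U f"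
  using smooth_on_Ck_on[of U f 0] by simp

lemma smooth_on_frechet_derivative:
  assumes "smooth_on U f"
  shows "smooth_on U (\<lambda>x. frechet_derivative f (at x) v)"
proof -
  have "Ck_on k U (\<lambda>x. frechet_derivative f (at x) v)" for k
    using smooth_on_Ck_on[OF assms, of "Suc k"] by simp
  then show ?thesis using smooth_on_open[OF assms] by (simp add: smooth_on_def)
qed

lemma smooth_on_sum:
  assumes "open U" "\<And>i. i \<in> A \<Longrightarrow> smooth_on U (f i)"
  shows "smooth_on U (\<lambda>x. \<Sum>i\<in>A. f i x)"
  using assms unfolding smooth_on_def by (auto intro: Ck_on_sum)

text \<open>The vector part of a tangent map, with base point and vector both moving; it gives
  smoothness of the changes of coordinates of tangent bundles.\<close>

lemma smooth_on_tangent: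
  assumes f: "smooth_on U f" and g: "smooth_on W g" and h: "smooth_on W h"
    and gU: "\<And>z. z \<in> W \<Longrightarrow> g z \<in> U"
  shows "smooth_on W (\<lambda>z. frechet_derivative f (at (g z)) (h z))"
proof (rule smooth_on_cong)
  show "smooth_on W (\<lambda>z. \<Sum>b\<in>Basis. (h z \<bullet> b) *\<^sub>R frechet_derivative f (at (g z)) b)"
    by (intro smooth_on_sum smooth_on_open[OF g] smooth_on_scaleR
        smooth_on_linear_compose[OF bounded_linear_inner_left h]
        smooth_on_compose[OF smooth_on_frechet_derivative[OF f] g gU])
qed (rule frechet_derivative_basis_expansion[symmetric, OF smooth_on_differentiable[OF f gU]])

lemma smooth_on_has_vector_derivative:
  fixes f :: "real \<Rightarrow> 'a::euclidean_space"
  assumes "smooth_on U f" "t \<in> U"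
  shows "(f has_vector_derivative vector_derivative f (at t)) (at t)"
  using assms smooth_on_differentiable vector_derivative_works by blast

lemma smooth_on_vector_derivative:
  fixes f :: "real \<Rightarrow> 'a::euclidean_space"
  assumes "smooth_on U f"
  shows "smooth_on U (\<lambda>t. vector_derivative f (at t))"
  by (rule smooth_on_cong[OF smooth_on_frechet_derivative[OF assms, of 1]])
    (simp add: frechet_derivative_eq_vector_derivative smooth_on_differentiable[OF assms])

lemma vector_derivative_cong_open:
  assumes "open U" "t \<in> U" "\<And>s. s \<in> U \<Longrightarrow> f s = g s"
  shows "vector_derivative f (at t) = vector_derivative g (at t)"
  by (rule vector_derivative_cong_eq) (use assms in \<open>auto simp: eventually_nhds\<close>)

section \<open>Symmetry of second derivatives\<close>

lemma has_real_derivative_along_line: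
  assumes "(f has_derivative f') (at (x + s *\<^sub>R v))"
  shows "((\<lambda>s. f (x + s *\<^sub>R v)) has_real_derivative f' v) (at s)"
proof -
  interpret bounded_linear f' using assms by (rule has_derivative_bounded_linear)
  have "((\<lambda>s. x + s *\<^sub>R v) has_derivative (\<lambda>h. h *\<^sub>R v)) (at s)"
    by (auto intro!: derivative_eq_intros)
  from diff_chain_at[OF this assms]
  show ?thesis by (simp add: has_field_derivative_def o_def scaleR mult.commute[of _ "f' v"])
qed

text \<open>Two applications of the mean value theorem: first in direction \<open>v\<close> to the
  difference of \<open>f\<close> along two parallel edges, then in direction \<open>w\<close> to the
  resulting difference of first derivatives.\<close>

lemma second_difference_mean_value:
  fixes f :: "'a::euclidean_space \<Rightarrow> real"
  assumes f: "smooth_on U f" and h: "h > 0"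
    and U: "\<And>r s. 0 \<le> r \<Longrightarrow> r \<le> h \<Longrightarrow> 0 \<le> s \<Longrightarrow> s \<le> h \<Longrightarrow> x + r *\<^sub>R v + s *\<^sub>R w \<in> U"
  shows "\<exists>r s. 0 \<le> r \<and> r \<le> h \<and> 0 \<le> s \<and> s \<le> h \<and>
    f (x + h *\<^sub>R v + h *\<^sub>R w) - f (x + h *\<^sub>R v) - f (x + h *\<^sub>R w) + f x =
    h * (h * frechet_derivative (\<lambda>z. frechet_derivative f (at z) v) (at (x + r *\<^sub>R v + s *\<^sub>R w)) w)"
proof -
  let ?D = "\<lambda>z. frechet_derivative f (at z) v"
  have line: "((\<lambda>r. f (y + r *\<^sub>R v)) has_real_derivative ?D (y + r *\<^sub>R v)) (at r)"
    if "y + r *\<^sub>R v \<in> U" for r y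
    by (rule has_real_derivative_along_line[OF smooth_on_has_derivative[OF f that]])
  have "((\<lambda>r. f ((x + h *\<^sub>R w) + r *\<^sub>R v) - f (x + r *\<^sub>R v)) has_real_derivative
      ?D ((x + h *\<^sub>R w) + r *\<^sub>R v) - ?D (x + r *\<^sub>R v)) (at r)" if "0 \<le> r" "r \<le> h" for r
    using U[of r h] U[of r 0] h that by (intro DERIV_diff line) (auto simp: algebra_simps)
  from MVT2[OF h this] obtain r where r: "0 < r" "r < h"
    "f ((x + h *\<^sub>R w) + h *\<^sub>R v) - f (x + h *\<^sub>R v) - (f ((x + h *\<^sub>R w)) - f x) =
     h * (?D ((x + h *\<^sub>R w) + r *\<^sub>R v) - ?D (x + r *\<^sub>R v))"
    by auto
  have "((\<lambda>s. ?D ((x + r *\<^sub>R v) + s *\<^sub>R w)) has_real_derivative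
      frechet_derivative ?D (at ((x + r *\<^sub>R v) + s *\<^sub>R w)) w) (at s)" if "0 \<le> s" "s \<le> h" for s
    using U[of r s] r that
    by (intro has_real_derivative_along_line smooth_on_has_derivative[OF
          smooth_on_frechet_derivative[OF f]]) auto
  from MVT2[OF h this] obtain s where s: "0 < s" "s < h"
    "?D ((x + r *\<^sub>R v) + h *\<^sub>R w) - ?D (x + r *\<^sub>R v) =
     h * frechet_derivative ?D (at ((x + r *\<^sub>R v) + s *\<^sub>R w)) w"
    by auto
  have e: "f (x + h *\<^sub>R v + h *\<^sub>R w) - f (x + h *\<^sub>R v) - f (x + h *\<^sub>R w) + f x =
    f ((x + h *\<^sub>R w) + h *\<^sub>R v) - f (x + h *\<^sub>R v) - (f ((x + h *\<^sub>R w)) - f x)"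
    by (simp add: algebra_simps)
  have e': "(x + h *\<^sub>R w) + r *\<^sub>R v = (x + r *\<^sub>R v) + h *\<^sub>R w" by (simp add: algebra_simps)
  show ?thesis
    by (intro exI[of _ r] exI[of _ s] conjI) (use r s in \<open>simp_all only: e r(3) e' s(3) less_imp_le\<close>)
qed

text \<open>The second difference over a parallelogram is symmetric in \<open>v\<close> and
  \<open>w\<close>. Hence the two mixed derivatives take a common value at two points arbitrarily
  close to \<open>x\<close>, and continuity at \<open>x\<close> finishes.\<close>

lemma frechet_derivative_symmetric_real:
  fixes f :: "'a::euclidean_space \<Rightarrow> real"
  assumes f: "smooth_on U f" and x: "x \<in> U"
  shows "frechet_derivative (\<lambda>z. frechet_derivative f (at z) v) (at x) w =
         frechet_derivative (\<lambda>z. frechet_derivative f (at z) w) (at x) v" (is "?A x = ?B x")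
proof -
  have "\<bar>?A x - ?B x\<bar> \<le> e" if "e > 0" for e
  proof -
    have cont: "isCont ?A x" "isCont ?B x"
      using x smooth_on_continuous_on[OF smooth_on_frechet_derivative[OF smooth_on_frechet_derivative[OF f]]]
        smooth_on_open[OF f] by (auto simp: continuous_on_eq_continuous_at)
    have "\<forall>\<^sub>F z in nhds x. dist (?A z) (?A x) < e / 2 \<and> dist (?B z) (?B x) < e / 2 \<and> z \<in> U"
      using cont \<open>e > 0\<close> x smooth_on_open[OF f]
      by (intro eventually_conj tendstoD[where e = "e / 2"])
        (auto simp: eventually_nhds_in_open continuous_at
          intro: tendsto_at_iff_tendsto_nhds[THEN iffD1])
    then obtain d where d: "d > 0"
      "\<And>z. dist z x < d \<Longrightarrow> dist (?A z) (?A x) < e / 2 \<and> dist (?B z) (?B x) < e / 2 \<and> z \<in> U"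
      unfolding eventually_nhds_metric by blast
    \<comment> \<open>Keeps the whole parallelogram within \<open>d / 2\<close> of \<open>x\<close>.
      The summand 1 keeps the denominator positive when \<open>v\<close> and \<open>w\<close>
      vanish.\<close>
    define h where "h = d / 2 / (norm v + norm w + 1)"
    have nn: "norm v + norm w + 1 > 0" by (simp add: add_nonneg_pos)
    have h: "h > 0" using d nn by (simp add: h_def)
    have near: "dist (x + r *\<^sub>R v + s *\<^sub>R w) x < d"
      if "0 \<le> r" "r \<le> h" "0 \<le> s" "s \<le> h" for r s
    proof -
      have "dist (x + r *\<^sub>R v + s *\<^sub>R w) x = norm (r *\<^sub>R v + s *\<^sub>R w)" by (simp add: dist_norm)
      also have "\<dots> \<le> norm (r *\<^sub>R v) + norm (s *\<^sub>R w)" by (rule norm_triangle_ineq)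
      also have "\<dots> \<le> h * norm v + h * norm w"
        using that by (auto intro!: add_mono mult_right_mono)
      also have "\<dots> \<le> h * (norm v + norm w + 1)" using h by (simp add: algebra_simps)
      also have "\<dots> = d / 2"
        unfolding h_def by (rule nonzero_eq_divide_eq[THEN iffD1]) (use nn in auto)
      finally show ?thesis using d(1) by simp
    qed
    obtain r s where rs: "0 \<le> r" "r \<le> h" "0 \<le> s" "s \<le> h"
      "f (x + h *\<^sub>R v + h *\<^sub>R w) - f (x + h *\<^sub>R v) - f (x + h *\<^sub>R w) + f x =
       h * (h * ?A (x + r *\<^sub>R v + s *\<^sub>R w))"
      using second_difference_mean_value[OF f h, of x v w] near d(2) by blast
    have near': "dist (x + r *\<^sub>R w + s *\<^sub>R v) x < d"
      if "0 \<le> r" "r \<le> h" "0 \<le> s" "s \<le> h" for r s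
      using near[of s r] that by (simp add: algebra_simps)
    obtain r' s' where rs': "0 \<le> r'" "r' \<le> h" "0 \<le> s'" "s' \<le> h"
      "f (x + h *\<^sub>R w + h *\<^sub>R v) - f (x + h *\<^sub>R w) - f (x + h *\<^sub>R v) + f x =
       h * (h * ?B (x + r' *\<^sub>R w + s' *\<^sub>R v))"
      using second_difference_mean_value[OF f h, of x w v] near' d(2) by blast
    have "f (x + h *\<^sub>R w + h *\<^sub>R v) - f (x + h *\<^sub>R w) - f (x + h *\<^sub>R v) + f x =
       f (x + h *\<^sub>R v + h *\<^sub>R w) - f (x + h *\<^sub>R v) - f (x + h *\<^sub>R w) + f x"
      by (simp add: algebra_simps)
    then have "?A (x + r *\<^sub>R v + s *\<^sub>R w) = ?B (x + r' *\<^sub>R w + s' *\<^sub>R v)"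
      using rs(5) rs'(5) h by simp
    moreover have "dist (?A (x + r *\<^sub>R v + s *\<^sub>R w)) (?A x) < e / 2"
      "dist (?B (x + r' *\<^sub>R w + s' *\<^sub>R v)) (?B x) < e / 2"
      using d(2) near[OF rs(1-4)] near'[OF rs'(1-4)] by blast+
    ultimately show ?thesis unfolding dist_real_def by linarith
  qed
  then have "\<bar>?A x - ?B x\<bar> \<le> 0" by (rule field_le_epsilon) simp
  then show ?thesis by simp
qed

lemma frechet_derivative_symmetric:
  fixes f :: "'a::euclidean_space \<Rightarrow> 'b::euclidean_space"
  assumes f: "smooth_on U f" and x: "x \<in> U"
  shows "frechet_derivative (\<lambda>z. frechet_derivative f (at z) v) (at x) w =
         frechet_derivative (\<lambda>z. frechet_derivative f (at z) w) (at x) v"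
proof (rule euclidean_eqI)
  fix b :: 'b
  have 1: "frechet_derivative (\<lambda>z. g z \<bullet> b) (at z) u = frechet_derivative g (at z) u \<bullet> b"
    if "smooth_on U g" "z \<in> U" for g :: "'a \<Rightarrow> 'b" and z u
    by (rule frechet_derivative_eqI)
      (rule bounded_linear.has_derivative[OF bounded_linear_inner_left smooth_on_has_derivative[OF that]])
  have 2: "frechet_derivative (\<lambda>z. frechet_derivative (\<lambda>z. f z \<bullet> b) (at z) u) (at x) u' =
      frechet_derivative (\<lambda>z. frechet_derivative f (at z) u) (at x) u' \<bullet> b" for u u'
  proof -
    have "frechet_derivative (\<lambda>z. frechet_derivative f (at z) u \<bullet> b) (at x) =
      frechet_derivative (\<lambda>z. frechet_derivative (\<lambda>z. f z \<bullet> b) (at z) u) (at x)"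
      by (rule frechet_derivative_transform_within_open[OF _ smooth_on_open[OF f] x])
        (use 1[OF f] in \<open>auto intro!: smooth_on_differentiable[OF _ x] smooth_on_frechet_derivative[OF f]
          smooth_on_linear_compose[OF bounded_linear_inner_left]\<close>)
    then show ?thesis using 1[OF smooth_on_frechet_derivative[OF f] x] by metis
  qed
  show "frechet_derivative (\<lambda>z. frechet_derivative f (at z) v) (at x) w \<bullet> b =
      frechet_derivative (\<lambda>z. frechet_derivative f (at z) w) (at x) v \<bullet> b"
    unfolding 2[symmetric]
    by (rule frechet_derivative_symmetric_real[OF
        smooth_on_linear_compose[OF bounded_linear_inner_left f] x])
qed

section \<open>Charts and tangent bundles\<close>

text \<open>The conditions on the atlas alone, in a form that passes from \<open>N\<close> to
  \<open>TB N\<close> and so to every iterated tangent bundle.\<close>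

definition charted :: "('m, 'e::euclidean_space) manifold \<Rightarrow> bool" where
  "charted N \<longleftrightarrow>
     (\<Union>A\<in>atlas N. fst A) = points N \<and>
     (\<forall>A\<in>atlas N. inj_on (snd A) (fst A) \<and> open (snd A ` fst A)) \<and>
     (\<forall>A\<in>atlas N. \<forall>B\<in>atlas N.
        smooth_on (snd A ` (fst A \<inter> fst B)) (snd B \<circ> chart_inv A))"

definition chart_image :: "('m, 'e) chart \<Rightarrow> 'e set" where
  "chart_image A = snd A ` fst A"

text \<open>The domain of the change of coordinates from \<open>A\<close> to \<open>B\<close>, as a
  subset of the coordinate space of \<open>A\<close>.\<close>

definition overlap :: "('m, 'e) chart \<Rightarrow> ('m, 'e) chart \<Rightarrow> 'e set" where
  "overlap A B = {x \<in> chart_image A. chart_inv A x \<in> fst B}"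

lemma smooth_manifold_charted: "smooth_manifold N \<Longrightarrow> charted N"
  by (auto simp: smooth_manifold_def charted_def)

lemma chart_inv_in: "x \<in> chart_image A \<Longrightarrow> chart_inv A x \<in> fst A"
  by (simp add: chart_image_def chart_inv_def inv_into_into)

lemma snd_chart_inv: "x \<in> chart_image A \<Longrightarrow> snd A (chart_inv A x) = x"
  by (simp add: chart_image_def chart_inv_def f_inv_into_f)

lemma snd_in_chart_image: "p \<in> fst A \<Longrightarrow> snd A p \<in> chart_image A"
  by (simp add: chart_image_def)

lemma chart_inv_snd: "charted N \<Longrightarrow> A \<in> atlas N \<Longrightarrow> p \<in> fst A \<Longrightarrow> chart_inv A (snd A p) = p"
  by (simp add: charted_def chart_inv_def)

lemma chart_inv_inject:
  "x \<in> chart_image A \<Longrightarrow> y \<in> chart_image A \<Longrightarrow> chart_inv A x = chart_inv A y \<longleftrightarrow> x = y"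
  by (metis snd_chart_inv)

lemma open_chart_image: "charted N \<Longrightarrow> A \<in> atlas N \<Longrightarrow> open (chart_image A)"
  by (simp add: charted_def chart_image_def)

lemma fst_subset_points: "charted N \<Longrightarrow> A \<in> atlas N \<Longrightarrow> fst A \<subseteq> points N"
  by (auto simp: charted_def)

lemma point_in_chart: "charted N \<Longrightarrow> p \<in> points N \<Longrightarrow> \<exists>A\<in>atlas N. p \<in> fst A"
  by (auto simp: charted_def)

lemma overlap_image:
  "charted N \<Longrightarrow> A \<in> atlas N \<Longrightarrow> snd A ` {p \<in> fst A. P p} = {x \<in> chart_image A. P (chart_inv A x)}"
  by (auto simp: chart_inv_snd snd_in_chart_image chart_inv_in snd_chart_inv
      intro!: image_eqI[of x "snd A" "chart_inv A x" for x])

lemma smooth_on_transition: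
  assumes "charted N" "A \<in> atlas N" "B \<in> atlas N"
  shows "smooth_on (overlap A B) (snd B \<circ> chart_inv A)"
proof -
  have "snd A ` (fst A \<inter> fst B) = overlap A B"
    using overlap_image[OF assms(1,2), of "\<lambda>p. p \<in> fst B"] by (simp add: overlap_def Int_def)
  then show ?thesis using assms unfolding charted_def by metis
qed

lemma open_overlap: "charted N \<Longrightarrow> A \<in> atlas N \<Longrightarrow> B \<in> atlas N \<Longrightarrow> open (overlap A B)"
  using smooth_on_transition smooth_on_open by blast

lemma overlap_transition:
  "charted N \<Longrightarrow> A \<in> atlas N \<Longrightarrow> B \<in> atlas N \<Longrightarrow> x \<in> overlap A B \<Longrightarrow>
    chart_inv B (snd B (chart_inv A x)) = chart_inv A x"
  by (simp add: overlap_def chart_inv_snd)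

lemma transition_derivative_self:
  assumes "charted N" "A \<in> atlas N" "x \<in> chart_image A"
  shows "frechet_derivative (snd A \<circ> chart_inv A) (at x) v = v"
proof -
  have "frechet_derivative (\<lambda>x. x) (at x) = frechet_derivative (snd A \<circ> chart_inv A) (at x)"
    by (rule frechet_derivative_transform_within_open[OF _ open_chart_image[OF assms(1,2)] assms(3)])
      (auto simp: snd_chart_inv)
  then show ?thesis by (metis frechet_derivative_ident)
qed

text \<open>The chain rule for the cocycle of coordinate changes. It is exactly the compatibility
  that \<open>is_tangent\<close> demands of the components of a tangent vector.\<close>

lemma transition_derivative_chain:
  assumes "charted N" "A \<in> atlas N" "B \<in> atlas N" "C \<in> atlas N"
    and "x \<in> overlap A B" "x \<in> overlap A C"
  shows "frechet_derivative (snd C \<circ> chart_inv B) (at (snd B (chart_inv A x)))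
      (frechet_derivative (snd B \<circ> chart_inv A) (at x) v) =
    frechet_derivative (snd C \<circ> chart_inv A) (at x) v"
proof -
  let ?g = "snd B \<circ> chart_inv A" and ?f = "snd C \<circ> chart_inv B"
  have gx: "?g x \<in> overlap B C"
    using assms(5,6) by (auto simp: overlap_def snd_in_chart_image chart_inv_snd[OF assms(1,3)])
  have dg: "?g differentiable (at x)"
    using smooth_on_differentiable[OF smooth_on_transition[OF assms(1-3)] assms(5)] .
  have df: "?f differentiable (at (?g x))"
    using smooth_on_differentiable[OF smooth_on_transition[OF assms(1,3,4)] gx] .
  have "frechet_derivative (?f \<circ> ?g) (at x) = frechet_derivative (snd C \<circ> chart_inv A) (at x)"
  proof (rule frechet_derivative_transform_within_open)
    show "?f \<circ> ?g differentiable at x" by (rule differentiable_chain_at[OF dg df])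
    show "open (overlap A B)" by (rule open_overlap[OF assms(1-3)])
    show "x \<in> overlap A B" by fact
    show "(?f \<circ> ?g) z = (snd C \<circ> chart_inv A) z" if "z \<in> overlap A B" for z
      using overlap_transition[OF assms(1-3) that] by simp
  qed
  then show ?thesis
    using frechet_derivative_compose[OF dg df] by (metis comp_apply)
qed

section \<open>The tangent bundle as a manifold\<close>

text \<open>The inverse of the tangent chart of \<open>A\<close> in explicit form, whereas
  \<open>chart_inv\<close> obtains it by choice.\<close>

definition tangent_vector ::
  "('m, 'e::euclidean_space) manifold \<Rightarrow> ('m, 'e) chart \<Rightarrow> 'e \<Rightarrow> 'e \<Rightarrow> ('m, 'e) tvec" where
  "tangent_vector N A x v = TVec (chart_inv A x)
     (\<lambda>B. if B \<in> charts_at N (chart_inv A x)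
       then frechet_derivative (snd B \<circ> chart_inv A) (at x) v else 0)"

lemma base_tangent_vector: "base (tangent_vector N A x v) = chart_inv A x"
  by (simp add: tangent_vector_def)

lemma comp_tangent_vector:
  "comp (tangent_vector N A x v) B = (if B \<in> charts_at N (chart_inv A x)
    then frechet_derivative (snd B \<circ> chart_inv A) (at x) v else 0)"
  by (simp add: tangent_vector_def)

lemma is_tangent_tangent_vector:
  assumes "charted N" "A \<in> atlas N" "x \<in> chart_image A"
  shows "is_tangent N (tangent_vector N A x v)"
proof -
  have 1: "chart_inv A x \<in> points N"
    using fst_subset_points[OF assms(1,2)] chart_inv_in[OF assms(3)] by blast
  have 2: "comp (tangent_vector N A x v) C =
      frechet_derivative (snd C \<circ> chart_inv B) (at (snd B (chart_inv A x))) (comp (tangent_vector N A x v) B)"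
    if BC: "B \<in> charts_at N (chart_inv A x)" "C \<in> charts_at N (chart_inv A x)" for B C
  proof -
    have "B \<in> atlas N" "C \<in> atlas N" "x \<in> overlap A B" "x \<in> overlap A C"
      using BC assms(3) by (simp_all add: charts_at_def overlap_def)
    then show ?thesis
      using BC by (simp only: comp_tangent_vector if_True transition_derivative_chain[OF assms(1,2)])
  qed
  show ?thesis
    unfolding is_tangent_def base_tangent_vector
  proof (intro conjI ballI allI impI)
    show "comp (tangent_vector N A x v) B = 0" if "B \<notin> charts_at N (chart_inv A x)" for B
      using that by (simp add: comp_tangent_vector)
  qed (fact 1 2)+
qed

lemma is_tangent_comp:
  "is_tangent N \<xi> \<Longrightarrow> A \<in> charts_at N (base \<xi>) \<Longrightarrow> B \<in> charts_at N (base \<xi>) \<Longrightarrow>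
    comp \<xi> B = frechet_derivative (snd B \<circ> chart_inv A) (at (snd A (base \<xi>))) (comp \<xi> A)"
  unfolding is_tangent_def by blast

lemma is_tangent_comp_0: "is_tangent N \<xi> \<Longrightarrow> B \<notin> charts_at N (base \<xi>) \<Longrightarrow> comp \<xi> B = 0"
  unfolding is_tangent_def by blast

lemma tangent_eq_tangent_vector:
  assumes "charted N" "A \<in> atlas N" "is_tangent N \<xi>" "base \<xi> \<in> fst A"
  shows "\<xi> = tangent_vector N A (snd A (base \<xi>)) (comp \<xi> A)"
proof (rule tvec.expand, intro conjI ext)
  show "base \<xi> = base (tangent_vector N A (snd A (base \<xi>)) (comp \<xi> A))"
    using assms by (simp add: base_tangent_vector chart_inv_snd)
  have "A \<in> charts_at N (base \<xi>)" using assms by (simp add: charts_at_def)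
  then show "comp \<xi> B = comp (tangent_vector N A (snd A (base \<xi>)) (comp \<xi> A)) B" for B
    using is_tangent_comp[OF assms(3), of A B] is_tangent_comp_0[OF assms(3), of B]
    unfolding comp_tangent_vector chart_inv_snd[OF assms(1,2,4)] by presburger
qed

lemma chart_image_tangent_chart:
  assumes "charted N" "A \<in> atlas N"
  shows "chart_image (tangent_chart N A) = chart_image A \<times> UNIV"
proof -
  have "(x, v) \<in> chart_image (tangent_chart N A)" if "x \<in> chart_image A" for x v
    unfolding chart_image_def tangent_chart_def
    by (rule image_eqI[of _ _ "tangent_vector N A x v"])
      (use assms that in \<open>auto simp: is_tangent_tangent_vector base_tangent_vector comp_tangent_vector snd_chart_inv
        chart_inv_in charts_at_def transition_derivative_self\<close>)
  then show ?thesis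
    by (auto simp: chart_image_def tangent_chart_def)
qed

lemma inj_on_tangent_chart:
  assumes "charted N" "A \<in> atlas N"
  shows "inj_on (snd (tangent_chart N A)) (fst (tangent_chart N A))"
  using tangent_eq_tangent_vector[OF assms]
  by (intro inj_onI) (auto simp: tangent_chart_def, metis)

lemma chart_inv_tangent_chart:
  assumes "charted N" "A \<in> atlas N" "x \<in> chart_image A"
  shows "chart_inv (tangent_chart N A) (x, v) = tangent_vector N A x v"
  unfolding chart_inv_def
  by (rule inv_into_f_eq[OF inj_on_tangent_chart[OF assms(1,2)]])
    (use assms in \<open>auto simp: tangent_chart_def is_tangent_tangent_vector base_tangent_vector comp_tangent_vector
      snd_chart_inv chart_inv_in charts_at_def transition_derivative_self\<close>)

lemma base_chart_inv:
  "charted N \<Longrightarrow> A \<in> atlas N \<Longrightarrow> x \<in> chart_image A \<Longrightarrow>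
    base (chart_inv (tangent_chart N A) (x, v)) = chart_inv A x"
  by (simp add: chart_inv_tangent_chart tangent_vector_def)

lemma comp_chart_inv:
  "charted N \<Longrightarrow> A \<in> atlas N \<Longrightarrow> x \<in> chart_image A \<Longrightarrow>
    comp (chart_inv (tangent_chart N A) (x, v)) B =
      (if B \<in> charts_at N (chart_inv A x)
       then frechet_derivative (snd B \<circ> chart_inv A) (at x) v else 0)"
  by (simp add: chart_inv_tangent_chart tangent_vector_def)

lemma comp_chart_inv_self:
  "charted N \<Longrightarrow> A \<in> atlas N \<Longrightarrow> x \<in> chart_image A \<Longrightarrow>
    comp (chart_inv (tangent_chart N A) (x, v)) A = v"
  by (simp add: comp_chart_inv charts_at_def chart_inv_in transition_derivative_self)

lemma overlap_tangent_chart: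
  assumes "charted N" "A \<in> atlas N"
  shows "overlap (tangent_chart N A) (tangent_chart N B) = overlap A B \<times> UNIV"
  unfolding overlap_def chart_image_tangent_chart[OF assms]
  using assms by (auto simp: base_chart_inv tangent_chart_def[of N B] chart_inv_tangent_chart
      is_tangent_tangent_vector base_tangent_vector)

lemma snd_tangent_chart_chart_inv:
  assumes "charted N" "A \<in> atlas N" "B \<in> atlas N" "x \<in> overlap A B"
  shows "snd (tangent_chart N B) (chart_inv (tangent_chart N A) (x, v)) =
    (snd B (chart_inv A x), frechet_derivative (snd B \<circ> chart_inv A) (at x) v)"
  using assms by (auto simp: tangent_chart_def[of N B] base_chart_inv overlap_def comp_chart_inv charts_at_def)

lemma TB_simps [simp]:
  "points (TB N) = {\<xi>. is_tangent N \<xi>}" "atlas (TB N) = tangent_chart N ` atlas N"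
  by (auto simp: TB_def)

text \<open>In tangent charts a change of coordinates \<open>\<phi>\<close> becomes
  \<open>(x, y) \<mapsto> (\<phi> x, D\<phi>(x) y)\<close>, which is smooth by
  \<open>smooth_on_tangent\<close>. The conclusion has the form of the hypothesis, so everything
  proved for \<open>N\<close> holds for \<open>TB N\<close> and \<open>TB (TB N)\<close>.\<close>

lemma charted_TB:
  assumes "charted N"
  shows "charted (TB N)"
proof -
  have "(\<Union>A\<in>atlas (TB N). fst A) = points (TB N)"
  proof -
    have "\<exists>A\<in>atlas N. base \<xi> \<in> fst A" if "is_tangent N \<xi>" for \<xi>
      using point_in_chart[OF assms] that by (auto simp: is_tangent_def)
    then show ?thesis by (auto simp: tangent_chart_def)
  qed
  moreover have "smooth_on (snd (tangent_chart N A) ` (fst (tangent_chart N A) \<inter> fst (tangent_chart N B)))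
      (snd (tangent_chart N B) \<circ> chart_inv (tangent_chart N A))"
    if A: "A \<in> atlas N" and B: "B \<in> atlas N" for A B
  proof -
    let ?S = "overlap A B \<times> (UNIV :: 'b set)"
    note t = smooth_on_transition[OF assms A B]
    have open_S: "open ?S" using open_overlap[OF assms A B] by (simp add: open_Times)
    have fst_S: "smooth_on ?S fst" and snd_S: "smooth_on ?S snd"
      using open_S by (auto intro: smooth_on_linear bounded_linear_fst bounded_linear_snd)
    have "snd (tangent_chart N A) ` (fst (tangent_chart N A) \<inter> fst (tangent_chart N B)) =
        overlap (tangent_chart N A) (tangent_chart N B)"
      unfolding overlap_def
      using inv_into_f_f[OF inj_on_tangent_chart[OF assms A]]
      by (force simp: chart_image_def chart_inv_def)
    moreover have "smooth_on ?S (\<lambda>z. ((snd B \<circ> chart_inv A) (fst z),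
        frechet_derivative (snd B \<circ> chart_inv A) (at (fst z)) (snd z)))"
      by (intro smooth_on_Pair smooth_on_compose[OF t fst_S] smooth_on_tangent[OF t fst_S snd_S]) auto
    then have "smooth_on ?S (snd (tangent_chart N B) \<circ> chart_inv (tangent_chart N A))"
      by (rule smooth_on_cong) (auto simp: snd_tangent_chart_chart_inv[OF assms A B])
    ultimately show ?thesis by (simp add: overlap_tangent_chart[OF assms A])
  qed
  ultimately show ?thesis
    using inj_on_tangent_chart[OF assms] chart_image_tangent_chart[OF assms] open_chart_image[OF assms]
    unfolding charted_def by (auto simp: chart_image_def open_Times)
qed

lemma tangent_chart_atlas [intro]: "A \<in> atlas N \<Longrightarrow> tangent_chart N A \<in> atlas (TB N)"
  by simp

lemma chart_inv_is_tangent: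
  "charted N \<Longrightarrow> A \<in> atlas N \<Longrightarrow> x \<in> chart_image A \<Longrightarrow>
    is_tangent N (chart_inv (tangent_chart N A) (x, v))"
  by (simp add: chart_inv_tangent_chart is_tangent_tangent_vector)

lemma tangent_cases:
  assumes "charted N" "A \<in> atlas N" "is_tangent N \<xi>" "base \<xi> \<in> fst A"
  obtains x v where "x \<in> chart_image A" "\<xi> = chart_inv (tangent_chart N A) (x, v)"
  using tangent_eq_tangent_vector[OF assms] chart_inv_tangent_chart[OF assms(1,2)]
    snd_in_chart_image[OF assms(4)] by metis

section \<open>Velocities and tangent maps in charts\<close>

text \<open>A coordinate expression \<open>f\<close> of \<open>c\<close> on an open set. The
  parameter space is any Euclidean space, so curves and maps on a square are treated alike.\<close>

definition represents ::
  "('m, 'e::euclidean_space) manifold \<Rightarrow> ('m, 'e) chart \<Rightarrow> 'a::euclidean_space set \<Rightarrow>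
    ('a \<Rightarrow> 'e) \<Rightarrow> ('a \<Rightarrow> 'm) \<Rightarrow> bool" where
  "represents N A U f c \<longleftrightarrow> A \<in> atlas N \<and> smooth_on U f \<and>
     (\<forall>t\<in>U. f t \<in> chart_image A \<and> c t = chart_inv A (f t))"

lemma representsI:
  "A \<in> atlas N \<Longrightarrow> smooth_on U f \<Longrightarrow> (\<And>t. t \<in> U \<Longrightarrow> f t \<in> chart_image A) \<Longrightarrow>
    (\<And>t. t \<in> U \<Longrightarrow> c t = chart_inv A (f t)) \<Longrightarrow> represents N A U f c"
  by (simp add: represents_def)

lemma
  assumes "represents N A U f c"
  shows represents_atlas: "A \<in> atlas N" and represents_smooth: "smooth_on U f"
    and represents_open: "open U"
    and represents_image: "t \<in> U \<Longrightarrow> f t \<in> chart_image A"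
    and represents_eq: "t \<in> U \<Longrightarrow> c t = chart_inv A (f t)"
  using assms smooth_on_open by (auto simp: represents_def)

lemma represents_cong:
  "represents N A U f c \<Longrightarrow> (\<And>t. t \<in> U \<Longrightarrow> c t = d t) \<Longrightarrow> represents N A U f d"
  by (auto simp: represents_def)

lemma euclidean_simps [simp]: "points euclidean = UNIV" "atlas euclidean = {(UNIV, \<lambda>x. x)}"
  by (auto simp: euclidean_def)

lemma chart_inv_euclidean [simp]: "chart_inv (UNIV, \<lambda>x. x) = (\<lambda>x. x)"
  by (auto simp: chart_inv_def inv_into_def fun_eq_iff)

text \<open>\<open>smooth_map\<close> tests every chart of the target, while here one chart near
  each parameter is enough; changes of coordinates supply the others.\<close>

lemma smooth_map_euclidean_iff:
  assumes "charted N"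
  shows "smooth_map euclidean I N c \<longleftrightarrow>
    (\<forall>t\<in>I. \<exists>A U f. t \<in> U \<and> U \<subseteq> I \<and> represents N A U f c)"
proof
  assume c: "smooth_map euclidean I N c"
  show "\<forall>t\<in>I. \<exists>A U f. t \<in> U \<and> U \<subseteq> I \<and> represents N A U f c"
  proof
    fix t assume "t \<in> I"
    then have "c t \<in> points N" using c by (auto simp: smooth_map_def)
    then obtain A where A: "A \<in> atlas N" "c t \<in> fst A" using point_in_chart[OF assms] by blast
    have "represents N A {s \<in> I. c s \<in> fst A} (\<lambda>s. snd A (c s)) c"
      using c A(1) by (simp add: represents_def smooth_map_def snd_in_chart_image chart_inv_snd[OF assms] o_def)
    moreover have "t \<in> {s \<in> I. c s \<in> fst A}" "{s \<in> I. c s \<in> fst A} \<subseteq> I" using A \<open>t \<in> I\<close> by auto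
    ultimately show "\<exists>A U f. t \<in> U \<and> U \<subseteq> I \<and> represents N A U f c"
      by (intro exI conjI)
  qed
next
  assume r: "\<forall>t\<in>I. \<exists>A U f. t \<in> U \<and> U \<subseteq> I \<and> represents N A U f c"
  have "c ` I \<subseteq> points N"
  proof
    fix p assume "p \<in> c ` I"
    then obtain t where "t \<in> I" "p = c t" by blast
    then obtain A U f where "t \<in> U" "represents N A U f c" using r by blast
    then have "A \<in> atlas N" "p \<in> fst A"
      using chart_inv_in[of "f t" A] \<open>p = c t\<close> by (auto simp: represents_def)
    then show "p \<in> points N" using fst_subset_points[OF assms] by blast
  qed
  moreover have "smooth_on {t \<in> I. c t \<in> fst B} (\<lambda>t. snd B (c t))" if B: "B \<in> atlas N" for B
  proof (rule smooth_on_local)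
    fix t assume t: "t \<in> {t \<in> I. c t \<in> fst B}"
    then obtain A U f where U: "t \<in> U" "U \<subseteq> I" and R: "represents N A U f c" using r by blast
    note A = represents_atlas[OF R]
    \<comment> \<open>Near \<open>t\<close> the expression in \<open>B\<close> is the one in
      \<open>A\<close> followed by the change of coordinates; on \<open>V\<close> the values of
      \<open>f\<close> stay in the domain of that change.\<close>
    define V where "V = f -` overlap A B \<inter> U"
    have cf: "c s \<in> fst B \<longleftrightarrow> f s \<in> overlap A B" if "s \<in> U" for s
      using represents_eq[OF R that] represents_image[OF R that] by (simp add: overlap_def)
    have "open V"
      unfolding V_def using represents_open[OF R] open_overlap[OF assms A B]
        smooth_on_continuous_on[OF represents_smooth[OF R]] by (simp add: continuous_on_open_vimage)
    then have "smooth_on V f"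
      using smooth_on_subset[OF represents_smooth[OF R]] by (auto simp: V_def)
    then have "smooth_on V (\<lambda>s. (snd B \<circ> chart_inv A) (f s))"
      by (rule smooth_on_compose[OF smooth_on_transition[OF assms A B]]) (simp add: V_def)
    then have "smooth_on V (\<lambda>s. snd B (c s))"
      by (rule smooth_on_cong) (simp add: V_def represents_eq[OF R])
    moreover have "t \<in> V" "V \<subseteq> {t \<in> I. c t \<in> fst B}"
      using t U cf by (auto simp: V_def)
    ultimately show "\<exists>V. t \<in> V \<and> V \<subseteq> {t \<in> I. c t \<in> fst B} \<and> smooth_on V (\<lambda>t. snd B (c t))" by blast
  qed
  ultimately show "smooth_map euclidean I N c" by (simp add: smooth_map_def o_def)
qed

lemma smooth_map_represents:
  assumes "charted N" "smooth_map euclidean I N c" "t \<in> I" "A \<in> atlas N" "c t \<in> fst A"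
  obtains U where "t \<in> U" "U \<subseteq> I" "represents N A U (\<lambda>s. snd A (c s)) c"
proof (rule that[of "{s \<in> I. c s \<in> fst A}"])
  show "represents N A {s \<in> I. c s \<in> fst A} (\<lambda>s. snd A (c s)) c"
    using assms(2,4) by (simp add: represents_def smooth_map_def snd_in_chart_image chart_inv_snd[OF assms(1)] o_def)
qed (use assms in auto)

text \<open>The chain rule through the coordinate changes turns one derivative in \<open>A\<close>
  into all components. Differentiability is asked at \<open>t\<close> only, which suits slices of
  maps of two variables.\<close>

lemma velocity_eq:
  assumes N: "charted N" "A \<in> atlas N"
    and U: "open U" "t \<in> U"
    and f: "\<And>s. s \<in> U \<Longrightarrow> f s \<in> chart_image A" "\<And>s. s \<in> U \<Longrightarrow> c s = chart_inv A (f s)"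
    and v: "(f has_vector_derivative v) (at t)"
  shows "velocity N c t = chart_inv (tangent_chart N A) (f t, v)"
proof -
  have "vector_derivative (snd B \<circ> c) (at t) = frechet_derivative (snd B \<circ> chart_inv A) (at (f t)) v"
    if B: "B \<in> charts_at N (chart_inv A (f t))" for B
  proof (rule vector_derivative_at)
    let ?D = "frechet_derivative (snd B \<circ> chart_inv A) (at (f t))"
    have t: "f t \<in> overlap A B" and BN: "B \<in> atlas N"
      using B f(1)[OF U(2)] by (auto simp: overlap_def charts_at_def)
    have D: "((snd B \<circ> chart_inv A) has_derivative ?D) (at (f t))"
      by (rule smooth_on_has_derivative[OF smooth_on_transition[OF N BN] t])
    interpret bounded_linear ?D using D by (rule has_derivative_bounded_linear)
    have "((\<lambda>s. (snd B \<circ> chart_inv A) (f s)) has_vector_derivative ?D v) (at t)"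
      using diff_chain_at[OF v[unfolded has_vector_derivative_def] D]
      by (simp add: has_vector_derivative_def o_def scaleR[unfolded o_def])
    then show "(snd B \<circ> c has_vector_derivative ?D v) (at t)"
      by (rule has_vector_derivative_transform_within_open[OF _ U]) (simp add: f(2))
  qed
  then show ?thesis
    using f[OF U(2)] by (auto simp: velocity_def chart_inv_tangent_chart[OF N] tangent_vector_def)
qed

lemma represents_velocity:
  fixes f :: "real \<Rightarrow> 'e::euclidean_space"
  assumes N: "charted N" and R: "represents N A U f c"
  shows "represents (TB N) (tangent_chart N A) U (\<lambda>t. (f t, vector_derivative f (at t))) (velocity N c)"
proof (rule representsI)
  note A = represents_atlas[OF R]
  show "tangent_chart N A \<in> atlas (TB N)" using A by simp
  show "smooth_on U (\<lambda>t. (f t, vector_derivative f (at t)))"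
    by (intro smooth_on_Pair smooth_on_vector_derivative represents_smooth[OF R])
  show "(f t, vector_derivative f (at t)) \<in> chart_image (tangent_chart N A)" if "t \<in> U" for t
    using represents_image[OF R that] by (simp add: chart_image_tangent_chart[OF N A])
  show "velocity N c t = chart_inv (tangent_chart N A) (f t, vector_derivative f (at t))"
    if "t \<in> U" for t
    by (rule velocity_eq[OF N A represents_open[OF R] that represents_image[OF R] represents_eq[OF R]
          smooth_on_has_vector_derivative[OF represents_smooth[OF R] that]])
qed

lemma velocity_cong:
  fixes N :: "('m, 'e::euclidean_space) manifold"
  assumes "open U" "t \<in> U" "\<And>s. s \<in> U \<Longrightarrow> c s = d s"
  shows "velocity N c t = velocity N d t"
proof -
  have "vector_derivative (snd A \<circ> c) (at t) = vector_derivative (snd A \<circ> d) (at t)" for A :: "('m, 'e) chart"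
    by (rule vector_derivative_cong_open[OF assms(1,2)]) (simp add: assms(3))
  then show ?thesis using assms(2,3) by (simp add: velocity_def cong: if_cong)
qed

text \<open>\<open>tangent_map\<close> computes in an arbitrarily chosen chart at the base point.
  Composing the local expression \<open>g\<close> with the change of coordinates \<open>h\<close>
  from that chart to \<open>A\<close> removes the choice.\<close>

lemma tangent_map_eq:
  assumes N: "charted N" "A \<in> atlas N" and N': "charted N'" "B \<in> atlas N'"
    and U: "open U" "x \<in> U" "U \<subseteq> chart_image A"
    and g: "\<And>z. z \<in> U \<Longrightarrow> g z \<in> chart_image B"
      "\<And>z. z \<in> U \<Longrightarrow> f (chart_inv A z) = chart_inv B (g z)"
    and D: "(g has_derivative g') (at x)"
  shows "tangent_map N N' f (chart_inv (tangent_chart N A) (x, v)) =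
    chart_inv (tangent_chart N' B) (g x, g' v)"
proof -
  let ?\<xi> = "chart_inv (tangent_chart N A) (x, v)" and ?p = "chart_inv A x"
  have x: "x \<in> chart_image A" using U by blast
  have base: "base ?\<xi> = ?p" by (rule base_chart_inv[OF N x])
  have fp: "f ?p = chart_inv B (g x)" by (rule g(2)[OF U(2)])
  define A' where "A' = (SOME A. A \<in> charts_at N ?p)"
  have "A \<in> charts_at N ?p" using N(2) chart_inv_in[OF x] by (simp add: charts_at_def)
  then have A'c: "A' \<in> charts_at N ?p" unfolding A'_def by (rule someI)
  then have A': "A' \<in> atlas N" and x': "x \<in> overlap A A'"
    using x by (auto simp: charts_at_def overlap_def)
  define h where "h = snd A \<circ> chart_inv A'"
  define y where "y = snd A' ?p"
  have y: "y \<in> overlap A' A" "h y = x"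
    using A'c chart_inv_in[OF x] snd_chart_inv[OF x]
    by (auto simp: y_def overlap_def charts_at_def snd_in_chart_image chart_inv_snd[OF N(1)] h_def)
  have h: "(h has_derivative frechet_derivative h (at y)) (at y)"
    unfolding h_def by (rule smooth_on_has_derivative[OF smooth_on_transition[OF N(1) A' N(2)] y(1)])
  have comp': "comp ?\<xi> A' = frechet_derivative (snd A' \<circ> chart_inv A) (at x) v"
    using A'c by (simp add: comp_chart_inv[OF N x])
  \<comment> \<open>The components in the chosen chart arise from \<open>v\<close> by the change
    from \<open>A\<close>; \<open>h\<close> undoes this change.\<close>
  have hv: "frechet_derivative h (at y) (comp ?\<xi> A') = v"
    unfolding comp' h_def y_def
    using transition_derivative_chain[OF N(1,2) A' N(2) x'] x transition_derivative_self[OF N x]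
    by (auto simp: overlap_def chart_inv_in)
  have "frechet_derivative (snd C \<circ> f \<circ> chart_inv A') (at y) (comp ?\<xi> A') =
      frechet_derivative (snd C \<circ> chart_inv B) (at (g x)) (g' v)"
    if C: "C \<in> charts_at N' (f ?p)" for C
  proof -
    have CN: "C \<in> atlas N'" and gx: "g x \<in> overlap B C"
      using C g(1)[OF U(2)] fp by (auto simp: charts_at_def overlap_def)
    have dC: "((snd C \<circ> chart_inv B) has_derivative frechet_derivative (snd C \<circ> chart_inv B) (at (g x))) (at (g x))"
      by (rule smooth_on_has_derivative[OF smooth_on_transition[OF N' CN] gx])
    have "(g has_derivative g') (at (h y))" using D by (simp add: y(2))
    from diff_chain_at[OF h this]
    have gh: "(g \<circ> h has_derivative g' \<circ> frechet_derivative h (at y)) (at y)" .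
    have "((snd C \<circ> chart_inv B) has_derivative frechet_derivative (snd C \<circ> chart_inv B) (at (g x))) (at ((g \<circ> h) y))"
      using dC by (simp add: y(2))
    from diff_chain_at[OF gh this]
    have chain: "((snd C \<circ> chart_inv B) \<circ> (g \<circ> h) has_derivative
      frechet_derivative (snd C \<circ> chart_inv B) (at (g x)) \<circ> (g' \<circ> frechet_derivative h (at y))) (at y)" .
    have hcont: "continuous_on (overlap A' A) h"
      unfolding h_def by (rule smooth_on_continuous_on[OF smooth_on_transition[OF N(1) A' N(2)]])
    have "(snd C \<circ> f \<circ> chart_inv A' has_derivative
      frechet_derivative (snd C \<circ> chart_inv B) (at (g x)) \<circ> (g' \<circ> frechet_derivative h (at y))) (at y)"
    proof (rule has_derivative_transform_within_open[OF chain])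
      show "open (h -` U \<inter> overlap A' A)"
        using hcont U(1) open_overlap[OF N(1) A' N(2)] by (simp add: continuous_on_open_vimage)
      show "y \<in> h -` U \<inter> overlap A' A" using y U(2) by simp
      fix z assume z: "z \<in> h -` U \<inter> overlap A' A"
      then have "chart_inv A (h z) = chart_inv A' z"
        using overlap_transition[OF N(1) A' N(2)] by (simp add: h_def)
      then show "((snd C \<circ> chart_inv B) \<circ> (g \<circ> h)) z = (snd C \<circ> f \<circ> chart_inv A') z"
        using g(2)[of "h z"] z by simp
    qed
    from frechet_derivative_eqI[OF this] show ?thesis by (simp add: hv)
  qed
  then show ?thesis
    unfolding tangent_map_def Let_def base A'_def[symmetric] y_def[symmetric]
      chart_inv_tangent_chart[OF N' g(1)[OF U(2)]] tangent_vector_def fp[symmetric]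
    by (intro arg_cong2[where f = TVec] refl ext) simp
qed

section \<open>The canonical involution in charts\<close>

lemma frechet_derivative_partial:
  assumes "g differentiable (at (x, y))"
  shows "frechet_derivative g (at (x, y)) (u, v) =
    frechet_derivative (\<lambda>z. g (z, y)) (at x) u + frechet_derivative (\<lambda>w. g (x, w)) (at y) v"
proof -
  let ?L = "frechet_derivative g (at (x, y))"
  have L: "(g has_derivative ?L) (at (x, y))" using assms frechet_derivative_works by blast
  interpret bounded_linear ?L using L by (rule has_derivative_bounded_linear)
  have "((\<lambda>z. (z, y)) has_derivative (\<lambda>u. (u, 0))) (at x)"
    "((\<lambda>w. (x, w)) has_derivative (\<lambda>v. (0, v))) (at y)"
    by (auto intro!: derivative_eq_intros)
  from diff_chain_at[OF this(1) L] diff_chain_at[OF this(2) L]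
  have "frechet_derivative (\<lambda>z. g (z, y)) (at x) u = ?L (u, 0)"
    "frechet_derivative (\<lambda>w. g (x, w)) (at y) v = ?L (0, v)"
    by (auto intro!: frechet_derivative_eqI simp: o_def)
  then show ?thesis by (simp flip: add)
qed

text \<open>The tangent map of a tangent map. The fibre part is linear in the vector, so its vector
  derivative is \<open>Df(x)\<close> again, and the second derivative enters through the base
  direction only.\<close>

lemma frechet_derivative_tangent:
  assumes f: "smooth_on U f" and x: "x \<in> U"
  shows "frechet_derivative (\<lambda>z. (f (fst z), frechet_derivative f (at (fst z)) (snd z))) (at (x, y)) (u, v) =
    (frechet_derivative f (at x) u,
     frechet_derivative (\<lambda>z. frechet_derivative f (at z) y) (at x) u + frechet_derivative f (at x) v)"
proof -
  let ?g = "\<lambda>z. frechet_derivative f (at (fst z)) (snd z)"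
  have "open (U \<times> (UNIV :: 'a set))" using smooth_on_open[OF f] by (simp add: open_Times)
  then have fs: "smooth_on (U \<times> UNIV) (fst :: 'a \<times> 'a \<Rightarrow> 'a)" "smooth_on (U \<times> UNIV) (snd :: 'a \<times> 'a \<Rightarrow> 'a)"
    by (auto intro: smooth_on_linear bounded_linear_fst bounded_linear_snd)
  have g: "smooth_on (U \<times> UNIV) ?g" by (rule smooth_on_tangent[OF f fs]) auto
  have xU: "(x, y) \<in> U \<times> UNIV" using x by simp
  have "(f has_derivative frechet_derivative f (at x)) (at (fst (x, y)))"
    using smooth_on_has_derivative[OF f x] by simp
  from diff_chain_at[OF bounded_linear_imp_has_derivative[OF bounded_linear_fst] this]
  have 1: "((\<lambda>z. f (fst z)) has_derivative (\<lambda>h. frechet_derivative f (at x) (fst h))) (at (x, y))"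
    by (simp add: o_def)
  have "frechet_derivative (\<lambda>z. (f (fst z), ?g z)) (at (x, y)) (u, v) =
      (frechet_derivative f (at x) u, frechet_derivative ?g (at (x, y)) (u, v))"
    using frechet_derivative_eqI[OF has_derivative_Pair[OF 1 smooth_on_has_derivative[OF g xU]], of "(u, v)"]
    by simp
  also have "frechet_derivative ?g (at (x, y)) (u, v) =
    frechet_derivative (\<lambda>z. frechet_derivative f (at z) y) (at x) u +
    frechet_derivative (frechet_derivative f (at x)) (at y) v"
    using frechet_derivative_partial[OF smooth_on_differentiable[OF g xU], of u v] by simp
  also have "frechet_derivative (frechet_derivative f (at x)) (at y) v = frechet_derivative f (at x) v"
    by (rule frechet_derivative_eqI[OF bounded_linear_imp_has_derivative[OF
          has_derivative_bounded_linear[OF smooth_on_has_derivative[OF f x]]]])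
  finally show ?thesis .
qed

fun flip :: "('a \<times> 'a) \<times> ('a \<times> 'a) \<Rightarrow> ('a \<times> 'a) \<times> ('a \<times> 'a)" where
  "flip ((x, y), (X, Y)) = ((x, X), (y, Y))"

lemma flip_flip [simp]: "flip (flip z) = z"
  by (cases z rule: flip.cases) simp

lemma bounded_linear_flip: "bounded_linear (flip :: ('a::euclidean_space \<times> 'a) \<times> ('a \<times> 'a) \<Rightarrow> _)"
proof -
  have "flip = (\<lambda>z :: ('a \<times> 'a) \<times> ('a \<times> 'a). ((fst (fst z), fst (snd z)), (snd (fst z), snd (snd z))))"
    by (auto simp: fun_eq_iff)
  moreover have "bounded_linear \<dots>"
    by (intro bounded_linear_Pair bounded_linear_fst_comp bounded_linear_snd_comp
        bounded_linear_fst bounded_linear_snd)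
  ultimately show ?thesis by simp
qed

abbreviation tangent_chart2 where
  "tangent_chart2 N A \<equiv> tangent_chart (TB N) (tangent_chart N A)"

lemma chart_image_tangent_chart2:
  "charted N \<Longrightarrow> A \<in> atlas N \<Longrightarrow> chart_image (tangent_chart2 N A) = (chart_image A \<times> UNIV) \<times> UNIV"
  by (simp add: chart_image_tangent_chart charted_TB)

lemma overlap_tangent_chart2:
  "charted N \<Longrightarrow> A \<in> atlas N \<Longrightarrow>
    overlap (tangent_chart2 N A) (tangent_chart2 N B) = (overlap A B \<times> UNIV) \<times> UNIV"
  by (simp add: overlap_tangent_chart charted_TB)

lemma transition_tangent_chart2:
  fixes N :: "('m, 'e::euclidean_space) manifold"
  assumes N: "charted N" "A \<in> atlas N" "B \<in> atlas N" and x: "x \<in> overlap A B"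
  defines "\<phi> \<equiv> snd B \<circ> chart_inv A"
  shows "snd (tangent_chart2 N B) (chart_inv (tangent_chart2 N A) ((x, y), (X, Y))) =
    ((\<phi> x, frechet_derivative \<phi> (at x) y), (frechet_derivative \<phi> (at x) X,
     frechet_derivative (\<lambda>z. frechet_derivative \<phi> (at z) y) (at x) X + frechet_derivative \<phi> (at x) Y))"
proof -
  note N' = charted_TB[OF N(1)] tangent_chart_atlas[OF N(2)] tangent_chart_atlas[OF N(3)]
  let ?\<psi> = "snd (tangent_chart N B) \<circ> chart_inv (tangent_chart N A)"
  let ?O = "overlap A B \<times> (UNIV :: 'e set)"
  have xO: "(x, y) \<in> overlap (tangent_chart N A) (tangent_chart N B)"
    using x by (simp add: overlap_tangent_chart[OF N(1,2)])
  have \<psi>: "?\<psi> (z, w) = (\<phi> z, frechet_derivative \<phi> (at z) w)" if "z \<in> overlap A B" for z w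
    using snd_tangent_chart_chart_inv[OF N that] by (simp add: \<phi>_def)
  have "frechet_derivative ?\<psi> (at (x, y)) =
      frechet_derivative (\<lambda>z. (\<phi> (fst z), frechet_derivative \<phi> (at (fst z)) (snd z))) (at (x, y))"
  proof (rule frechet_derivative_transform_within_open)
    show "?\<psi> differentiable at (x, y)"
      by (rule smooth_on_differentiable[OF smooth_on_transition[OF N'] xO])
    show "open ?O" using open_overlap[OF N] by (simp add: open_Times)
  qed (use x \<psi> in auto)
  then show ?thesis
    unfolding snd_tangent_chart_chart_inv[OF N' xO]
    using \<psi>[OF x] frechet_derivative_tangent[OF smooth_on_transition[OF N] x]
    by (simp add: \<phi>_def)
qed

text \<open>In the change of coordinates of TTN, \<open>y\<close> and \<open>X\<close> enter
  symmetrically except for the term \<open>D\<^sup>2\<phi>(x)(y, X)\<close>, and that term is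
  symmetric as a second derivative. Therefore exchanging \<open>y\<close> and \<open>X\<close> does
  not depend on the chart.\<close>

lemma transition_flip:
  assumes N: "charted N" "A \<in> atlas N" "B \<in> atlas N"
    and z: "z \<in> overlap (tangent_chart2 N A) (tangent_chart2 N B)"
  shows "snd (tangent_chart2 N B) (chart_inv (tangent_chart2 N A) (flip z)) =
    flip (snd (tangent_chart2 N B) (chart_inv (tangent_chart2 N A) z))"
proof -
  obtain x y X Y where zz: "z = ((x, y), (X, Y))" by (cases z rule: flip.cases)
  have x: "x \<in> overlap A B" using z by (simp add: zz overlap_tangent_chart2[OF N(1,2)])
  show ?thesis
    using frechet_derivative_symmetric[OF smooth_on_transition[OF N] x, of y X]
    by (simp add: zz transition_tangent_chart2[OF N x])
qed

text \<open>An explicit candidate for \<open>kappa\<close>, written in a chosen chart. Independence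
  of the choice is \<open>transition_flip\<close>.\<close>

definition canonical_flip where
  "canonical_flip N \<zeta> = (let A = (SOME A. A \<in> charts_at N (base (base \<zeta>))) in
     chart_inv (tangent_chart2 N A) (flip (snd (tangent_chart2 N A) \<zeta>)))"

lemma canonical_flip_chart_inv:
  assumes N: "charted N" "A \<in> atlas N" and z: "z \<in> chart_image (tangent_chart2 N A)"
  shows "canonical_flip N (chart_inv (tangent_chart2 N A) z) = chart_inv (tangent_chart2 N A) (flip z)"
proof -
  obtain x y X Y where zz: "z = ((x, y), (X, Y))" by (cases z rule: flip.cases)
  have x: "x \<in> chart_image A" using z by (simp add: zz chart_image_tangent_chart2[OF N])
  have bb: "base (base (chart_inv (tangent_chart2 N A) z)) = chart_inv A x"
    using x by (simp add: zz base_chart_inv N charted_TB chart_image_tangent_chart)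
  define B where "B = (SOME B. B \<in> charts_at N (chart_inv A x))"
  have "A \<in> charts_at N (chart_inv A x)" using N(2) x by (simp add: charts_at_def chart_inv_in)
  then have "B \<in> charts_at N (chart_inv A x)" unfolding B_def by (rule someI)
  then have B: "B \<in> atlas N" "x \<in> overlap A B" using x by (auto simp: charts_at_def overlap_def)
  have zo: "z \<in> overlap (tangent_chart2 N A) (tangent_chart2 N B)"
    and zf: "flip z \<in> overlap (tangent_chart2 N A) (tangent_chart2 N B)"
    using B(2) by (simp_all add: zz overlap_tangent_chart2[OF N])
  have "chart_inv (tangent_chart2 N B) (flip (snd (tangent_chart2 N B) (chart_inv (tangent_chart2 N A) z))) =
      chart_inv (tangent_chart2 N A) (flip z)"
    using overlap_transition[OF charted_TB[OF charted_TB[OF N(1)]] _ _ zf] N(2) B(1)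
    by (simp add: transition_flip[OF N B(1) zo, symmetric])
  then show ?thesis unfolding canonical_flip_def bb B_def[symmetric] Let_def .
qed

lemma tangent2_cases:
  assumes "charted N" "is_tangent (TB N) \<zeta>"
  obtains A x y X Y where "A \<in> atlas N" "x \<in> chart_image A"
    "\<zeta> = chart_inv (tangent_chart2 N A) ((x, y), (X, Y))"
proof -
  note N' = charted_TB[OF assms(1)]
  have "is_tangent N (base \<zeta>)" using assms(2) by (auto simp: is_tangent_def[of "TB N"])
  then have "base (base \<zeta>) \<in> points N" by (auto simp: is_tangent_def)
  then obtain A where A: "A \<in> atlas N" "base (base \<zeta>) \<in> fst A"
    using point_in_chart[OF assms(1)] by blast
  have "base \<zeta> \<in> fst (tangent_chart N A)"
    using A \<open>is_tangent N (base \<zeta>)\<close> by (simp add: tangent_chart_def)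
  then obtain z v where "z \<in> chart_image (tangent_chart N A)" "\<zeta> = chart_inv (tangent_chart2 N A) (z, v)"
    using tangent_cases[OF N' _ assms(2)] A(1) by blast
  then show ?thesis
    using that[OF A(1)] by (cases z, cases v) (auto simp: chart_image_tangent_chart[OF assms(1) A(1)])
qed

lemma smooth_map_cong:
  assumes N: "charted N" and f: "smooth_map N W N' f" and eq: "\<And>p. p \<in> W \<Longrightarrow> f p = g p"
  shows "smooth_map N W N' g"
  unfolding smooth_map_def
proof (intro conjI ballI)
  show "W \<subseteq> points N" using f by (simp add: smooth_map_def)
  show "g ` W \<subseteq> points N'" using f eq by (force simp: smooth_map_def)
  fix A B assume A: "A \<in> atlas N" and B: "B \<in> atlas N'"
  have "smooth_on (snd A ` {p \<in> W. p \<in> fst A \<and> f p \<in> fst B}) (snd B \<circ> f \<circ> chart_inv A)"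
    using f A B by (simp add: smooth_map_def)
  then have "smooth_on (snd A ` {p \<in> W. p \<in> fst A \<and> f p \<in> fst B}) (snd B \<circ> g \<circ> chart_inv A)"
    by (rule smooth_on_cong) (auto simp: chart_inv_snd[OF N A] eq)
  moreover have "{p \<in> W. p \<in> fst A \<and> f p \<in> fst B} = {p \<in> W. p \<in> fst A \<and> g p \<in> fst B}"
    using eq by auto
  ultimately show "smooth_on (snd A ` {p \<in> W. p \<in> fst A \<and> g p \<in> fst B}) (snd B \<circ> g \<circ> chart_inv A)"
    by simp
qed

lemma canonical_flip_is_tangent:
  assumes "charted N" "is_tangent (TB N) \<zeta>"
  shows "is_tangent (TB N) (canonical_flip N \<zeta>)" "canonical_flip N (canonical_flip N \<zeta>) = \<zeta>"
proof -
  obtain A x y X Y where A: "A \<in> atlas N" "x \<in> chart_image A"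
    and \<zeta>: "\<zeta> = chart_inv (tangent_chart2 N A) ((x, y), (X, Y))"
    using tangent2_cases[OF assms] by metis
  show "is_tangent (TB N) (canonical_flip N \<zeta>)" "canonical_flip N (canonical_flip N \<zeta>) = \<zeta>"
    using A assms(1) unfolding \<zeta>
    by (simp_all add: canonical_flip_chart_inv chart_image_tangent_chart2 chart_inv_is_tangent charted_TB
        chart_image_tangent_chart)
qed

text \<open>Read in two charts, the map is \<open>flip\<close> followed by a change of coordinates.
  The overlap restricts only the entry \<open>x\<close>, which \<open>flip\<close> fixes, so it is
  invariant under \<open>flip\<close>.\<close>

lemma smooth_map_canonical_flip:
  assumes N: "charted N"
  shows "smooth_map (TB (TB N)) (points (TB (TB N))) (TB (TB N)) (canonical_flip N)"
  unfolding smooth_map_def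
proof (intro conjI ballI)
  note N2 = charted_TB[OF charted_TB[OF N]]
  show "canonical_flip N ` points (TB (TB N)) \<subseteq> points (TB (TB N))"
    using canonical_flip_is_tangent(1)[OF N] by auto
  fix A2 B2 assume "A2 \<in> atlas (TB (TB N))" "B2 \<in> atlas (TB (TB N))"
  then obtain A B where A: "A \<in> atlas N" "A2 = tangent_chart2 N A" and B: "B \<in> atlas N" "B2 = tangent_chart2 N B"
    by auto
  let ?O = "overlap A2 B2"
  have at: "A2 \<in> atlas (TB (TB N))" "B2 \<in> atlas (TB (TB N))" using A B by auto
  have flip_O: "flip z \<in> ?O \<longleftrightarrow> z \<in> ?O" for z
    by (cases z rule: flip.cases) (simp add: A(2) B(2) overlap_tangent_chart2[OF N A(1)])
  have image: "flip z \<in> chart_image A2" if "z \<in> chart_image A2" for z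
    using that by (cases z rule: flip.cases) (simp add: A(2) chart_image_tangent_chart2[OF N A(1)])
  have eq: "canonical_flip N (chart_inv A2 z) = chart_inv A2 (flip z)" if "z \<in> chart_image A2" for z
    using canonical_flip_chart_inv[OF N A(1)] that by (simp add: A(2))
  have "snd A2 ` {p \<in> points (TB (TB N)). p \<in> fst A2 \<and> canonical_flip N p \<in> fst B2} =
      snd A2 ` {p \<in> fst A2. canonical_flip N p \<in> fst B2}"
    using fst_subset_points[OF N2 at(1)] by (intro arg_cong[where f = "\<lambda>X. snd A2 ` X"]) auto
  also have "\<dots> = ?O"
    unfolding overlap_image[OF N2 at(1)]
  proof (intro set_eqI iffI)
    fix z assume "z \<in> {z \<in> chart_image A2. canonical_flip N (chart_inv A2 z) \<in> fst B2}"
    then have "flip z \<in> ?O" using image[of z] eq[of z] by (simp add: overlap_def)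
    then show "z \<in> ?O" by (simp add: flip_O)
  next
    fix z assume z: "z \<in> ?O"
    then have "flip z \<in> ?O" by (simp add: flip_O)
    then show "z \<in> {z \<in> chart_image A2. canonical_flip N (chart_inv A2 z) \<in> fst B2}"
      using z eq by (simp add: overlap_def)
  qed
  finally have set: "snd A2 ` {p \<in> points (TB (TB N)). p \<in> fst A2 \<and> canonical_flip N p \<in> fst B2} = ?O" .
  have "smooth_on ?O (\<lambda>z. (snd B2 \<circ> chart_inv A2) (flip z))"
    by (rule smooth_on_compose[OF smooth_on_transition[OF N2 at]
          smooth_on_linear[OF open_overlap[OF N2 at] bounded_linear_flip]]) (simp add: flip_O)
  then have "smooth_on ?O (snd B2 \<circ> canonical_flip N \<circ> chart_inv A2)"
    by (rule smooth_on_cong) (simp add: eq overlap_def)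
  then show "smooth_on (snd A2 ` {p \<in> points (TB (TB N)). p \<in> fst A2 \<and> canonical_flip N p \<in> fst B2})
      (snd B2 \<circ> canonical_flip N \<circ> chart_inv A2)"
    by (simp only: set)
qed simp

section \<open>Iterated velocities and the characterization of the involution\<close>

lemma has_vector_derivative_slice:
  assumes "(g has_derivative g') (at (t, s))"
  shows "((\<lambda>\<sigma>. g (t, \<sigma>)) has_vector_derivative g' (0, 1)) (at s)"
    and "((\<lambda>\<tau>. g (\<tau>, s)) has_vector_derivative g' (1, 0)) (at t)"
proof -
  interpret bounded_linear g' using assms by (rule has_derivative_bounded_linear)
  have "((\<lambda>\<sigma>. (t, \<sigma>)) has_derivative (\<lambda>h. (0, h))) (at s)"
    "((\<lambda>\<tau>. (\<tau>, s)) has_derivative (\<lambda>h. (h, 0))) (at t)"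
    by (auto intro!: derivative_eq_intros)
  from diff_chain_at[OF this(1) assms] diff_chain_at[OF this(2) assms]
  have "((\<lambda>\<sigma>. g (t, \<sigma>)) has_derivative (\<lambda>h. g' (0, h))) (at s)"
    "((\<lambda>\<tau>. g (\<tau>, s)) has_derivative (\<lambda>h. g' (h, 0))) (at t)"
    by (simp_all add: o_def)
  moreover have "(\<lambda>h. g' (0, h)) = (\<lambda>h. h *\<^sub>R g' (0, 1))"
    by (rule ext) (simp only: scaleR[symmetric] scaleR_Pair scaleR_zero_right real_scaleR_def mult_1_right mult_zero_right)
  moreover have "(\<lambda>h. g' (h, 0)) = (\<lambda>h. h *\<^sub>R g' (1, 0))"
    by (rule ext) (simp only: scaleR[symmetric] scaleR_Pair scaleR_zero_right real_scaleR_def mult_1_right mult_zero_right)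
  ultimately show "((\<lambda>\<sigma>. g (t, \<sigma>)) has_vector_derivative g' (0, 1)) (at s)"
    "((\<lambda>\<tau>. g (\<tau>, s)) has_vector_derivative g' (1, 0)) (at t)"
    unfolding has_vector_derivative_def o_def by metis+
qed

lemma open_slice:
  assumes "open U"
  shows "open {\<sigma>. (t, \<sigma>) \<in> U}" "open {\<tau>. (\<tau>, s) \<in> U}"
proof -
  have "open ((\<lambda>\<sigma>. (t, \<sigma>)) -` U)" "open ((\<lambda>\<tau>. (\<tau>, s)) -` U)"
    by (intro open_vimage assms continuous_intros)+
  then show "open {\<sigma>. (t, \<sigma>) \<in> U}" "open {\<tau>. (\<tau>, s) \<in> U}" by (simp_all add: vimage_def)
qed

text \<open>The two values have their first-order entries exchanged, and their last entries are the
  mixed derivatives in the two orders. Symmetry thus makes them differ by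
  \<open>flip\<close>.\<close>

lemma dt_ds_ds_dt_represents:
  fixes f :: "real \<times> real \<Rightarrow> 'e::euclidean_space"
  assumes N: "charted N" and R: "represents N A U f c" and ts: "(t, s) \<in> U"
  shows "dt_ds N c t s = chart_inv (tangent_chart2 N A)
      ((f (t, s), frechet_derivative f (at (t, s)) (0, 1)),
       (frechet_derivative f (at (t, s)) (1, 0),
        frechet_derivative (\<lambda>z. frechet_derivative f (at z) (0, 1)) (at (t, s)) (1, 0)))" (is ?dt)
    and "ds_dt N c t s = chart_inv (tangent_chart2 N A)
      ((f (t, s), frechet_derivative f (at (t, s)) (1, 0)),
       (frechet_derivative f (at (t, s)) (0, 1),
        frechet_derivative (\<lambda>z. frechet_derivative f (at z) (1, 0)) (at (t, s)) (0, 1)))" (is ?ds)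
proof -
  note A = represents_atlas[OF R] and f = represents_smooth[OF R] and U = represents_open[OF R]
  note D = smooth_on_has_derivative[OF f]
  note D2 = smooth_on_has_derivative[OF smooth_on_frechet_derivative[OF f]]
  have vs: "velocity N (\<lambda>\<sigma>. c (\<tau>, \<sigma>)) \<sigma> =
      chart_inv (tangent_chart N A) (f (\<tau>, \<sigma>), frechet_derivative f (at (\<tau>, \<sigma>)) (0, 1))"
    if "(\<tau>, \<sigma>) \<in> U" for \<tau> \<sigma>
    using represents_image[OF R] represents_eq[OF R] that
    by (intro velocity_eq[OF N A open_slice(1)[OF U, of \<tau>]] has_vector_derivative_slice D) auto
  have vt: "velocity N (\<lambda>\<tau>. c (\<tau>, \<sigma>)) \<tau> =
      chart_inv (tangent_chart N A) (f (\<tau>, \<sigma>), frechet_derivative f (at (\<tau>, \<sigma>)) (1, 0))"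
    if "(\<tau>, \<sigma>) \<in> U" for \<tau> \<sigma>
    using represents_image[OF R] represents_eq[OF R] that
    by (intro velocity_eq[OF N A open_slice(2)[OF U, of \<sigma>], where f = "\<lambda>\<tau>. f (\<tau>, \<sigma>)"]
        has_vector_derivative_slice D) auto
  note N' = charted_TB[OF N] tangent_chart_atlas[OF A]
  show ?dt unfolding dt_ds_def
    using represents_image[OF R] vs ts
    by (intro velocity_eq[OF N' open_slice(2)[OF U, of s],
          where f = "\<lambda>\<tau>. (f (\<tau>, s), frechet_derivative f (at (\<tau>, s)) (0, 1))"]
        has_vector_derivative_Pair has_vector_derivative_slice D has_vector_derivative_slice(2)[OF D2])
      (auto simp: chart_image_tangent_chart[OF N A])
  show ?ds unfolding ds_dt_def
    using represents_image[OF R] vt ts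
    by (intro velocity_eq[OF N' open_slice(1)[OF U, of t],
          where f = "\<lambda>\<sigma>. (f (t, \<sigma>), frechet_derivative f (at (t, \<sigma>)) (1, 0))"]
        has_vector_derivative_Pair has_vector_derivative_slice D has_vector_derivative_slice(1)[OF D2])
      (auto simp: chart_image_tangent_chart[OF N A])
qed

lemma canonical_flip_ds_dt:
  assumes N: "charted N" and c: "smooth_map euclidean (square \<epsilon>) N c" and ts: "(t, s) \<in> square \<epsilon>"
  shows "dt_ds N c t s = canonical_flip N (ds_dt N c t s)" "is_tangent (TB N) (ds_dt N c t s)"
proof -
  obtain A U f where U: "(t, s) \<in> U" and R: "represents N A U f c"
    using c ts unfolding smooth_map_euclidean_iff[OF N] by blast
  note A = represents_atlas[OF R]
  show "dt_ds N c t s = canonical_flip N (ds_dt N c t s)"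
    using frechet_derivative_symmetric[OF represents_smooth[OF R] U, of "(0, 1)" "(1, 0)"]
      represents_image[OF R U]
    by (simp add: dt_ds_ds_dt_represents[OF N R U] canonical_flip_chart_inv[OF N A]
        chart_image_tangent_chart2[OF N A])
  show "is_tangent (TB N) (ds_dt N c t s)"
    using represents_image[OF R U] A
    by (simp add: dt_ds_ds_dt_represents[OF N R U] chart_inv_is_tangent charted_TB N
        chart_image_tangent_chart)
qed

text \<open>In a chart, the surface \<open>x + t y + s X + t s Y\<close> has prescribed first
  derivatives and prescribed mixed derivative at the origin. That it reaches every point of TTN
  makes a map with the defining property of \<open>kappa\<close> unique.\<close>

lemma tangent2_as_ds_dt:
  assumes N: "charted N" and \<zeta>: "is_tangent (TB N) \<zeta>"
  obtains \<epsilon> c where "\<epsilon> > 0" "smooth_map euclidean (square \<epsilon>) N c" "ds_dt N c 0 0 = \<zeta>"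
proof -
  obtain A x y X Y where A: "A \<in> atlas N" "x \<in> chart_image A"
    and \<zeta>': "\<zeta> = chart_inv (tangent_chart2 N A) ((x, y), (X, Y))"
    using tangent2_cases[OF N \<zeta>] by metis
  define f where "f = (\<lambda>z :: real \<times> real. x + fst z *\<^sub>R y + snd z *\<^sub>R X + (fst z * snd z) *\<^sub>R Y)"
  have fst_snd: "smooth_on UNIV (fst :: real \<times> real \<Rightarrow> real)" "smooth_on UNIV (snd :: real \<times> real \<Rightarrow> real)"
    by (auto intro: smooth_on_linear bounded_linear_fst bounded_linear_snd)
  have f: "smooth_on UNIV f"
    unfolding f_def using smooth_on_scaleR[OF fst_snd]
    by (intro smooth_on_add smooth_on_scaleR[OF _ smooth_on_const] smooth_on_const open_UNIV fst_snd) simp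
  have "open (f -` chart_image A)"
    using continuous_on_open_vimage[OF open_UNIV, of f] smooth_on_continuous_on[OF f]
      open_chart_image[OF N A(1)] by auto
  moreover have "(0, 0) \<in> f -` chart_image A" using A(2) by (simp add: f_def)
  ultimately obtain e where e: "e > 0" "ball (0, 0) e \<subseteq> f -` chart_image A"
    using open_contains_ball by blast
  have "square (e / 2) \<subseteq> ball (0, 0) e"
  proof
    fix z assume "z \<in> square (e / 2)"
    then have "\<bar>fst z\<bar> < e / 2" "\<bar>snd z\<bar> < e / 2" by (auto simp: square_def)
    moreover have "norm z \<le> \<bar>fst z\<bar> + \<bar>snd z\<bar>"
      using norm_Pair_le[of "fst z" "snd z"] by simp
    ultimately show "z \<in> ball (0, 0) e" by (simp add: dist_norm zero_prod_def[symmetric])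
  qed
  with e have sq: "square (e / 2) \<subseteq> f -` chart_image A" by blast
  have "open (square (e / 2))" by (simp add: square_def open_Times)
  then have R: "represents N A (square (e / 2)) f (\<lambda>z. chart_inv A (f z))"
    using sq by (intro representsI A(1) smooth_on_subset[OF f]) auto
  have 0: "(0, 0) \<in> square (e / 2)" using e(1) by (simp add: square_def)
  have "(f has_derivative (\<lambda>h. fst h *\<^sub>R y + snd h *\<^sub>R X + (fst z * snd h + fst h * snd z) *\<^sub>R Y)) (at z)" for z
    unfolding f_def by (auto intro!: derivative_eq_intros simp: algebra_simps)
  from frechet_derivative_eqI[OF this]
  have D: "frechet_derivative f (at z) h = fst h *\<^sub>R y + snd h *\<^sub>R X + (fst z * snd h + fst h * snd z) *\<^sub>R Y"
    for z h .
  have "((\<lambda>z :: real \<times> real. y + snd z *\<^sub>R Y) has_derivative (\<lambda>h. snd h *\<^sub>R Y)) (at (0, 0))"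
    by (auto intro!: derivative_eq_intros)
  from frechet_derivative_eqI[OF this, of "(0, 1)"]
  have "ds_dt N (\<lambda>z. chart_inv A (f z)) 0 0 = \<zeta>"
    by (simp add: dt_ds_ds_dt_represents(2)[OF N R 0] D \<zeta>') (simp add: f_def)
  moreover have "smooth_map euclidean (square (e / 2)) N (\<lambda>z. chart_inv A (f z))"
    unfolding smooth_map_euclidean_iff[OF N] using R by blast
  ultimately show ?thesis using that e(1) half_gt_zero by blast
qed

text \<open>For existence, the candidate is an involution, hence its own inverse, so smoothness of
  the inverse is already known. For uniqueness, \<open>tangent2_as_ds_dt\<close> fixes the value at
  every point of TTN. The restriction meets the extensionality clause of the description.\<close>

lemma kappa_eq_canonical_flip:
  assumes N: "charted N"
  shows "kappa N = restrict (canonical_flip N) (points (TB (TB N)))" (is "_ = ?k")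
  unfolding kappa_def
proof (rule the_equality, intro conjI allI impI)
  let ?P = "points (TB (TB N))"
  note N2 = charted_TB[OF charted_TB[OF N]]
  have kk: "?k \<zeta> \<in> ?P" "?k (?k \<zeta>) = \<zeta>" if "\<zeta> \<in> ?P" for \<zeta>
    using canonical_flip_is_tangent[OF N] that by auto
  show "?k \<in> extensional ?P" by simp
  have bij: "bij_betw ?k ?P ?P"
    by (rule bij_betw_byWitness[where f' = ?k]) (use kk in blast)+
  have inv: "inv_into ?P ?k \<zeta> = ?k \<zeta>" if "\<zeta> \<in> ?P" for \<zeta>
    by (rule inv_into_f_eq[OF bij_betw_imp_inj_on[OF bij]]) (use kk that in blast)+
  have smooth: "smooth_map (TB (TB N)) ?P (TB (TB N)) ?k"
    by (rule smooth_map_cong[OF N2 smooth_map_canonical_flip[OF N]]) simp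
  show "diffeomorphism (TB (TB N)) (TB (TB N)) ?k"
    unfolding diffeomorphism_def
    using bij smooth smooth_map_cong[OF N2 smooth inv[symmetric]] by blast
  fix \<epsilon> :: real and c assume "smooth_map euclidean (square \<epsilon>) N c"
  then show "\<forall>(t, s)\<in>square \<epsilon>. dt_ds N c t s = ?k (ds_dt N c t s)"
    using canonical_flip_ds_dt[OF N] by auto
next
  fix k
  assume k: "k \<in> extensional (points (TB (TB N))) \<and> diffeomorphism (TB (TB N)) (TB (TB N)) k \<and>
    (\<forall>\<epsilon>>0. \<forall>c. smooth_map euclidean (square \<epsilon>) N c \<longrightarrow>
      (\<forall>(t, s)\<in>square \<epsilon>. dt_ds N c t s = k (ds_dt N c t s)))"
  show "k = ?k"
  proof (rule extensionalityI)
    show "k \<in> extensional (points (TB (TB N)))" using k by blast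
    fix \<zeta> assume \<zeta>: "\<zeta> \<in> points (TB (TB N))"
    then obtain \<epsilon> c where c: "\<epsilon> > 0" "smooth_map euclidean (square \<epsilon>) N c" "ds_dt N c 0 0 = \<zeta>"
      using tangent2_as_ds_dt[OF N] by auto
    have 0: "(0, 0) \<in> square \<epsilon>" using c(1) by (simp add: square_def)
    have "dt_ds N c 0 0 = k (ds_dt N c 0 0)" using k c(1,2) 0 by blast
    then show "k \<zeta> = ?k \<zeta>"
      using canonical_flip_ds_dt(1)[OF N c(2) 0] \<zeta> c(3) by simp
  qed simp
qed

lemma kappa_chart_inv:
  assumes "charted N" "A \<in> atlas N" "x \<in> chart_image A"
  shows "kappa N (chart_inv (tangent_chart2 N A) ((x, y), (X, Y))) =
    chart_inv (tangent_chart2 N A) ((x, X), (y, Y))"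
  using assms
  by (simp add: kappa_eq_canonical_flip canonical_flip_chart_inv chart_image_tangent_chart2
      chart_inv_is_tangent charted_TB chart_image_tangent_chart)

section \<open>Sprays and complete lifts in charts\<close>

lemma linear_transition_derivative:
  assumes "charted N" "A \<in> atlas N" "x \<in> chart_image A" "B \<in> charts_at N (chart_inv A x)"
  shows "linear (frechet_derivative (snd B \<circ> chart_inv A) (at x))"
  using assms smooth_on_transition[OF assms(1,2), of B]
  by (intro linear_frechet_derivative smooth_on_differentiable[of "overlap A B"])
    (auto simp: charts_at_def overlap_def)

lemma chart_inv_in_slashed_T:
  assumes M: "charted M" "A \<in> atlas M" and x: "x \<in> chart_image A"
  shows "chart_inv (tangent_chart M A) (x, y) \<in> slashed_T M \<longleftrightarrow> y \<noteq> 0"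
proof -
  let ?\<xi> = "chart_inv (tangent_chart M A) (x, y)"
  have "?\<xi> = TVec (base ?\<xi>) (\<lambda>_. 0) \<longleftrightarrow> y = 0"
  proof
    assume "?\<xi> = TVec (base ?\<xi>) (\<lambda>_. 0)"
    then have "comp ?\<xi> A = 0" by (metis tvec.sel(2))
    then show "y = 0" by (simp add: comp_chart_inv_self[OF M x])
  next
    assume y: "y = 0"
    have "comp ?\<xi> B = 0" for B
      using linear_0[OF linear_transition_derivative[OF M x]] by (simp add: comp_chart_inv[OF M x] y)
    then have "comp ?\<xi> = (\<lambda>_. 0)" by (simp add: fun_eq_iff)
    then show "?\<xi> = TVec (base ?\<xi>) (\<lambda>_. 0)" by (metis tvec.collapse)
  qed
  then show ?thesis by (simp add: slashed_T_def chart_inv_is_tangent[OF M x])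
qed

text \<open>The bundle projection is \<open>fst\<close> in coordinates, so its tangent map keeps
  \<open>(x, X)\<close>; the slashed condition therefore concerns \<open>X\<close> and not the whole
  vector.\<close>

lemma chart_inv_in_slashed_TT:
  assumes M: "charted M" "A \<in> atlas M" and x: "x \<in> chart_image A"
  shows "chart_inv (tangent_chart2 M A) ((x, y), (X, Y)) \<in> slashed_TT M \<longleftrightarrow> X \<noteq> 0"
proof -
  note M' = charted_TB[OF M(1)] tangent_chart_atlas[OF M(2)]
  have xy: "(x, y) \<in> chart_image (tangent_chart M A)"
    using x by (simp add: chart_image_tangent_chart[OF M])
  have "tangent_map (TB M) M base (chart_inv (tangent_chart2 M A) ((x, y), (X, Y))) =
      chart_inv (tangent_chart M A) (fst (x, y), fst (X, Y))"
    by (rule tangent_map_eq[OF M' M open_chart_image[OF M'] xy order_refl])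
      (auto simp: chart_image_tangent_chart[OF M] base_chart_inv[OF M]
        intro!: bounded_linear_imp_has_derivative bounded_linear_fst)
  then show ?thesis
    using chart_inv_in_slashed_T[OF M x] chart_inv_is_tangent[OF M' xy]
    by (simp add: slashed_TT_def)
qed

lemma liouville_chart_inv:
  assumes M: "charted M" "A \<in> atlas M" and x: "x \<in> chart_image A"
  shows "liouville M (chart_inv (tangent_chart M A) (x, y)) =
    chart_inv (tangent_chart2 M A) ((x, y), (0, y))"
proof -
  note M' = charted_TB[OF M(1)] tangent_chart_atlas[OF M(2)]
  let ?\<xi> = "chart_inv (tangent_chart M A) (x, y)"
  have eq: "vadd ?\<xi> (vscale s ?\<xi>) = chart_inv (tangent_chart M A) (x, y + s *\<^sub>R y)" for s
  proof (rule tvec.expand, intro conjI ext)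
    show "base (vadd ?\<xi> (vscale s ?\<xi>)) = base (chart_inv (tangent_chart M A) (x, y + s *\<^sub>R y))"
      by (simp add: vadd_def base_chart_inv[OF M x])
    show "comp (vadd ?\<xi> (vscale s ?\<xi>)) B = comp (chart_inv (tangent_chart M A) (x, y + s *\<^sub>R y)) B" for B
      using linear_transition_derivative[OF M x, of B]
      by (simp add: vadd_def vscale_def comp_chart_inv[OF M x] linear_add linear_scale)
  qed
  have "((\<lambda>s. (x, y + s *\<^sub>R y)) has_derivative (\<lambda>s. (0, 0 + s *\<^sub>R y))) (at 0)"
    by (intro has_derivative_Pair has_derivative_const has_derivative_add has_derivative_scaleR_left
        has_derivative_ident)
  then have D: "((\<lambda>s. (x, y + s *\<^sub>R y)) has_vector_derivative (0, y)) (at 0)"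
    by (simp add: has_vector_derivative_def)
  have "velocity (TB M) (\<lambda>s. vadd ?\<xi> (vscale s ?\<xi>)) 0 =
      chart_inv (tangent_chart2 M A) ((x, y + 0 *\<^sub>R y), (0, y))"
  proof (rule velocity_eq[OF M' open_UNIV UNIV_I, where f = "\<lambda>s. (x, y + s *\<^sub>R y)"])
    show "(x, y + s *\<^sub>R y) \<in> chart_image (tangent_chart M A)" for s
      using x by (simp add: chart_image_tangent_chart[OF M])
  qed (rule eq, rule D)
  then show ?thesis by (simp add: liouville_def)
qed

section \<open>Coordinate form of sprays and complete lifts\<close>

context
  fixes M :: "('m, 'e::euclidean_space) manifold"
    and S :: "('m, 'e) tvec \<Rightarrow> (('m, 'e) tvec, 'e \<times> 'e) tvec"
    and A :: "('m, 'e) chart"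
  assumes M: "charted M" and S: "spray M (slashed_T M) S" and A: "A \<in> atlas M"
begin

private abbreviation (input) "G \<equiv> \<lambda>z. spray_coeff M S A (fst z) (snd z)"

text \<open>Being a vector field fixes the entries \<open>(x, y)\<close>, invariance under
  \<open>kappa\<close> forces the third entry to equal \<open>y\<close>, and the last entry is what
  \<open>spray_coeff\<close> reads off.\<close>

lemma spray_chart_inv:
  assumes x: "x \<in> chart_image A" and y: "y \<noteq> 0"
  shows "S (chart_inv (tangent_chart M A) (x, y)) =
    chart_inv (tangent_chart2 M A) ((x, y), (y, (-2) *\<^sub>R spray_coeff M S A x y))"
proof -
  note M' = charted_TB[OF M] tangent_chart_atlas[OF A]
  let ?\<xi> = "chart_inv (tangent_chart M A) (x, y)"
  have xy: "(x, y) \<in> chart_image (tangent_chart M A)" using x by (simp add: chart_image_tangent_chart[OF M A])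
  have \<xi>: "?\<xi> \<in> slashed_T M" using y by (simp add: chart_inv_in_slashed_T[OF M A x])
  have "vector_field_on (TB M) (slashed_T M) S" and kappa: "kappa M (S ?\<xi>) = S ?\<xi>"
    using S \<xi> by (auto simp: spray_def semispray_def)
  then have tan: "is_tangent (TB M) (S ?\<xi>)" and base: "base (S ?\<xi>) = ?\<xi>"
    using \<xi> by (auto simp: vector_field_on_def smooth_map_def)
  have "base (S ?\<xi>) \<in> fst (tangent_chart M A)" using base chart_inv_in[OF xy] by simp
  from tangent_cases[OF M' tan this] obtain z v
    where z: "z \<in> chart_image (tangent_chart M A)" "S ?\<xi> = chart_inv (tangent_chart2 M A) (z, v)" .
  have "chart_inv (tangent_chart M A) z = ?\<xi>"
    using base base_chart_inv[OF M' z(1), of v] unfolding z(2) by metis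
  then have "z = (x, y)" by (rule chart_inv_inject[OF z(1) xy, THEN iffD1])
  moreover obtain X Y where v: "v = (X, Y)" by (cases v)
  ultimately have SX: "S ?\<xi> = chart_inv (tangent_chart2 M A) ((x, y), (X, Y))" using z by simp
  have mem: "((x, a), b) \<in> chart_image (tangent_chart2 M A)" for a b
    using x by (simp add: chart_image_tangent_chart2[OF M A])
  have "chart_inv (tangent_chart2 M A) ((x, X), (y, Y)) = chart_inv (tangent_chart2 M A) ((x, y), (X, Y))"
    using kappa unfolding SX kappa_chart_inv[OF M A x] .
  then have "((x, X), (y, Y)) = ((x, y), (X, Y))"
    by (simp only: chart_inv_inject[OF mem mem])
  then have "X = y" by blast
  have "spray_coeff M S A x y = (- 1 / 2) *\<^sub>R Y"
    unfolding spray_coeff_def Let_def SX comp_chart_inv_self[OF M' xy] snd_conv ..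
  then have "Y = (-2) *\<^sub>R spray_coeff M S A x y" by simp
  with SX \<open>X = y\<close> show ?thesis by metis
qed

lemma open_slashed_image: "open (chart_image A \<times> (- {0 :: 'e}))"
  by (intro open_Times open_chart_image[OF M A] open_Compl closed_singleton)

lemma smooth_on_spray_coeff: "smooth_on (chart_image A \<times> - {0}) G"
proof -
  note M' = charted_TB[OF M] tangent_chart_atlas[OF A]
  let ?tA = "tangent_chart M A" and ?ttA = "tangent_chart2 M A"
  have S_eq: "S (chart_inv ?tA z) = chart_inv ?ttA (z, (snd z, (-2) *\<^sub>R G z))"
    if "z \<in> chart_image A \<times> - {0}" for z
    using that by (cases z) (simp add: spray_chart_inv)
  have image: "(z, w) \<in> chart_image ?ttA" if "z \<in> chart_image A \<times> - {0}" for z w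
    using that by (auto simp: chart_image_tangent_chart2[OF M A])
  have "smooth_map (TB M) (slashed_T M) (TB (TB M)) S"
    using S by (simp add: spray_def semispray_def vector_field_on_def)
  then have "smooth_on (snd ?tA ` {\<xi> \<in> slashed_T M. \<xi> \<in> fst ?tA \<and> S \<xi> \<in> fst ?ttA}) (snd ?ttA \<circ> S \<circ> chart_inv ?tA)"
    using A by (simp add: smooth_map_def)
  moreover have "snd ?tA ` {\<xi> \<in> slashed_T M. \<xi> \<in> fst ?tA \<and> S \<xi> \<in> fst ?ttA} =
      snd ?tA ` {\<xi> \<in> fst ?tA. \<xi> \<in> slashed_T M \<and> S \<xi> \<in> fst ?ttA}"
    by (intro arg_cong[where f = "\<lambda>X. snd ?tA ` X"]) auto
  \<comment> \<open>\<open>S\<close> covers the identity, so over this set its values stay in the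
    induced chart, and the domain occurring in \<open>smooth_map\<close> is the full
    product.\<close>
  moreover have "\<dots> = chart_image A \<times> - {0}"
    unfolding overlap_image[OF M'] chart_image_tangent_chart[OF M A]
    using S_eq chart_inv_in[OF image] by (auto simp: chart_inv_in_slashed_T[OF M A])
  ultimately have "smooth_on (chart_image A \<times> - {0}) (snd ?ttA \<circ> S \<circ> chart_inv ?tA)" by simp
  then have "smooth_on (chart_image A \<times> - {0})
      (\<lambda>z. (-1/2) *\<^sub>R snd (snd ((snd ?ttA \<circ> S \<circ> chart_inv ?tA) z)))"
    by (intro smooth_on_scaleR smooth_on_const open_slashed_image smooth_on_snd)
  then show ?thesis
    by (rule smooth_on_cong) (simp add: S_eq snd_chart_inv[OF image])
qed

text \<open>In coordinates the Liouville field is \<open>(0, y)\<close> and the spray is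
  \<open>(y, -2 G)\<close>. The fibre part of their bracket is \<open>-2 D\<^sub>yG y + 2 G\<close>,
  and the spray condition equates it with \<open>-2 G\<close>.\<close>

lemma spray_coeff_euler:
  assumes x: "x \<in> chart_image A" and y: "y \<noteq> 0"
  shows "frechet_derivative G (at (x, y)) (0, y) = 2 *\<^sub>R spray_coeff M S A x y"
proof -
  note M' = charted_TB[OF M] tangent_chart_atlas[OF A]
  let ?tA = "tangent_chart M A" and ?\<xi> = "chart_inv (tangent_chart M A) (x, y)"
  have xy: "(x, y) \<in> chart_image ?tA" using x by (simp add: chart_image_tangent_chart[OF M A])
  have xy': "(x, y) \<in> chart_image A \<times> - {0}" using x y by simp
  have \<xi>: "?\<xi> \<in> slashed_T M" using y by (simp add: chart_inv_in_slashed_T[OF M A x])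
  have at: "?tA \<in> charts_at (TB M) ?\<xi>"
    using A chart_inv_in[OF xy] by (simp add: charts_at_def)
  have Sc: "comp (S (chart_inv ?tA z)) ?tA = (snd z, (-2) *\<^sub>R G z)" if "z \<in> chart_image A \<times> - {0}" for z
    using that comp_chart_inv_self[OF M'] by (cases z) (simp add: spray_chart_inv chart_image_tangent_chart[OF M A])
  have Lc: "comp (liouville M (chart_inv ?tA z)) ?tA = (0, snd z)" if "z \<in> chart_image ?tA" for z
    using that comp_chart_inv_self[OF M'] by (auto simp: liouville_chart_inv M A chart_image_tangent_chart)
  have "((\<lambda>z. (snd z, (-2) *\<^sub>R G z)) has_derivative
      (\<lambda>h. (snd h, (-2) *\<^sub>R frechet_derivative G (at (x, y)) h))) (at (x, y))"
    by (intro has_derivative_Pair bounded_linear_imp_has_derivative[OF bounded_linear_snd]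
        has_derivative_scaleR_right smooth_on_has_derivative[OF smooth_on_spray_coeff xy'])
  from frechet_derivative_eqI[OF has_derivative_transform_within_open[OF this open_slashed_image xy' Sc[symmetric]],
      of "(0, y)"]
  have 1: "frechet_derivative (\<lambda>z. comp (S (chart_inv ?tA z)) ?tA) (at (x, y)) (0, y) =
      (y, (-2) *\<^sub>R frechet_derivative G (at (x, y)) (0, y))"
    by simp
  have "((\<lambda>z. (0 :: 'e, snd z :: 'e)) has_derivative (\<lambda>h. (0, snd h))) (at (x, y))"
    by (intro bounded_linear_imp_has_derivative bounded_linear_Pair bounded_linear_zero bounded_linear_snd)
  from frechet_derivative_eqI[OF has_derivative_transform_within_open[OF this open_chart_image[OF M'] xy Lc[symmetric]]]
  have 2: "frechet_derivative (\<lambda>z. comp (liouville M (chart_inv ?tA z)) ?tA) (at (x, y)) w = (0, snd w)" for w .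
  have "lie_bracket (TB M) (liouville M) S ?\<xi> = S ?\<xi>" using S \<xi> by (simp add: spray_def)
  then have "comp (lie_bracket (TB M) (liouville M) S ?\<xi>) ?tA = comp (S ?\<xi>) ?tA" by simp
  then have "(y, (-2) *\<^sub>R frechet_derivative G (at (x, y)) (0, y)) - (0, (-2) *\<^sub>R G (x, y)) = (y, (-2) *\<^sub>R G (x, y))"
    using at by (simp only: lie_bracket_def tvec.sel if_True snd_chart_inv[OF xy] Lc[OF xy] Sc[OF xy'] 1 2 snd_conv)
  then have "(-2) *\<^sub>R frechet_derivative G (at (x, y)) (0, y) - (-2) *\<^sub>R G (x, y) = (-2) *\<^sub>R G (x, y)"
    unfolding diff_Pair prod.inject ..
  then have "(-2) *\<^sub>R frechet_derivative G (at (x, y)) (0, y) = (-2) *\<^sub>R (2 *\<^sub>R G (x, y))"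
    unfolding diff_eq_eq by (simp only: scaleR_2 scaleR_add_right)
  then show ?thesis by (simp only: scaleR_cancel_left fst_conv snd_conv) simp
qed

text \<open>The converse of Euler's theorem: by \<open>spray_coeff_euler\<close> the function
  \<open>s\<^sup>-\<^sup>2 G(x, s y)\<close> has zero derivative on the positive half-line, so its
  values at \<open>l\<close> and at 1 agree.\<close>

lemma spray_coeff_homogeneous:
  assumes x: "x \<in> chart_image A" and y: "y \<noteq> 0" and l: "l > 0"
  shows "spray_coeff M S A x (l *\<^sub>R y) = l\<^sup>2 *\<^sub>R spray_coeff M S A x y"
proof -
  define h where "h = (\<lambda>s. inverse (s\<^sup>2) *\<^sub>R G (x, s *\<^sub>R y))"
  have "(h has_derivative (\<lambda>_. 0)) (at s within {0<..})" if "s \<in> {0<..}" for s :: real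
  proof -
    have s: "s > 0" using that by simp
    then have xs: "(x, s *\<^sub>R y) \<in> chart_image A \<times> - {0}" using x y by simp
    let ?D = "frechet_derivative G (at (x, s *\<^sub>R y))"
    have D: "(G has_derivative ?D) (at (x, s *\<^sub>R y))"
      by (rule smooth_on_has_derivative[OF smooth_on_spray_coeff xs])
    interpret bounded_linear ?D using D by (rule has_derivative_bounded_linear)
    have lin: "((\<lambda>s. (x, s *\<^sub>R y)) has_derivative (\<lambda>h. (0, h *\<^sub>R y))) (at s)"
      by (auto intro!: derivative_eq_intros)
    have sD: "s *\<^sub>R ?D (0, y) = 2 *\<^sub>R G (x, s *\<^sub>R y)"
      using spray_coeff_euler[OF x, of "s *\<^sub>R y"] s y scaleR[of s "(0, y)"] by simp
    have "?D (0, y) = (1 / s) *\<^sub>R (s *\<^sub>R ?D (0, y))" using s by simp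
    also have "\<dots> = (2 / s) *\<^sub>R G (x, s *\<^sub>R y)" unfolding sD by simp
    finally have D0: "?D (0, y) = (2 / s) *\<^sub>R G (x, s *\<^sub>R y)" .
    have Dh: "?D (0, h *\<^sub>R y) = (h * (2 / s)) *\<^sub>R G (x, s *\<^sub>R y)" for h
      using scaleR[of h "(0, y)"] by (simp add: D0)
    have "((\<lambda>s. G (x, s *\<^sub>R y)) has_derivative (\<lambda>h. (h * (2 / s)) *\<^sub>R G (x, s *\<^sub>R y))) (at s)"
      using diff_chain_at[OF lin D] by (simp only: o_def Dh)
    moreover have "((\<lambda>s. inverse (s\<^sup>2)) has_derivative (\<lambda>h. h * (- 2 / s ^ 3))) (at s)"
      using s by (auto intro!: derivative_eq_intros simp: fun_eq_iff field_simps power2_eq_square power3_eq_cube)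
    ultimately have "(h has_derivative (\<lambda>k. inverse (s\<^sup>2) *\<^sub>R ((k * (2 / s)) *\<^sub>R G (x, s *\<^sub>R y)) +
        (k * (- 2 / s ^ 3)) *\<^sub>R G (x, s *\<^sub>R y))) (at s)"
      unfolding h_def by (rule has_derivative_scaleR[rotated])
    moreover have "inverse (s\<^sup>2) * (k * (2 / s)) + k * (- 2 / s ^ 3) = 0" for k
      using s by (simp add: field_simps power2_eq_square power3_eq_cube)
    ultimately have "(h has_derivative (\<lambda>_. 0)) (at s)"
      by (simp flip: scaleR_left_distrib)
    then show ?thesis by (rule has_derivative_at_withinI)
  qed
  then obtain c where c: "\<And>s. s \<in> {0<..} \<Longrightarrow> h s = c"
    using has_derivative_zero_constant[of "{0<..}" h] by (metis convex_real_interval(3))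
  have "h l = h 1" using c[of l] c[of 1] l by simp
  then have "inverse (l\<^sup>2) *\<^sub>R G (x, l *\<^sub>R y) = G (x, y)" by (simp add: h_def)
  then have "l\<^sup>2 *\<^sub>R inverse (l\<^sup>2) *\<^sub>R G (x, l *\<^sub>R y) = l\<^sup>2 *\<^sub>R G (x, y)" by simp
  then show ?thesis using l by simp
qed

text \<open>With \<open>D\<close> the derivative of \<open>G\<close> at \<open>(x, X)\<close>, the
  entries evolve as follows. \<open>kappa M\<close> gives \<open>(x, X, y, Y)\<close>. The tangent
  map of \<open>S\<close> gives base \<open>(x, X, X, -2 G)\<close> and vector
  \<open>(y, Y, Y, -2 D(y, Y))\<close>. \<open>kappa (TB M)\<close> exchanges the second half of the
  base with the first half of the vector. The last factor flips base and vector separately.\<close>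

lemma complete_lift_chart_inv:
  assumes x: "x \<in> chart_image A" and X: "X \<noteq> 0"
  shows "complete_lift M S (chart_inv (tangent_chart2 M A) ((x, y), (X, Y))) =
    chart_inv (tangent_chart2 (TB M) (tangent_chart M A)) (((x, y), (X, Y)), ((X, Y),
      ((-2) *\<^sub>R spray_coeff M S A x X, (-2) *\<^sub>R frechet_derivative G (at (x, X)) (y, Y))))"
proof -
  note M1 = charted_TB[OF M] tangent_chart_atlas[OF A]
  note M2 = charted_TB[OF M1(1)] tangent_chart_atlas[OF M1(2)]
  let ?tA = "tangent_chart M A" and ?ttA = "tangent_chart2 M A"
  let ?tttA = "tangent_chart2 (TB M) (tangent_chart M A)"
  let ?D = "frechet_derivative G (at (x, X))"
  have xX: "(x, X) \<in> chart_image A \<times> - {0}" and xX': "(x, X) \<in> chart_image ?tA"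
    and z: "((x, X), (y, Y)) \<in> chart_image ?ttA"
    using x X by (simp_all add: chart_image_tangent_chart[OF M A] chart_image_tangent_chart2[OF M A])
  have "((\<lambda>z. (z, (snd z, (-2) *\<^sub>R G z))) has_derivative (\<lambda>h. (h, (snd h, (-2) *\<^sub>R ?D h)))) (at (x, X))"
    by (intro has_derivative_Pair has_derivative_ident bounded_linear_imp_has_derivative[OF bounded_linear_snd]
        has_derivative_scaleR_right smooth_on_has_derivative[OF smooth_on_spray_coeff xX])
  moreover have "S (chart_inv ?tA z) = chart_inv ?ttA (z, (snd z, (-2) *\<^sub>R G z))"
    if "z \<in> chart_image A \<times> - {0}" for z
    using that by (cases z) (simp add: spray_chart_inv)
  ultimately have TS: "tangent_map (TB M) (TB (TB M)) S (chart_inv ?ttA ((x, X), (y, Y))) =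
      chart_inv ?tttA (((x, X), (snd (x, X), (-2) *\<^sub>R G (x, X))),
        ((y, Y), (snd (y, Y), (-2) *\<^sub>R ?D (y, Y))))"
    by (intro tangent_map_eq[OF M1 M2 open_slashed_image xX, where g = "\<lambda>z. (z, (snd z, (-2) *\<^sub>R G z))"])
      (auto simp: chart_image_tangent_chart[OF M A] chart_image_tangent_chart2[OF M A])
  have "kappa M (chart_inv ?ttA z) = chart_inv ?ttA (flip z)" if "z \<in> chart_image ?ttA" for z
    using that by (cases z rule: flip.cases) (simp add: kappa_chart_inv[OF M A] chart_image_tangent_chart2[OF M A])
  moreover have "flip z \<in> chart_image ?ttA" if "z \<in> chart_image ?ttA" for z
    using that by (cases z rule: flip.cases) (simp add: chart_image_tangent_chart2[OF M A])
  \<comment> \<open>In coordinates \<open>kappa M\<close> is the linear map \<open>flip\<close>, so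
    its derivative is \<open>flip\<close> again.\<close>
  ultimately have Tk: "tangent_map (TB (TB M)) (TB (TB M)) (kappa M) (chart_inv ?tttA (((x, X), (y, Y)), w)) =
      chart_inv ?tttA (flip ((x, X), (y, Y)), flip w)" for w
    by (intro tangent_map_eq[OF M2 M2 open_chart_image[OF M2] z order_refl]
        bounded_linear_imp_has_derivative bounded_linear_flip)
  show ?thesis
    unfolding complete_lift_def o_def kappa_chart_inv[OF M A x] TS kappa_chart_inv[OF M1 xX'] Tk
    by simp
qed

end

section \<open>Geodesics and Jacobi fields in charts\<close>

lemma vector_derivative_Pair:
  fixes f :: "real \<Rightarrow> 'a::euclidean_space" and g :: "real \<Rightarrow> 'b::euclidean_space"
  assumes "smooth_on U f" "smooth_on U g" "t \<in> U"
  shows "vector_derivative (\<lambda>t. (f t, g t)) (at t) = (vector_derivative f (at t), vector_derivative g (at t))"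
  by (intro vector_derivative_at has_vector_derivative_Pair smooth_on_has_vector_derivative[OF _ assms(3)] assms)

lemma represents_velocity2:
  fixes f :: "real \<Rightarrow> 'e::euclidean_space"
  assumes M: "charted M" and R: "represents M A U f c" and t: "t \<in> U"
  defines "f' \<equiv> \<lambda>t. vector_derivative f (at t)"
  shows "velocity M c t = chart_inv (tangent_chart M A) (f t, f' t)"
    and "velocity (TB M) (velocity M c) t =
      chart_inv (tangent_chart2 M A) ((f t, f' t), (f' t, vector_derivative f' (at t)))"
proof -
  note f = represents_smooth[OF R]
  note R1 = represents_velocity[OF M R]
  show "velocity M c t = chart_inv (tangent_chart M A) (f t, f' t)"
    unfolding f'_def by (rule represents_eq[OF R1 t])
  show "velocity (TB M) (velocity M c) t =
      chart_inv (tangent_chart2 M A) ((f t, f' t), (f' t, vector_derivative f' (at t)))"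
    using represents_eq[OF represents_velocity[OF charted_TB[OF M] R1] t]
    unfolding vector_derivative_Pair[OF f smooth_on_vector_derivative[OF f] t] f'_def .
qed

text \<open>The condition of \<open>jacobi_field\<close> in one chart at one time, isolated so that
  it can be compared pointwise with the equation of the lift.\<close>

definition jacobi_equation ::
  "('m, 'e::euclidean_space) manifold \<Rightarrow> (('m, 'e) tvec \<Rightarrow> (('m, 'e) tvec, 'e \<times> 'e) tvec)
     \<Rightarrow> ('m, 'e) chart \<Rightarrow> (real \<Rightarrow> ('m, 'e) tvec) \<Rightarrow> real \<Rightarrow> bool" where
  "jacobi_equation M S A J t \<longleftrightarrow>
     (let x = (\<lambda>\<tau>. snd A (base (J \<tau>)));
          y = (\<lambda>\<tau>. comp (J \<tau>) A);
          x' = (\<lambda>\<tau>. vector_derivative x (at \<tau>));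
          y' = (\<lambda>\<tau>. vector_derivative y (at \<tau>));
          G = spray_coeff M S A
      in vector_derivative y' (at t)
         + 2 *\<^sub>R frechet_derivative (\<lambda>w. G (x t) w) (at (x' t)) (y' t)
         + 2 *\<^sub>R frechet_derivative (\<lambda>z. G z (x' t)) (at (x t)) (y t) = 0)"

lemma jacobi_field_iff:
  "jacobi_field M S I J \<longleftrightarrow> smooth_map euclidean I (TB M) J \<and>
     geodesic M (slashed_T M) S I (base \<circ> J) \<and>
     (\<forall>A\<in>atlas M. \<forall>t\<in>I. base (J t) \<in> fst A \<longrightarrow> jacobi_equation M S A J t)"
  unfolding jacobi_field_def jacobi_equation_def Let_def ..

lemma represents_base:
  assumes M: "charted M" and A: "A \<in> atlas M"
    and R: "represents (TB M) (tangent_chart M A) U f J"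
  shows "represents M A U (\<lambda>t. fst (f t)) (base \<circ> J)"
proof (rule representsI[OF A smooth_on_fst[OF represents_smooth[OF R]]])
  fix t assume t: "t \<in> U"
  have f: "f t = (fst (f t), snd (f t))" by simp
  show x: "fst (f t) \<in> chart_image A"
    using represents_image[OF R t] by (auto simp: chart_image_tangent_chart[OF M A])
  show "(base \<circ> J) t = chart_inv A (fst (f t))"
    using represents_eq[OF R t] base_chart_inv[OF M A x] f by (metis comp_apply)
qed

lemma smooth_map_base:
  assumes M: "charted M" and J: "smooth_map euclidean I (TB M) J"
  shows "smooth_map euclidean I M (base \<circ> J)"
  unfolding smooth_map_euclidean_iff[OF M]
proof
  fix t assume "t \<in> I"
  then obtain A' U f where U: "t \<in> U" "U \<subseteq> I" and R: "represents (TB M) A' U f J"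
    using J unfolding smooth_map_euclidean_iff[OF charted_TB[OF M]] by blast
  from represents_atlas[OF R] obtain A where A: "A \<in> atlas M" "A' = tangent_chart M A" by auto
  from represents_base[OF M A(1)] R A(2) have "represents M A U (\<lambda>t. fst (f t)) (base \<circ> J)" by blast
  with U show "\<exists>A U f. t \<in> U \<and> U \<subseteq> I \<and> represents M A U f (base \<circ> J)" by (intro exI conjI)
qed

lemma smooth_map_tangent_represents:
  assumes M: "charted M" and J: "smooth_map euclidean I (TB M) J"
    and t: "t \<in> I" and A: "A \<in> atlas M" "base (J t) \<in> fst A"
  obtains U where "t \<in> U" "U \<subseteq> I"
    "represents (TB M) (tangent_chart M A) U (\<lambda>s. (snd A (base (J s)), comp (J s) A)) J"
proof -
  have "J t \<in> fst (tangent_chart M A)"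
    using J t A by (auto simp: smooth_map_def tangent_chart_def)
  from smooth_map_represents[OF charted_TB[OF M] J t tangent_chart_atlas[OF A(1)] this]
  show ?thesis using that by (auto simp: tangent_chart_def)
qed

section \<open>The geodesic and Jacobi equations in one chart\<close>

context
  fixes M :: "('m, 'e::euclidean_space) manifold"
    and S :: "('m, 'e) tvec \<Rightarrow> (('m, 'e) tvec, 'e \<times> 'e) tvec"
    and A :: "('m, 'e) chart"
  assumes M: "charted M" and S: "spray M (slashed_T M) S" and A: "A \<in> atlas M"
begin

lemma geodesic_equation:
  assumes R: "represents M A U f c" and t: "t \<in> U"
  defines "f' \<equiv> \<lambda>t. vector_derivative f (at t)"
  shows "velocity M c t \<in> slashed_T M \<longleftrightarrow> f' t \<noteq> 0"
    and "f' t \<noteq> 0 \<Longrightarrow> velocity (TB M) (velocity M c) t = S (velocity M c t) \<longleftrightarrow>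
      vector_derivative f' (at t) = (-2) *\<^sub>R spray_coeff M S A (f t) (f' t)"
proof -
  note v = represents_velocity2[OF M R t]
  have x: "f t \<in> chart_image A" by (rule represents_image[OF R t])
  show "velocity M c t \<in> slashed_T M \<longleftrightarrow> f' t \<noteq> 0"
    unfolding v f'_def by (rule chart_inv_in_slashed_T[OF M A x])
  assume nz: "f' t \<noteq> 0"
  show "velocity (TB M) (velocity M c) t = S (velocity M c t) \<longleftrightarrow>
      vector_derivative f' (at t) = (-2) *\<^sub>R spray_coeff M S A (f t) (f' t)"
    unfolding v f'_def spray_chart_inv[OF M S A x nz[unfolded f'_def]]
    using x by (subst chart_inv_inject) (simp_all add: chart_image_tangent_chart2[OF M A])
qed

lemma lift_geodesic_equation:
  assumes R: "represents (TB M) (tangent_chart M A) U (\<lambda>s. (x s, y s)) J" and t: "t \<in> U"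
  defines "x' \<equiv> \<lambda>t. vector_derivative x (at t)" and "y' \<equiv> \<lambda>t. vector_derivative y (at t)"
  shows "velocity (TB M) J t \<in> slashed_TT M \<longleftrightarrow> x' t \<noteq> 0"
    and "x' t \<noteq> 0 \<Longrightarrow>
      velocity (TB (TB M)) (velocity (TB M) J) t = complete_lift M S (velocity (TB M) J t) \<longleftrightarrow>
      vector_derivative x' (at t) = (-2) *\<^sub>R spray_coeff M S A (x t) (x' t) \<and>
      vector_derivative y' (at t) = (-2) *\<^sub>R
        frechet_derivative (\<lambda>z. spray_coeff M S A (fst z) (snd z)) (at (x t, x' t)) (y t, y' t)"
proof -
  have x: "smooth_on U x" and y: "smooth_on U y"
    using smooth_on_fst[OF represents_smooth[OF R]] smooth_on_snd[OF represents_smooth[OF R]] by simp_all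
  have x': "smooth_on U x'" and y': "smooth_on U y'"
    unfolding x'_def y'_def by (rule smooth_on_vector_derivative[OF x] smooth_on_vector_derivative[OF y])+
  have xy': "vector_derivative (\<lambda>s. (x s, y s)) (at s) = (x' s, y' s)" if "s \<in> U" for s
    unfolding x'_def y'_def by (rule vector_derivative_Pair[OF x y that])
  have "vector_derivative (\<lambda>t. vector_derivative (\<lambda>s. (x s, y s)) (at t)) (at t) =
      vector_derivative (\<lambda>s. (x' s, y' s)) (at t)"
    by (rule vector_derivative_cong_open[OF represents_open[OF R] t xy'])
  also have "\<dots> = (vector_derivative x' (at t), vector_derivative y' (at t))"
    by (rule vector_derivative_Pair[OF x' y' t])
  finally have xy'': "vector_derivative (\<lambda>t. vector_derivative (\<lambda>s. (x s, y s)) (at t)) (at t) =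
    (vector_derivative x' (at t), vector_derivative y' (at t))" .
  note v = represents_velocity2[OF charted_TB[OF M] R t, unfolded xy'' xy'[OF t]]
  have xt: "x t \<in> chart_image A"
    using represents_image[OF R t] by (simp add: chart_image_tangent_chart[OF M A])
  show "velocity (TB M) J t \<in> slashed_TT M \<longleftrightarrow> x' t \<noteq> 0"
    unfolding v by (rule chart_inv_in_slashed_TT[OF M A xt])
  assume nz: "x' t \<noteq> 0"
  have mem: "(((x t, a), b), d) \<in> chart_image (tangent_chart2 (TB M) (tangent_chart M A))" for a b d
    using xt by (simp add: chart_image_tangent_chart2[OF charted_TB[OF M] tangent_chart_atlas[OF A]]
        chart_image_tangent_chart[OF M A])
  show "velocity (TB (TB M)) (velocity (TB M) J) t = complete_lift M S (velocity (TB M) J t) \<longleftrightarrow>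
      vector_derivative x' (at t) = (-2) *\<^sub>R spray_coeff M S A (x t) (x' t) \<and>
      vector_derivative y' (at t) = (-2) *\<^sub>R
        frechet_derivative (\<lambda>z. spray_coeff M S A (fst z) (snd z)) (at (x t, x' t)) (y t, y' t)"
    unfolding v complete_lift_chart_inv[OF M S A xt nz] chart_inv_inject[OF mem mem] by simp
qed

text \<open>The lift contains one total derivative of \<open>G\<close> along \<open>(y, y')\<close>;
  the Jacobi equation contains the two partial derivatives whose sum it is.\<close>

lemma jacobi_equation_iff:
  fixes J :: "real \<Rightarrow> ('m, 'e) tvec"
  defines "x \<equiv> \<lambda>s. snd A (base (J s))" and "y \<equiv> \<lambda>s. comp (J s) A"
  defines "x' \<equiv> \<lambda>t. vector_derivative x (at t)" and "y' \<equiv> \<lambda>t. vector_derivative y (at t)"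
  assumes x: "x t \<in> chart_image A" and nz: "x' t \<noteq> 0"
  shows "jacobi_equation M S A J t \<longleftrightarrow> vector_derivative y' (at t) = (-2) *\<^sub>R
    frechet_derivative (\<lambda>z. spray_coeff M S A (fst z) (snd z)) (at (x t, x' t)) (y t, y' t)"
proof -
  have "(\<lambda>z. spray_coeff M S A (fst z) (snd z)) differentiable (at (x t, x' t))"
    by (rule smooth_on_differentiable[OF smooth_on_spray_coeff[OF M S A]]) (use x nz in simp)
  from frechet_derivative_partial[OF this, of "y t" "y' t"]
  have p: "frechet_derivative (\<lambda>z. spray_coeff M S A (fst z) (snd z)) (at (x t, x' t)) (y t, y' t) =
    frechet_derivative (\<lambda>z. spray_coeff M S A z (x' t)) (at (x t)) (y t) +
    frechet_derivative (\<lambda>w. spray_coeff M S A (x t) w) (at (x' t)) (y' t)" by simp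
  have lin: "u + 2 *\<^sub>R b + 2 *\<^sub>R a = 0 \<longleftrightarrow> u = (-2) *\<^sub>R (a + b)" for u a b :: 'e
  proof -
    have "(-2) *\<^sub>R (a + b) = - (2 *\<^sub>R b + 2 *\<^sub>R a)" by (simp add: scaleR_add_right)
    then show ?thesis by (metis eq_neg_iff_add_eq_0 add.assoc)
  qed
  show ?thesis
    unfolding p
    unfolding jacobi_equation_def Let_def x_def y_def x'_def y'_def by (rule lin)
qed

text \<open>The second-order equation of the lift splits: its base part is the geodesic equation of
  the projected curve, and its fibre part is the linearization of that equation.\<close>

lemma lift_geodesic_iff_jacobi:
  assumes J: "smooth_map euclidean I (TB M) J" and t: "t \<in> I" and At: "base (J t) \<in> fst A"
  shows "velocity (TB M) J t \<in> slashed_TT M \<longleftrightarrow> velocity M (base \<circ> J) t \<in> slashed_T M"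
    and "velocity M (base \<circ> J) t \<in> slashed_T M \<Longrightarrow>
      velocity (TB (TB M)) (velocity (TB M) J) t = complete_lift M S (velocity (TB M) J t) \<longleftrightarrow>
      velocity (TB M) (velocity M (base \<circ> J)) t = S (velocity M (base \<circ> J) t) \<and>
      jacobi_equation M S A J t"
proof -
  obtain U where U: "t \<in> U" "U \<subseteq> I" and
    R: "represents (TB M) (tangent_chart M A) U (\<lambda>s. (snd A (base (J s)), comp (J s) A)) J"
    using smooth_map_tangent_represents[OF M J t A At] .
  have Rb: "represents M A U (\<lambda>s. snd A (base (J s))) (base \<circ> J)"
    using represents_base[OF M A R] by simp
  note g = geodesic_equation[OF Rb U(1)] and l = lift_geodesic_equation[OF R U(1)]
  show "velocity (TB M) J t \<in> slashed_TT M \<longleftrightarrow> velocity M (base \<circ> J) t \<in> slashed_T M"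
    using g(1) l(1) by blast
  assume "velocity M (base \<circ> J) t \<in> slashed_T M"
  then have nz: "vector_derivative (\<lambda>s. snd A (base (J s))) (at t) \<noteq> 0" using g(1) by blast
  show "velocity (TB (TB M)) (velocity (TB M) J) t = complete_lift M S (velocity (TB M) J t) \<longleftrightarrow>
      velocity (TB M) (velocity M (base \<circ> J)) t = S (velocity M (base \<circ> J) t) \<and>
      jacobi_equation M S A J t"
    unfolding l(2)[OF nz] g(2)[OF nz] jacobi_equation_iff[OF represents_image[OF Rb U(1)] nz] ..
qed

end

lemma lift_geodesic_on_iff:
  assumes M: "charted M" and S: "spray M (slashed_T M) S"
  shows "geodesic_on (TB M) (slashed_TT M) (complete_lift M S) I J \<longleftrightarrow>
    smooth_map euclidean I (TB M) J \<and> geodesic_on M (slashed_T M) S I (base \<circ> J) \<and>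
    (\<forall>A\<in>atlas M. \<forall>t\<in>I. base (J t) \<in> fst A \<longrightarrow> jacobi_equation M S A J t)"
proof (cases "smooth_map euclidean I (TB M) J")
  case J: True
  note eq = lift_geodesic_iff_jacobi[OF M S _ J]
  have chart: "\<exists>A\<in>atlas M. base (J t) \<in> fst A" if "t \<in> I" for t
  proof -
    have "is_tangent M (J t)" using J that by (auto simp: smooth_map_def)
    then show ?thesis using point_in_chart[OF M] by (simp add: is_tangent_def)
  qed
  let ?v = "velocity (TB M) J" and ?w = "velocity M (base \<circ> J)"
  have 1: "?v t \<in> slashed_TT M \<longleftrightarrow> ?w t \<in> slashed_T M" if "t \<in> I" for t
    using chart[OF that] eq(1)[OF _ that] by blast
  \<comment> \<open>The left side mentions no chart, so it yields the Jacobi equation in every chart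
    at the point. In the other direction one chart is enough, and \<open>chart\<close> provides
    it.\<close>
  have 2: "velocity (TB (TB M)) ?v t = complete_lift M S (?v t) \<longleftrightarrow>
      velocity (TB M) ?w t = S (?w t) \<and> (\<forall>A\<in>atlas M. base (J t) \<in> fst A \<longrightarrow> jacobi_equation M S A J t)"
    if "t \<in> I" "?w t \<in> slashed_T M" for t
    using chart[OF that(1)] eq(2)[OF _ that(1) _ that(2)] by metis
  have "(\<forall>t\<in>I. ?v t \<in> slashed_TT M) \<longleftrightarrow> (\<forall>t\<in>I. ?w t \<in> slashed_T M)"
    by (intro ball_cong refl 1)
  moreover have "(\<forall>t\<in>I. velocity (TB (TB M)) ?v t = complete_lift M S (?v t)) \<longleftrightarrow>
      (\<forall>t\<in>I. velocity (TB M) ?w t = S (?w t) \<and>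
        (\<forall>A\<in>atlas M. base (J t) \<in> fst A \<longrightarrow> jacobi_equation M S A J t))"
    if "\<forall>t\<in>I. ?w t \<in> slashed_T M"
    by (intro ball_cong refl 2) (use that in blast)+
  ultimately show ?thesis
    unfolding geodesic_on_def using J smooth_map_base[OF M J] by (smt (verit))
qed (simp add: geodesic_on_def)

section \<open>Sprays that agree on the slashed bundle\<close>

lemma spray_coeff_cong:
  assumes M: "charted M" and A: "A \<in> atlas M" and eq: "\<And>\<xi>. \<xi> \<in> slashed_T M \<Longrightarrow> S\<^sub>1 \<xi> = S\<^sub>2 \<xi>"
    and "x \<in> chart_image A" "y \<noteq> 0"
  shows "spray_coeff M S\<^sub>1 A x y = spray_coeff M S\<^sub>2 A x y"
  using eq[of "chart_inv (tangent_chart M A) (x, y)"] assms(4,5)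
  by (simp add: spray_coeff_def Let_def chart_inv_in_slashed_T[OF M A])

lemma geodesic_on_cong:
  assumes "\<And>\<xi>. \<xi> \<in> W \<Longrightarrow> S\<^sub>1 \<xi> = S\<^sub>2 \<xi>"
  shows "geodesic_on N W S\<^sub>1 I c \<longleftrightarrow> geodesic_on N W S\<^sub>2 I c"
  unfolding geodesic_on_def using assms by auto

lemma geodesic_cong:
  assumes "\<And>\<xi>. \<xi> \<in> W \<Longrightarrow> S\<^sub>1 \<xi> = S\<^sub>2 \<xi>"
  shows "geodesic N W S\<^sub>1 I c \<longleftrightarrow> geodesic N W S\<^sub>2 I c"
proof -
  have "geodesic_on N W S\<^sub>1 I c \<longleftrightarrow> geodesic_on N W S\<^sub>2 I c" for I c by (rule geodesic_on_cong[OF assms])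
  then show ?thesis by (simp add: geodesic_def)
qed

context
  fixes M :: "('m, 'e::euclidean_space) manifold"
    and S\<^sub>1 S\<^sub>2 :: "('m, 'e) tvec \<Rightarrow> (('m, 'e) tvec, 'e \<times> 'e) tvec"
  assumes M: "charted M"
    and S1: "spray M (slashed_T M) S\<^sub>1" and S2: "spray M (slashed_T M) S\<^sub>2"
    and eq: "\<And>\<xi>. \<xi> \<in> slashed_T M \<Longrightarrow> S\<^sub>1 \<xi> = S\<^sub>2 \<xi>"
begin

text \<open>Derivatives of the coefficients are compared, so agreement at the single point
  \<open>(x, x')\<close> would be too little. The slashed bundle is open and contains this point
  because the velocity of the geodesic does not vanish.\<close>

lemma jacobi_equation_cong:
  assumes J: "smooth_map euclidean I (TB M) J" and g: "geodesic_on M (slashed_T M) S\<^sub>1 I (base \<circ> J)"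
    and t: "t \<in> I" and A: "A \<in> atlas M" "base (J t) \<in> fst A"
  shows "jacobi_equation M S\<^sub>1 A J t \<longleftrightarrow> jacobi_equation M S\<^sub>2 A J t"
proof -
  obtain U where U: "t \<in> U" "U \<subseteq> I" and
    R: "represents (TB M) (tangent_chart M A) U (\<lambda>s. (snd A (base (J s)), comp (J s) A)) J"
    using smooth_map_tangent_represents[OF M J t A] .
  have Rb: "represents M A U (\<lambda>s. snd A (base (J s))) (base \<circ> J)"
    using represents_base[OF M A(1) R] by simp
  let ?x = "snd A (base (J t))" and ?x' = "vector_derivative (\<lambda>s. snd A (base (J s))) (at t)"
  have x: "?x \<in> chart_image A" by (rule represents_image[OF Rb U(1)])
  have nz: "?x' \<noteq> 0"
    using g t geodesic_equation(1)[OF M S1 A(1) Rb U(1)] by (auto simp: geodesic_on_def)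
  have "frechet_derivative (\<lambda>z. spray_coeff M S\<^sub>1 A (fst z) (snd z)) (at (?x, ?x')) =
      frechet_derivative (\<lambda>z. spray_coeff M S\<^sub>2 A (fst z) (snd z)) (at (?x, ?x'))"
  proof (rule frechet_derivative_transform_within_open[OF
        smooth_on_differentiable[OF smooth_on_spray_coeff[OF M S1 A(1)]] open_slashed_image[OF M S1 A(1)]])
    show "spray_coeff M S\<^sub>1 A (fst z) (snd z) = spray_coeff M S\<^sub>2 A (fst z) (snd z)"
      if "z \<in> chart_image A \<times> - {0}" for z
      using that by (intro spray_coeff_cong[OF M A(1) eq]) auto
  qed (use x nz in auto)
  then show ?thesis
    unfolding jacobi_equation_iff[OF M S1 A(1) x nz] jacobi_equation_iff[OF M S2 A(1) x nz] by simp
qed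

lemma geodesic_on_eq: "geodesic_on M (slashed_T M) S\<^sub>1 I c = geodesic_on M (slashed_T M) S\<^sub>2 I c"
  by (rule geodesic_on_cong) (rule eq)

lemma geodesic_eq: "geodesic M (slashed_T M) S\<^sub>1 I c = geodesic M (slashed_T M) S\<^sub>2 I c"
  by (rule geodesic_cong) (rule eq)

lemma jacobi_field_cong: "jacobi_field M S\<^sub>1 I J \<longleftrightarrow> jacobi_field M S\<^sub>2 I J"
proof (cases "smooth_map euclidean I (TB M) J \<and> geodesic M (slashed_T M) S\<^sub>1 I (base \<circ> J)")
  case True
  then have "\<forall>A\<in>atlas M. \<forall>t\<in>I. base (J t) \<in> fst A \<longrightarrow>
      jacobi_equation M S\<^sub>1 A J t = jacobi_equation M S\<^sub>2 A J t"
    using jacobi_equation_cong[of I J] by (simp add: geodesic_def)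
  with True show ?thesis
    by (simp add: jacobi_field_iff geodesic_eq)
qed (auto simp: jacobi_field_iff geodesic_eq)

text \<open>The sprays are arbitrary outside the slashed bundle, so the complete lifts may differ as
  total functions. The comparison therefore passes through the description of lift geodesics by the
  base geodesic and the Jacobi equation.\<close>

lemma lift_geodesic_cong:
  "geodesic (TB M) (slashed_TT M) (complete_lift M S\<^sub>1) I J \<longleftrightarrow>
   geodesic (TB M) (slashed_TT M) (complete_lift M S\<^sub>2) I J"
proof -
  have "geodesic_on (TB M) (slashed_TT M) (complete_lift M S\<^sub>1) I J \<longleftrightarrow>
      geodesic_on (TB M) (slashed_TT M) (complete_lift M S\<^sub>2) I J" for I J
  proof (cases "smooth_map euclidean I (TB M) J \<and> geodesic_on M (slashed_T M) S\<^sub>1 I (base \<circ> J)")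
    case True
    then have "\<forall>A\<in>atlas M. \<forall>t\<in>I. base (J t) \<in> fst A \<longrightarrow>
        jacobi_equation M S\<^sub>1 A J t = jacobi_equation M S\<^sub>2 A J t"
      using jacobi_equation_cong[of I J] by simp
    with True show ?thesis
      by (simp add: lift_geodesic_on_iff[OF M S1] lift_geodesic_on_iff[OF M S2] geodesic_on_eq)
  qed (auto simp: lift_geodesic_on_iff[OF M S1] lift_geodesic_on_iff[OF M S2] geodesic_on_eq)
  then show ?thesis by (simp add: geodesic_def)
qed

end

section \<open>Existence of geodesics\<close>

text \<open>For a globally Lipschitz and bounded right-hand side, the Picard operator acts on all
  bounded continuous functions on the line, a complete metric space; Banach's fixed point theorem
  applies there directly.\<close>

lemma lipschitz_ode_solution:
  fixes H :: "'a::euclidean_space \<Rightarrow> 'a"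
  assumes Lip: "\<And>x y. norm (H x - H y) \<le> L * norm (x - y)" and bound: "\<And>x. norm (H x) \<le> K"
    and L: "L \<ge> 0"
  obtains e u where "e > 0" "u 0 = u\<^sub>0"
    "\<And>t. t \<in> {-e<..<e} \<Longrightarrow> (u has_vector_derivative H (u t)) (at t)"
proof -
  \<comment> \<open>The operator contains two integrals over intervals of length at most
    \<open>2 * e\<close>, so its Lipschitz constant is at most \<open>4 * e * L\<close>, here at
    most 1/2. Using \<open>L + 1\<close> covers the case \<open>L = 0\<close>.\<close>
  define e where "e = 1 / (8 * (L + 1))"
  have e: "e > 0" "4 * e * L \<le> 1 / 2" using L by (auto simp: e_def field_simps)
  have H: "continuous_on UNIV H"
  proof (rule lipschitz_on_continuous_on)
    show "L-lipschitz_on UNIV H" using Lip L by (auto simp: lipschitz_on_def dist_norm)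
  qed
  \<comment> \<open>Freezing time outside \<open>{-e..e}\<close> makes the operator produce bounded
    functions on the whole line.\<close>
  define clamp where "clamp = (\<lambda>t :: real. max (-e) (min e t))"
  have clamp: "clamp t \<in> {-e..e}" for t using e by (auto simp: clamp_def)
  have clamp_id: "clamp t = t" if "t \<in> {-e..e}" for t using that by (auto simp: clamp_def)
  have clamp_cont: "continuous_on UNIV clamp" unfolding clamp_def by (intro continuous_intros)
  \<comment> \<open>The difference of two integrals starting at \<open>-e\<close> is the oriented
    integral from 0 to \<open>clamp t\<close>; an integral over \<open>{0..t}\<close> would be 0 for
    negative \<open>t\<close>.\<close>
  define \<Phi> where "\<Phi> = (\<lambda>u t. u\<^sub>0 + (integral {-e..clamp t} (\<lambda>s. H (u s)) - integral {-e..0} (\<lambda>s. H (u s))))"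
  have Hu: "continuous_on S (\<lambda>s. H (apply_bcontfun u s))" for u S
    by (rule continuous_on_compose2[OF H]) auto
  have int_bound: "norm (integral {-e..c} f) \<le> B * (2 * e)"
    if "continuous_on {-e..c} f" "c \<in> {-e..e}" "\<And>s. norm (f s) \<le> B" for f :: "real \<Rightarrow> 'a" and c B
  proof -
    have "norm (integral {-e..c} f) \<le> B * (c - (-e))"
      by (rule integral_bound) (use that in auto)
    also have "\<dots> \<le> B * (2 * e)"
      using that order_trans[OF norm_ge_zero that(3)] by (intro mult_left_mono) auto
    finally show ?thesis .
  qed
  have e0: "0 \<in> {-e..e}" using e by simp
  have \<Phi>: "\<Phi> (apply_bcontfun u) \<in> bcontfun" for u
  proof (rule bcontfun_normI)
    have "continuous_on {-e..e} (\<lambda>x. integral {-e..x} (\<lambda>s. H (apply_bcontfun u s)))"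
      by (intro indefinite_integral_continuous_1 integrable_continuous_real Hu)
    then have "continuous_on UNIV (\<lambda>t. integral {-e..clamp t} (\<lambda>s. H (apply_bcontfun u s)))"
      by (rule continuous_on_compose2[OF _ clamp_cont]) (use clamp in blast)
    then show "continuous_on UNIV (\<Phi> (apply_bcontfun u))"
      unfolding \<Phi>_def by (intro continuous_intros)
    show "norm (\<Phi> (apply_bcontfun u) t) \<le> norm u\<^sub>0 + (K * (2 * e) + K * (2 * e))" for t
      unfolding \<Phi>_def
      by (rule order_trans[OF norm_triangle_ineq add_left_mono[OF order_trans[OF norm_triangle_ineq4 add_mono]]])
        (intro int_bound[OF Hu _ bound] clamp e0)+
  qed
  define T where "T = (\<lambda>u. Bcontfun (\<Phi> (apply_bcontfun u)))"
  have T: "apply_bcontfun (T u) = \<Phi> (apply_bcontfun u)" for u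
    unfolding T_def by (rule Bcontfun_inverse[OF \<Phi>])
  have contr: "dist (T u) (T v) \<le> 1 / 2 * dist u v" for u v
  proof (rule dist_bound)
    fix t
    let ?f = "\<lambda>s. H (apply_bcontfun u s) - H (apply_bcontfun v s)"
    have f_le: "norm (?f s) \<le> L * dist u v" for s
    proof -
      have "norm (apply_bcontfun u s - apply_bcontfun v s) \<le> dist u v"
        using dist_bounded[of u s v] by (simp only: dist_norm[symmetric])
      from order_trans[OF Lip mult_left_mono[OF this L]] show ?thesis .
    qed
    have sub: "integral {-e..c} ?f = integral {-e..c} (\<lambda>s. H (apply_bcontfun u s)) - integral {-e..c} (\<lambda>s. H (apply_bcontfun v s))" for c
      by (intro Henstock_Kurzweil_Integration.integral_diff integrable_continuous_real Hu)
    have "dist (apply_bcontfun (T u) t) (apply_bcontfun (T v) t) =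
        norm (integral {-e..clamp t} ?f - integral {-e..0} ?f)"
      unfolding T \<Phi>_def dist_norm sub by (simp add: algebra_simps)
    also have "\<dots> \<le> L * dist u v * (2 * e) + L * dist u v * (2 * e)"
      by (rule order_trans[OF norm_triangle_ineq4 add_mono])
        (intro int_bound[OF _ _ f_le] clamp e0 continuous_on_diff Hu)+
    also have "\<dots> = 4 * e * L * dist u v" by simp
    also have "\<dots> \<le> 1 / 2 * dist u v" by (intro mult_right_mono e(2)) simp
    finally show "dist (apply_bcontfun (T u) t) (apply_bcontfun (T v) t) \<le> 1 / 2 * dist u v" .
  qed
  obtain w where w: "T w = w"
    using banach_fix_type[of "1 / 2" T] contr by auto
  define u where "u = apply_bcontfun w"
  have u: "u t = u\<^sub>0 + (integral {-e..clamp t} (\<lambda>s. H (u s)) - integral {-e..0} (\<lambda>s. H (u s)))" for t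
    using T[of w] unfolding w u_def \<Phi>_def by metis
  show ?thesis
  proof (rule that[OF e(1)])
    show "u 0 = u\<^sub>0" by (subst u) (simp add: clamp_id[OF e0])
    fix t assume t: "t \<in> {-e<..<e}"
    have "((\<lambda>t. integral {-e..t} (\<lambda>s. H (u s))) has_vector_derivative H (u t)) (at t within {-e..e})"
      by (rule integral_has_vector_derivative) (use t Hu[of _ w] in \<open>auto simp: u_def\<close>)
    then have "((\<lambda>t. integral {-e..t} (\<lambda>s. H (u s))) has_vector_derivative H (u t)) (at t)"
      using t at_within_Icc_at[of "-e" t e] by auto
    from has_vector_derivative_add[OF has_vector_derivative_const
        has_vector_derivative_diff[OF this has_vector_derivative_const]]
    have "((\<lambda>t. u\<^sub>0 + (integral {-e..t} (\<lambda>s. H (u s)) - integral {-e..0} (\<lambda>s. H (u s))))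
      has_vector_derivative H (u t)) (at t)" by simp
    then show "(u has_vector_derivative H (u t)) (at t)"
    proof (rule has_vector_derivative_transform_within_open[OF _ open_greaterThanLessThan t])
      show "u\<^sub>0 + (integral {-e..s} (\<lambda>s. H (u s)) - integral {-e..0} (\<lambda>s. H (u s))) = u s"
        if "s \<in> {-e<..<e}" for s
        using u[of s] clamp_id[of s] that by simp
    qed
  qed
qed

text \<open>On the compact ball the derivative in each basis direction is bounded, and the sum of
  these bounds controls the operator norm. The ball is convex, so the mean value inequality
  applies.\<close>

lemma smooth_on_lipschitz_cball:
  fixes F :: "'a::euclidean_space \<Rightarrow> 'b::euclidean_space"
  assumes F: "smooth_on U F" and r: "cball a r \<subseteq> U"
  obtains L where "L \<ge> 0"
    "\<And>x y. x \<in> cball a r \<Longrightarrow> y \<in> cball a r \<Longrightarrow> norm (F x - F y) \<le> L * norm (x - y)"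
proof -
  have "\<exists>B. \<forall>x\<in>cball a r. norm (frechet_derivative F (at x) b) \<le> B" for b
  proof -
    have "continuous_on (cball a r) (\<lambda>x. frechet_derivative F (at x) b)"
      by (rule continuous_on_subset[OF smooth_on_continuous_on[OF smooth_on_frechet_derivative[OF F]] r])
    from compact_imp_bounded[OF compact_continuous_image[OF this compact_cball]]
    show ?thesis by (auto simp: bounded_iff)
  qed
  then obtain B where B: "\<And>b x. x \<in> cball a r \<Longrightarrow> norm (frechet_derivative F (at x) b) \<le> B b" by metis
  define L where "L = (\<Sum>b\<in>(Basis :: 'a set). \<bar>B b\<bar>)"
  show ?thesis
  proof (rule that[of L])
    show "L \<ge> 0" by (simp add: L_def sum_nonneg)
    fix x y assume xy: "x \<in> cball a r" "y \<in> cball a r"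
    show "norm (F x - F y) \<le> L * norm (x - y)"
    proof (rule differentiable_bound[OF convex_cball _ _ xy])
      fix z assume z: "z \<in> cball a r"
      then have zU: "z \<in> U" using r by blast
      show "(F has_derivative frechet_derivative F (at z)) (at z within cball a r)"
        by (rule has_derivative_at_withinI[OF smooth_on_has_derivative[OF F zU]])
      show "onorm (frechet_derivative F (at z)) \<le> L"
      proof (rule onorm_le)
        fix v
        have "norm (frechet_derivative F (at z) v) \<le>
            (\<Sum>b\<in>Basis. norm ((v \<bullet> b) *\<^sub>R frechet_derivative F (at z) b))"
          unfolding frechet_derivative_basis_expansion[OF smooth_on_differentiable[OF F zU], of v]
          by (rule norm_sum)
        also have "\<dots> \<le> (\<Sum>b\<in>Basis. norm v * \<bar>B b\<bar>)"
        proof (rule sum_mono)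
          fix b :: 'a assume "b \<in> Basis"
          then show "norm ((v \<bullet> b) *\<^sub>R frechet_derivative F (at z) b) \<le> norm v * \<bar>B b\<bar>"
            using Basis_le_norm[of b v] B[OF z, of b] by (auto intro!: mult_mono)
        qed
        also have "\<dots> = L * norm v" by (simp add: L_def sum_distrib_left mult.commute)
        finally show "norm (frechet_derivative F (at z) v) \<le> L * norm v" .
      qed
    qed
  qed
qed

text \<open>Composing \<open>F\<close> with the nearest-point projection onto a closed ball, which
  is 1-Lipschitz, gives a globally Lipschitz bounded map. For short times the solution stays in the
  ball, where the projection is the identity.\<close>

lemma smooth_ode_solution:
  fixes F :: "'a::euclidean_space \<Rightarrow> 'a"
  assumes F: "smooth_on U F" and u0: "u\<^sub>0 \<in> U"
  obtains e u where "e > 0" "u 0 = u\<^sub>0" "\<And>t. t \<in> {-e<..<e} \<Longrightarrow> u t \<in> U"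
    "\<And>t. t \<in> {-e<..<e} \<Longrightarrow> (u has_vector_derivative F (u t)) (at t)"
proof -
  obtain r where r: "r > 0" "cball u\<^sub>0 r \<subseteq> U"
    using smooth_on_open[OF F] u0 open_contains_cball by blast
  obtain L where L: "L \<ge> 0"
    "\<And>x y. x \<in> cball u\<^sub>0 r \<Longrightarrow> y \<in> cball u\<^sub>0 r \<Longrightarrow> norm (F x - F y) \<le> L * norm (x - y)"
    using smooth_on_lipschitz_cball[OF F r(2)] by blast
  let ?p = "closest_point (cball u\<^sub>0 r)"
  have ne: "cball u\<^sub>0 r \<noteq> {}" using r(1) by simp
  have p: "?p x \<in> cball u\<^sub>0 r" for x by (rule closest_point_in_set[OF closed_cball ne])
  have p_le: "norm (?p x - ?p y) \<le> norm (x - y)" for x y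
    using closest_point_lipschitz[OF convex_cball closed_cball ne] by (simp add: dist_norm)
  have "bounded (F ` cball u\<^sub>0 r)"
    by (intro compact_imp_bounded compact_continuous_image compact_cball
        continuous_on_subset[OF smooth_on_continuous_on[OF F] r(2)])
  then obtain K where K: "\<And>x. x \<in> cball u\<^sub>0 r \<Longrightarrow> norm (F x) \<le> K" unfolding bounded_iff by blast
  obtain e u where e: "e > 0" "u 0 = u\<^sub>0"
    and u: "\<And>t. t \<in> {-e<..<e} \<Longrightarrow> (u has_vector_derivative F (?p (u t))) (at t)"
  proof (rule lipschitz_ode_solution[of "\<lambda>x. F (?p x)" L K u\<^sub>0])
    show "norm (F (?p x) - F (?p y)) \<le> L * norm (x - y)" for x y
      by (rule order_trans[OF L(2)[OF p p] mult_left_mono[OF p_le L(1)]])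
  qed (use K[OF p] L(1) in auto)
  have "isCont u 0" using has_vector_derivative_continuous[OF u[of 0]] e(1) by simp
  then obtain d where d: "d > 0" "\<And>t. norm t < d \<Longrightarrow> dist (u t) u\<^sub>0 < r"
    using r(1) e(2) unfolding continuous_at_eps_delta by (metis diff_zero dist_norm)
  show ?thesis
  proof (rule that[of "min e d" u])
    show "min e d > 0" using e(1) d(1) by simp
    show "u 0 = u\<^sub>0" by (rule e(2))
    fix t assume t: "t \<in> {- min e d<..<min e d}"
    then have mem: "u t \<in> cball u\<^sub>0 r" using d(2)[of t] by (auto simp: dist_commute intro: less_imp_le)
    then show "u t \<in> U" using r(2) by blast
    show "(u has_vector_derivative F (u t)) (at t)"
    proof -
      have "t \<in> {-e<..<e}" using t by (auto simp: min_def split: if_splits)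
      from u[OF this] show ?thesis by (simp only: closest_point_self[OF mem])
    qed
  qed
qed

text \<open>Bootstrapping: if \<open>u\<close> is of class \<open>C^k\<close>, then so is its
  derivative \<open>F (u t)\<close>, and \<open>u\<close> is of class
  \<open>C^(k+1)\<close>.\<close>

lemma smooth_on_ode_solution:
  fixes u :: "real \<Rightarrow> 'a::euclidean_space"
  assumes F: "smooth_on U F" and I: "open I" and uU: "\<And>t. t \<in> I \<Longrightarrow> u t \<in> U"
    and u: "\<And>t. t \<in> I \<Longrightarrow> (u has_vector_derivative F (u t)) (at t)"
  shows "smooth_on I u"
proof -
  have "Ck_on k I u" for k
  proof (induction k)
    case 0
    then show ?case
      by (auto intro!: continuous_at_imp_continuous_on has_vector_derivative_continuous[OF u])
  next
    case (Suc k)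
    show ?case
    proof (rule Ck_on_SucI[OF I])
      show "(u has_derivative (\<lambda>h. h *\<^sub>R F (u t))) (at t)" if "t \<in> I" for t
        using u[OF that] by (simp add: has_vector_derivative_def)
      show "Ck_on k I (\<lambda>t. h *\<^sub>R F (u t))" for h
        by (intro Ck_on_linear_compose[OF bounded_linear_scaleR_right I]
            Ck_on_compose[OF I smooth_on_open[OF F] smooth_on_Ck_on[OF F] Suc]) (use uU in blast)
    qed
  qed
  then show ?thesis using I by (simp add: smooth_on_def)
qed

section \<open>Local geodesics\<close>

text \<open>In coordinates the spray is the first-order field \<open>(y, -2 G)\<close> on the
  slashed set, and the projection of an integral curve is a geodesic. The velocity never vanishes
  because the solution stays in that set.\<close>

lemma local_geodesic:
  assumes M: "charted M" and S: "spray M (slashed_T M) S" and \<xi>: "\<xi> \<in> slashed_T M"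
  obtains e c where "e > 0" "geodesic_on M (slashed_T M) S {-e<..<e} c" "velocity M c 0 = \<xi>"
proof -
  have tan: "is_tangent M \<xi>" using \<xi> by (simp add: slashed_T_def)
  then obtain A where A: "A \<in> atlas M" "base \<xi> \<in> fst A"
    using point_in_chart[OF M, of "base \<xi>"] by (auto simp: is_tangent_def simp del: split_paired_All split_paired_Ex)
  obtain x0 y0 where x0: "x0 \<in> chart_image A" and \<xi>_eq: "\<xi> = chart_inv (tangent_chart M A) (x0, y0)"
    using tangent_cases[OF M A(1) tan A(2)] .
  have y0: "y0 \<noteq> 0" using \<xi> unfolding \<xi>_eq chart_inv_in_slashed_T[OF M A(1) x0] .
  let ?U = "chart_image A \<times> - {0}"
  let ?F = "\<lambda>z. (snd z, (-2) *\<^sub>R spray_coeff M S A (fst z) (snd z))"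
  have F: "smooth_on ?U ?F"
    by (intro smooth_on_Pair smooth_on_scaleR smooth_on_const smooth_on_spray_coeff[OF M S A(1)]
        smooth_on_linear bounded_linear_snd open_slashed_image[OF M S A(1)])
  obtain e u where e: "e > 0" and u0: "u 0 = (x0, y0)"
    and uU: "\<And>t. t \<in> {-e<..<e} \<Longrightarrow> u t \<in> ?U"
    and u: "\<And>t. t \<in> {-e<..<e} \<Longrightarrow> (u has_vector_derivative ?F (u t)) (at t)"
    using smooth_ode_solution[OF F, of "(x0, y0)"] x0 y0 by auto
  let ?I = "{-e<..<e}"
  define x where "x = (\<lambda>t. fst (u t))"
  define y where "y = (\<lambda>t. snd (u t))"
  define c where "c = (\<lambda>t. chart_inv A (x t))"
  have xyd: "(x has_vector_derivative y t) (at t)"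
    "(y has_vector_derivative (-2) *\<^sub>R spray_coeff M S A (x t) (y t)) (at t)" if "t \<in> ?I" for t
    using bounded_linear.has_vector_derivative[OF bounded_linear_fst u[OF that]]
      bounded_linear.has_vector_derivative[OF bounded_linear_snd u[OF that]]
    by (simp_all add: x_def y_def)
  have x': "vector_derivative x (at t) = y t" if "t \<in> ?I" for t
    by (rule vector_derivative_at[OF xyd(1)[OF that]])
  have x'': "vector_derivative (\<lambda>t. vector_derivative x (at t)) (at t) = (-2) *\<^sub>R spray_coeff M S A (x t) (y t)"
    if "t \<in> ?I" for t
    using vector_derivative_cong_open[OF open_greaterThanLessThan that x']
      vector_derivative_at[OF xyd(2)[OF that]] by simp
  have nz: "y t \<noteq> 0" and xA: "x t \<in> chart_image A" if "t \<in> ?I" for t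
    using uU[OF that] by (auto simp: x_def y_def)
  have R: "represents M A ?I x c"
    using smooth_on_fst[OF smooth_on_ode_solution[OF F open_greaterThanLessThan uU u]] xA
    by (intro representsI A(1)) (auto simp: x_def c_def)
  note g = geodesic_equation[OF M S A(1) R]
  have "geodesic_on M (slashed_T M) S ?I c"
    unfolding geodesic_on_def
  proof (intro conjI ballI)
    show "open_interval ?I" using e by (auto simp: open_interval_def is_interval_oo)
    show "smooth_map euclidean ?I M c" unfolding smooth_map_euclidean_iff[OF M] using R by blast
    fix t assume t: "t \<in> ?I"
    show "velocity M c t \<in> slashed_T M" using g(1)[OF t] nz[OF t] x'[OF t] by simp
    show "velocity (TB M) (velocity M c) t = S (velocity M c t)"
      using g(2)[OF t] nz[OF t] x'[OF t] x''[OF t] by simp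
  qed
  moreover have "velocity M c 0 = \<xi>"
    using represents_velocity2(1)[OF M R, of 0] x'[of 0] e u0 by (simp add: \<xi>_eq x_def y_def)
  ultimately show ?thesis using that e by blast
qed

section \<open>Maximal geodesics\<close>

lemma geodesic_on_glue:
  assumes N: "charted N" and J: "open_interval J"
    and loc: "\<And>t. t \<in> J \<Longrightarrow> \<exists>J' d'. t \<in> J' \<and> J' \<subseteq> J \<and> geodesic_on N W S J' d' \<and> (\<forall>s\<in>J'. d s = d' s)"
  shows "geodesic_on N W S J d"
  unfolding geodesic_on_def
proof (intro conjI ballI)
  show "open_interval J" by fact
  show "smooth_map euclidean J N d"
    unfolding smooth_map_euclidean_iff[OF N]
  proof
    fix t assume "t \<in> J"
    then obtain J' d' where J': "t \<in> J'" "J' \<subseteq> J" "geodesic_on N W S J' d'" "\<forall>s\<in>J'. d s = d' s"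
      using loc by blast
    then have "smooth_map euclidean J' N d'" by (simp add: geodesic_on_def)
    then obtain A U f where U: "t \<in> U" "U \<subseteq> J'" and R: "represents N A U f d'"
      using J'(1) unfolding smooth_map_euclidean_iff[OF N] by blast
    have "represents N A U f d" by (rule represents_cong[OF R]) (use U J'(4) in auto)
    moreover have "U \<subseteq> J" using U(2) J'(2) by blast
    ultimately show "\<exists>A U f. t \<in> U \<and> U \<subseteq> J \<and> represents N A U f d" using U(1) by (intro exI conjI)
  qed
  fix t assume "t \<in> J"
  then obtain J' d' where J': "t \<in> J'" "J' \<subseteq> J" "geodesic_on N W S J' d'" "\<forall>s\<in>J'. d s = d' s"
    using loc by blast
  have "open J'" using J'(3) by (simp add: geodesic_on_def open_interval_def)
  have v: "velocity N d s = velocity N d' s" if "s \<in> J'" for s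
    by (rule velocity_cong[OF \<open>open J'\<close> that]) (use J'(4) in blast)
  have vv: "velocity (TB N) (velocity N d) t = velocity (TB N) (velocity N d') t"
    by (rule velocity_cong[OF \<open>open J'\<close> J'(1) v])
  show "velocity N d t \<in> W" "velocity (TB N) (velocity N d) t = S (velocity N d t)"
    unfolding vv v[OF J'(1)] using J'(1,3) by (auto simp: geodesic_on_def)
qed

text \<open>Members of a chain of graphs agree where both are defined, so the union is again a
  graph. The common time \<open>t\<^sub>0\<close> makes the union of the intervals
  connected.\<close>

lemma geodesic_on_Union_chain:
  assumes N: "charted N" and ne: "\<C> \<noteq> {}"
    and geo: "\<And>\<Gamma>. \<Gamma> \<in> \<C> \<Longrightarrow> \<exists>J d. geodesic_on N W S J d \<and> \<Gamma> = (\<lambda>t. (t, d t)) ` J"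
    and chain: "\<And>\<Gamma> \<Delta>. \<Gamma> \<in> \<C> \<Longrightarrow> \<Delta> \<in> \<C> \<Longrightarrow> \<Gamma> \<subseteq> \<Delta> \<or> \<Delta> \<subseteq> \<Gamma>"
    and common: "\<And>\<Gamma>. \<Gamma> \<in> \<C> \<Longrightarrow> t\<^sub>0 \<in> fst ` \<Gamma>"
  shows "\<exists>J d. geodesic_on N W S J d \<and> \<Union>\<C> = (\<lambda>t. (t, d t)) ` J"
proof -
  define J where "J = fst ` \<Union>\<C>"
  define d where "d = (\<lambda>t. SOME p. (t, p) \<in> \<Union>\<C>)"
  have single: "p = q" if pq: "(t, p) \<in> \<Union>\<C>" "(t, q) \<in> \<Union>\<C>" for t p q
  proof -
    obtain \<Gamma> where \<Gamma>: "\<Gamma> \<in> \<C>" "(t, p) \<in> \<Gamma>" "(t, q) \<in> \<Gamma>" using pq chain by blast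
    with geo[OF \<Gamma>(1)] show ?thesis by auto
  qed
  have d: "(t, d t) \<in> \<Union>\<C>" if "t \<in> J" for t
  proof -
    have "\<exists>p. (t, p) \<in> \<Union>\<C>" using that by (force simp: J_def)
    then show ?thesis unfolding d_def by (rule someI_ex)
  qed
  have graph: "\<Union>\<C> = (\<lambda>t. (t, d t)) ` J"
  proof
    show "\<Union>\<C> \<subseteq> (\<lambda>t. (t, d t)) ` J"
    proof
      fix z assume z: "z \<in> \<Union>\<C>"
      obtain t p where tp: "z = (t, p)" by (cases z)
      have "t \<in> J" unfolding J_def using z tp by (metis fst_conv image_eqI)
      moreover from this have "p = d t" using single d z tp by blast
      ultimately show "z \<in> (\<lambda>t. (t, d t)) ` J" using tp by blast
    qed
  qed (use d in blast)
  have loc: "\<exists>J' d'. t \<in> J' \<and> J' \<subseteq> J \<and> geodesic_on N W S J' d' \<and> (\<forall>s\<in>J'. d s = d' s)" if t: "t \<in> J" for t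
  proof -
    obtain \<Gamma> where \<Gamma>: "\<Gamma> \<in> \<C>" "(t, d t) \<in> \<Gamma>" using d[OF t] by blast
    obtain J' d' where g: "geodesic_on N W S J' d'" "\<Gamma> = (\<lambda>t. (t, d' t)) ` J'" using geo[OF \<Gamma>(1)] by blast
    have mem: "(s, d' s) \<in> \<Union>\<C>" if "s \<in> J'" for s using that g(2) \<Gamma>(1) by blast
    have "J' \<subseteq> J" unfolding J_def using mem by force
    moreover have "d s = d' s" if "s \<in> J'" for s
      using single[OF d mem[OF that]] \<open>J' \<subseteq> J\<close> that by blast
    moreover have "t \<in> J'" using \<Gamma>(2) g(2) by auto
    ultimately show ?thesis using g(1) by blast
  qed
  have "open_interval J"
    unfolding open_interval_def
  proof (intro conjI)
    have J_eq: "J = (\<Union>\<Gamma>\<in>\<C>. fst ` \<Gamma>)" by (auto simp: J_def)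
    obtain \<Gamma> where \<Gamma>: "\<Gamma> \<in> \<C>" using ne by blast
    then have "t\<^sub>0 \<in> J" unfolding J_eq using common[OF \<Gamma>] by (rule UN_I)
    then show "J \<noteq> {}" by blast
    have int: "open_interval (fst ` \<Gamma>)" if "\<Gamma> \<in> \<C>" for \<Gamma>
      using geo[OF that] by (auto simp: geodesic_on_def image_image)
    show "open J" unfolding J_eq using int by (auto simp: open_interval_def)
    have "connected J"
      unfolding J_eq
    proof (rule connected_Union)
      show "connected Z" if "Z \<in> (`) fst ` \<C>" for Z
        using that int by (auto simp: open_interval_def is_interval_connected_1)
      have "t\<^sub>0 \<in> (\<Inter>\<Gamma>\<in>\<C>. fst ` \<Gamma>)" using common by blast
      then show "(\<Inter>\<Gamma>\<in>\<C>. fst ` \<Gamma>) \<noteq> {}" by blast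
    qed
    then show "is_interval J" by (simp add: is_interval_connected_1)
  qed
  from geodesic_on_glue[OF N this loc] graph show ?thesis by blast
qed

text \<open>Zorn's lemma for graphs ordered by inclusion. Pairs of an interval and a total function
  would not be ordered antisymmetrically by extension, since the function is arbitrary outside the
  interval; graphs forget those values.\<close>

lemma geodesic_on_extends:
  assumes N: "charted N" and c: "geodesic_on N W S I c"
  obtains J d where "geodesic N W S J d" "I \<subseteq> J" "\<And>t. t \<in> I \<Longrightarrow> d t = c t"
proof -
  let ?graph = "\<lambda>J d. (\<lambda>t. (t, d t)) ` J"
  define \<G> where "\<G> = {\<Gamma>. ?graph I c \<subseteq> \<Gamma> \<and> (\<exists>J d. geodesic_on N W S J d \<and> \<Gamma> = ?graph J d)}"
  obtain t0 where t0: "t0 \<in> I" using c by (auto simp: geodesic_on_def open_interval_def)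
  have "\<exists>\<Gamma>\<in>\<G>. \<forall>\<Delta>\<in>\<G>. \<Gamma> \<subseteq> \<Delta> \<longrightarrow> \<Delta> = \<Gamma>"
  proof (rule subset_Zorn_nonempty)
    show "\<G> \<noteq> {}" using c unfolding \<G>_def by blast
    fix \<C> assume ne: "\<C> \<noteq> {}" and chain: "subset.chain \<G> \<C>"
    have sub: "\<C> \<subseteq> \<G>" and lin: "\<And>\<Gamma> \<Delta>. \<Gamma> \<in> \<C> \<Longrightarrow> \<Delta> \<in> \<C> \<Longrightarrow> \<Gamma> \<subseteq> \<Delta> \<or> \<Delta> \<subseteq> \<Gamma>"
      using chain unfolding subset_chain_def by blast+
    have ext: "?graph I c \<subseteq> \<Gamma>" if "\<Gamma> \<in> \<C>" for \<Gamma> using sub that unfolding \<G>_def by blast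
    have "\<exists>J d. geodesic_on N W S J d \<and> \<Union>\<C> = ?graph J d"
    proof (rule geodesic_on_Union_chain[OF N ne _ lin])
      show "\<exists>J d. geodesic_on N W S J d \<and> \<Gamma> = ?graph J d" if "\<Gamma> \<in> \<C>" for \<Gamma>
        using sub that unfolding \<G>_def by blast
      show "t0 \<in> fst ` \<Gamma>" if "\<Gamma> \<in> \<C>" for \<Gamma>
        using ext[OF that] t0 by force
    qed
    moreover have "?graph I c \<subseteq> \<Union>\<C>" using ne ext by blast
    ultimately show "\<Union>\<C> \<in> \<G>" unfolding \<G>_def by blast
  qed
  then obtain \<Gamma> where \<Gamma>: "\<Gamma> \<in> \<G>" and max: "\<And>\<Delta>. \<Delta> \<in> \<G> \<Longrightarrow> \<Gamma> \<subseteq> \<Delta> \<Longrightarrow> \<Delta> = \<Gamma>" by blast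
  then obtain J d where J: "geodesic_on N W S J d" "\<Gamma> = ?graph J d" "?graph I c \<subseteq> ?graph J d"
    unfolding \<G>_def by blast
  have "geodesic N W S J d"
    unfolding geodesic_def
  proof (intro conjI allI impI J(1))
    fix J' d' assume J': "geodesic_on N W S J' d' \<and> J \<subseteq> J' \<and> (\<forall>t\<in>J. d' t = d t)"
    then have sub: "?graph J d \<subseteq> ?graph J' d'" by force
    have "?graph J' d' \<in> \<G>"
      unfolding \<G>_def using J' subset_trans[OF J(3) sub]
      by (intro CollectI conjI exI[of _ J'] exI[of _ d']) simp_all
    then have "?graph J' d' = ?graph J d" using max sub unfolding J(2) by blast
    then have "fst ` ?graph J' d' = fst ` ?graph J d" by (rule arg_cong)
    then show "J' = J" by (simp add: image_image)
  qed
  moreover have "I \<subseteq> J" "\<And>t. t \<in> I \<Longrightarrow> d t = c t" using J(3) by auto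
  ultimately show ?thesis using that by blast
qed

lemma geodesic_exists:
  assumes M: "charted M" and S: "spray M (slashed_T M) S" and \<xi>: "\<xi> \<in> slashed_T M"
  obtains I c where "geodesic M (slashed_T M) S I c" "0 \<in> I" "velocity M c 0 = \<xi>"
proof -
  obtain e c where e: "e > 0" and c: "geodesic_on M (slashed_T M) S {-e<..<e} c" "velocity M c 0 = \<xi>"
    using local_geodesic[OF assms] .
  obtain J d where J: "geodesic M (slashed_T M) S J d" "{-e<..<e} \<subseteq> J"
    "\<And>t. t \<in> {-e<..<e} \<Longrightarrow> d t = c t"
    using geodesic_on_extends[OF M c(1)] by blast
  have "velocity M d 0 = velocity M c 0"
    by (rule velocity_cong[OF open_greaterThanLessThan _ J(3)]) (use e in auto)
  moreover have "0 \<in> J" using e J(2) by force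
  ultimately show ?thesis using that J(1) c(2) by simp
qed

section \<open>The scaled velocity field of a geodesic\<close>

lemma vscale_chart_inv:
  assumes M: "charted M" "A \<in> atlas M" and x: "x \<in> chart_image A"
  shows "vscale s (chart_inv (tangent_chart M A) (x, v)) = chart_inv (tangent_chart M A) (x, s *\<^sub>R v)"
proof (rule tvec.expand, intro conjI ext)
  show "base (vscale s (chart_inv (tangent_chart M A) (x, v))) =
      base (chart_inv (tangent_chart M A) (x, s *\<^sub>R v))"
    by (simp add: vscale_def base_chart_inv[OF M x])
  show "comp (vscale s (chart_inv (tangent_chart M A) (x, v))) B =
      comp (chart_inv (tangent_chart M A) (x, s *\<^sub>R v)) B" for B
    using linear_transition_derivative[OF M x, of B]
    by (simp add: vscale_def comp_chart_inv[OF M x] linear_scale)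
qed

definition scaled_velocity ::
  "('m, 'e::euclidean_space) manifold \<Rightarrow> (real \<Rightarrow> 'm) \<Rightarrow> real \<Rightarrow> ('m, 'e) tvec" where
  "scaled_velocity M c t = vscale t (velocity M c t)"

lemma base_scaled_velocity [simp]: "base (scaled_velocity M c t) = c t"
  by (simp add: scaled_velocity_def vscale_def velocity_def)

lemma base_comp_scaled_velocity [simp]: "base \<circ> scaled_velocity M c = c"
  by (simp add: fun_eq_iff)

lemma represents_scaled_velocity:
  assumes M: "charted M" and R: "represents M A U f c"
  shows "represents (TB M) (tangent_chart M A) U
    (\<lambda>t. (f t, t *\<^sub>R vector_derivative f (at t))) (scaled_velocity M c)"
proof (rule representsI)
  note A = represents_atlas[OF R]
  show "tangent_chart M A \<in> atlas (TB M)" using A by simp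
  show "smooth_on U (\<lambda>t. (f t, t *\<^sub>R vector_derivative f (at t)))"
    by (intro smooth_on_Pair smooth_on_scaleR smooth_on_ident represents_open[OF R]
        smooth_on_vector_derivative represents_smooth[OF R])
  fix t assume t: "t \<in> U"
  note x = represents_image[OF R t]
  show "(f t, t *\<^sub>R vector_derivative f (at t)) \<in> chart_image (tangent_chart M A)"
    using x by (simp add: chart_image_tangent_chart[OF M A])
  show "scaled_velocity M c t = chart_inv (tangent_chart M A) (f t, t *\<^sub>R vector_derivative f (at t))"
    unfolding scaled_velocity_def represents_velocity2(1)[OF M R t] by (rule vscale_chart_inv[OF M A x])
qed

lemma smooth_map_scaled_velocity:
  assumes M: "charted M" and c: "smooth_map euclidean I M c"
  shows "smooth_map euclidean I (TB M) (scaled_velocity M c)"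
  unfolding smooth_map_euclidean_iff[OF charted_TB[OF M]]
proof
  fix t assume "t \<in> I"
  then obtain A U f where U: "t \<in> U" "U \<subseteq> I" and R: "represents M A U f c"
    using c unfolding smooth_map_euclidean_iff[OF M] by blast
  from represents_scaled_velocity[OF M R] U
  show "\<exists>A U f. t \<in> U \<and> U \<subseteq> I \<and> represents (TB M) A U f (scaled_velocity M c)" by (intro exI conjI)
qed

text \<open>Differentiating the geodesic equation shows that \<open>f1\<close> solves the linearized
  equation. For \<open>y = t f1\<close> the product rule adds \<open>2 f2\<close> to the second
  derivative, and the summand \<open>f1\<close> of \<open>y'\<close> adds \<open>-2 D(0, f1)\<close>
  to the right side. Both equal \<open>-4 G\<close>, by the geodesic equation and by Euler's
  identity.\<close>

lemma scaled_velocity_jacobi_equation: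
  assumes M: "charted M" and S: "spray M (slashed_T M) S"
    and c: "geodesic_on M (slashed_T M) S I c" and t: "t \<in> I" and A: "A \<in> atlas M" "c t \<in> fst A"
  shows "jacobi_equation M S A (scaled_velocity M c) t"
proof -
  have sm: "smooth_map euclidean I M c" using c by (simp add: geodesic_on_def)
  obtain U where U: "t \<in> U" "U \<subseteq> I" and R: "represents M A U (\<lambda>s. snd A (c s)) c"
    using smooth_map_represents[OF M sm t A] .
  define f where "f = (\<lambda>s. snd A (c s))"
  define f1 where "f1 = (\<lambda>s. vector_derivative f (at s))"
  define f2 where "f2 = (\<lambda>s. vector_derivative f1 (at s))"
  let ?G = "\<lambda>z. spray_coeff M S A (fst z) (snd z)"
  have R: "represents M A U f c" unfolding f_def by (rule R)
  note openU = represents_open[OF R]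
  have f: "smooth_on U f" by (rule represents_smooth[OF R])
  have f1: "smooth_on U f1" unfolding f1_def by (rule smooth_on_vector_derivative[OF f])
  have f2: "smooth_on U f2" unfolding f2_def by (rule smooth_on_vector_derivative[OF f1])
  have D: "(f has_vector_derivative f1 s) (at s)" "(f1 has_vector_derivative f2 s) (at s)" if "s \<in> U" for s
    using smooth_on_has_vector_derivative[OF f that] smooth_on_has_vector_derivative[OF f1 that]
    by (simp_all add: f1_def f2_def)
  have nz: "f1 s \<noteq> 0" and geo: "f2 s = (-2) *\<^sub>R ?G (f s, f1 s)" if s: "s \<in> U" for s
  proof -
    have "s \<in> I" using s U(2) by blast
    then have v: "velocity M c s \<in> slashed_T M" "velocity (TB M) (velocity M c) s = S (velocity M c s)"
      using c by (auto simp: geodesic_on_def)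
    show "f1 s \<noteq> 0" using v(1) geodesic_equation(1)[OF M S A(1) R s] by (simp add: f1_def)
    then show "f2 s = (-2) *\<^sub>R ?G (f s, f1 s)"
      using v(2) geodesic_equation(2)[OF M S A(1) R s] by (simp add: f2_def f1_def)
  qed
  have mem: "(f s, f1 s) \<in> chart_image A \<times> - {0}" if "s \<in> U" for s
    using represents_image[OF R that] nz[OF that] by simp
  let ?D = "frechet_derivative ?G (at (f t, f1 t))"
  have DG: "(?G has_derivative ?D) (at (f t, f1 t))"
    by (rule smooth_on_has_derivative[OF smooth_on_spray_coeff[OF M S A(1)] mem[OF U(1)]])
  interpret linear ?D using DG by (rule has_derivative_linear)
  have "((\<lambda>s. (f s, f1 s)) has_derivative (\<lambda>h. h *\<^sub>R (f1 t, f2 t))) (at t)"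
    using has_vector_derivative_Pair[OF D[OF U(1)]] by (simp only: has_vector_derivative_def)
  from diff_chain_at[OF this DG]
  have "((\<lambda>s. ?G (f s, f1 s)) has_vector_derivative ?D (f1 t, f2 t)) (at t)"
    by (simp only: has_vector_derivative_def o_def scale)
  from bounded_linear.has_vector_derivative[OF bounded_linear_scaleR_right this]
  have "((\<lambda>s. (-2) *\<^sub>R ?G (f s, f1 s)) has_vector_derivative (-2) *\<^sub>R ?D (f1 t, f2 t)) (at t)" .
  \<comment> \<open>The third derivative of the coordinate curve, obtained from the geodesic
    equation, which holds on all of \<open>U\<close>.\<close>
  then have D2: "(f2 has_vector_derivative (-2) *\<^sub>R ?D (f1 t, f2 t)) (at t)"
    by (rule has_vector_derivative_transform_within_open[OF _ openU U(1)]) (simp only: geo)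
  have y: "comp (scaled_velocity M c s) A = s *\<^sub>R f1 s" if "s \<in> U" for s
    using represents_eq[OF represents_scaled_velocity[OF M R] that] represents_image[OF R that]
    by (simp add: comp_chart_inv_self[OF M A(1)] f1_def)
  have y1: "vector_derivative (\<lambda>s. comp (scaled_velocity M c s) A) (at s) = s *\<^sub>R f2 s + f1 s" if s: "s \<in> U" for s
  proof -
    have "((\<lambda>s. s *\<^sub>R f1 s) has_vector_derivative s *\<^sub>R f2 s + 1 *\<^sub>R f1 s) (at s)"
      by (intro has_vector_derivative_scaleR D[OF s] DERIV_ident)
    from vector_derivative_at[OF this] show ?thesis
      using vector_derivative_cong_open[OF openU s y] by simp
  qed
  have "((\<lambda>s. s *\<^sub>R f2 s + f1 s) has_vector_derivative
      (t *\<^sub>R ((-2) *\<^sub>R ?D (f1 t, f2 t)) + 1 *\<^sub>R f2 t) + f2 t) (at t)"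
    by (intro has_vector_derivative_add has_vector_derivative_scaleR D2 D(2)[OF U(1)] DERIV_ident)
  from vector_derivative_at[OF this] vector_derivative_cong_open[OF openU U(1) y1]
  have y2: "vector_derivative (\<lambda>t. vector_derivative (\<lambda>s. comp (scaled_velocity M c s) A) (at t)) (at t) =
    t *\<^sub>R ((-2) *\<^sub>R ?D (f1 t, f2 t)) + f2 t + f2 t" by simp
  have "?D (t *\<^sub>R f1 t, t *\<^sub>R f2 t + f1 t) = t *\<^sub>R ?D (f1 t, f2 t) + ?D (0, f1 t)"
    using add[of "t *\<^sub>R (f1 t, f2 t)" "(0, f1 t)"] scale[of t "(f1 t, f2 t)"] by simp
  also have "?D (0, f1 t) = 2 *\<^sub>R ?G (f t, f1 t)"
    using spray_coeff_euler[OF M S A(1) _ nz[OF U(1)]] represents_image[OF R U(1)] by simp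
  finally have "(-2) *\<^sub>R ?D (t *\<^sub>R f1 t, t *\<^sub>R f2 t + f1 t) =
      t *\<^sub>R ((-2) *\<^sub>R ?D (f1 t, f2 t)) + 2 *\<^sub>R ((-2) *\<^sub>R ?G (f t, f1 t))"
    by (simp add: scaleR_add_right)
  then have eq: "(-2) *\<^sub>R ?D (t *\<^sub>R f1 t, t *\<^sub>R f2 t + f1 t) =
      t *\<^sub>R ((-2) *\<^sub>R ?D (f1 t, f2 t)) + f2 t + f2 t"
    unfolding geo[OF U(1), symmetric] by (simp add: scaleR_2)
  let ?x = "\<lambda>s. snd A (base (scaled_velocity M c s))"
  have x: "?x t = f t" "vector_derivative ?x (at t) = f1 t" by (simp_all add: f_def f1_def)
  have xt: "?x t \<in> chart_image A" and x1: "vector_derivative ?x (at t) \<noteq> 0"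
    unfolding x using represents_image[OF R U(1)] nz[OF U(1)] .
  show ?thesis
    unfolding jacobi_equation_iff[OF M S A(1) xt x1]
    unfolding x y2 y1[OF U(1)] y[OF U(1)] using eq by (rule sym)
qed

lemma scaled_velocity_jacobi_field:
  assumes M: "charted M" and S: "spray M (slashed_T M) S" and c: "geodesic M (slashed_T M) S I c"
  shows "jacobi_field M S I (scaled_velocity M c)"
proof -
  have c': "geodesic_on M (slashed_T M) S I c" using c by (simp add: geodesic_def)
  then have "smooth_map euclidean I M c" by (simp add: geodesic_on_def)
  then show ?thesis
    unfolding jacobi_field_iff
    using c smooth_map_scaled_velocity[OF M] scaled_velocity_jacobi_equation[OF M S c'] by simp
qed

text \<open>Maximality comes from the base: an extension of \<open>J\<close> as a geodesic of the
  lift projects to an extension of the base geodesic, which is already maximal.\<close>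

lemma jacobi_field_lift_geodesic:
  assumes M: "charted M" and S: "spray M (slashed_T M) S" and J: "jacobi_field M S I J"
  shows "geodesic (TB M) (slashed_TT M) (complete_lift M S) I J"
  unfolding geodesic_def
proof (intro conjI allI impI)
  have g: "geodesic M (slashed_T M) S I (base \<circ> J)" using J by (simp add: jacobi_field_iff)
  then show "geodesic_on (TB M) (slashed_TT M) (complete_lift M S) I J"
    using J by (simp add: lift_geodesic_on_iff[OF M S] jacobi_field_iff geodesic_def)
  fix K d
  assume "geodesic_on (TB M) (slashed_TT M) (complete_lift M S) K d \<and> I \<subseteq> K \<and> (\<forall>t\<in>I. d t = J t)"
  then have "geodesic_on M (slashed_T M) S K (base \<circ> d)" "I \<subseteq> K" "\<forall>t\<in>I. (base \<circ> d) t = (base \<circ> J) t"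
    by (simp_all add: lift_geodesic_on_iff[OF M S])
  then show "K = I" using g unfolding geodesic_def by blast
qed

section \<open>Comparison of two sprays at the zero of the field\<close>

lemma scaled_velocity_reparameterization:
  assumes M: "charted M" and S1: "spray M (slashed_T M) S\<^sub>1" and S2: "spray M (slashed_T M) S\<^sub>2"
    and c: "geodesic_on M (slashed_T M) S\<^sub>1 I c" and 0: "0 \<in> I"
    and d: "geodesic_on (TB M) (slashed_TT M) (complete_lift M S\<^sub>2) K d"
    and r: "reparameterization I (scaled_velocity M c) K d"
  shows "S\<^sub>1 (velocity M c 0) = S\<^sub>2 (velocity M c 0)"
proof -
  obtain \<sigma> where \<sigma>: "smooth_on K \<sigma>" "bij_betw \<sigma> K I"
    and \<sigma>_pos: "\<And>t. t \<in> K \<Longrightarrow> vector_derivative \<sigma> (at t) > 0"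
    and d_eq: "\<And>t. t \<in> K \<Longrightarrow> d t = scaled_velocity M c (\<sigma> t)"
    using r unfolding reparameterization_def by blast
  \<comment> \<open>A reparameterization is onto \<open>I\<close>, so some parameter reaches the
    time 0 where the field vanishes.\<close>
  obtain s where s: "s \<in> K" "\<sigma> s = 0" using \<sigma>(2) 0 unfolding bij_betw_def by (metis imageE)
  have sm: "smooth_map euclidean I M c" using c by (simp add: geodesic_on_def)
  then have "c 0 \<in> points M" using 0 by (auto simp: smooth_map_def)
  then obtain A where A: "A \<in> atlas M" "c 0 \<in> fst A" using point_in_chart[OF M] by blast
  obtain U f where U: "0 \<in> U" "U \<subseteq> I" and R: "represents M A U f c"
    using smooth_map_represents[OF M sm 0 A] .
  define f1 where "f1 = (\<lambda>s. vector_derivative f (at s))"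
  define f2 where "f2 = (\<lambda>s. vector_derivative f1 (at s))"
  define \<sigma>1 where "\<sigma>1 = (\<lambda>s. vector_derivative \<sigma> (at s))"
  define \<mu> where "\<mu> = vector_derivative \<sigma>1 (at s)"
  have f: "smooth_on U f" by (rule represents_smooth[OF R])
  have f1: "smooth_on U f1" unfolding f1_def by (rule smooth_on_vector_derivative[OF f])
  have f2: "smooth_on U f2" unfolding f2_def by (rule smooth_on_vector_derivative[OF f1])
  have \<sigma>1: "smooth_on K \<sigma>1" unfolding \<sigma>1_def by (rule smooth_on_vector_derivative[OF \<sigma>(1)])
  \<comment> \<open>The parameters near \<open>s\<close> for which the reparameterized curve stays
    in the chart \<open>A\<close>; all derivatives below are taken on this open set.\<close>
  define K' where "K' = \<sigma> -` U \<inter> K"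
  have openK': "open K'"
    unfolding K'_def using smooth_on_continuous_on[OF \<sigma>(1)] smooth_on_open[OF \<sigma>(1)] represents_open[OF R]
    by (simp add: continuous_on_open_vimage)
  have sK': "s \<in> K'" using s U by (simp add: K'_def)
  have K': "t \<in> K" "\<sigma> t \<in> U" if "t \<in> K'" for t using that by (auto simp: K'_def)
  have D\<sigma>: "(\<sigma> has_vector_derivative \<sigma>1 t) (at t)" if "t \<in> K'" for t
    using smooth_on_has_vector_derivative[OF \<sigma>(1) K'(1)[OF that]] by (simp add: \<sigma>1_def)
  have D\<sigma>1: "(\<sigma>1 has_vector_derivative \<mu>) (at s)"
    using smooth_on_has_vector_derivative[OF \<sigma>1 s(1)] by (simp add: \<mu>_def)
  have Df: "((\<lambda>t. f (\<sigma> t)) has_vector_derivative \<sigma>1 t *\<^sub>R f1 (\<sigma> t)) (at t)"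
    and Df1: "((\<lambda>t. f1 (\<sigma> t)) has_vector_derivative \<sigma>1 t *\<^sub>R f2 (\<sigma> t)) (at t)"
    and Df2: "\<exists>w. ((\<lambda>t. f2 (\<sigma> t)) has_vector_derivative w) (at t)" if t: "t \<in> K'" for t
    using vector_diff_chain_at[OF D\<sigma>[OF t] smooth_on_has_vector_derivative[OF f K'(2)[OF t]]]
      vector_diff_chain_at[OF D\<sigma>[OF t] smooth_on_has_vector_derivative[OF f1 K'(2)[OF t]]]
      vector_diff_chain_at[OF D\<sigma>[OF t] smooth_on_has_vector_derivative[OF f2 K'(2)[OF t]]]
    by (auto simp: o_def f1_def f2_def)
  define x where "x = (\<lambda>t. f (\<sigma> t))"
  define y where "y = (\<lambda>t. \<sigma> t *\<^sub>R f1 (\<sigma> t))"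
  have Rd: "represents (TB M) (tangent_chart M A) K' (\<lambda>t. (x t, y t)) d"
  proof (rule representsI)
    note R' = represents_scaled_velocity[OF M R]
    have \<sigma>K': "smooth_on K' \<sigma>" by (rule smooth_on_subset[OF \<sigma>(1) openK']) (auto simp: K'_def)
    show "tangent_chart M A \<in> atlas (TB M)" using A(1) by simp
    show "smooth_on K' (\<lambda>t. (x t, y t))"
      using smooth_on_compose[OF represents_smooth[OF R'] \<sigma>K' K'(2)] by (simp add: x_def y_def f1_def)
    show "(x t, y t) \<in> chart_image (tangent_chart M A)" "d t = chart_inv (tangent_chart M A) (x t, y t)"
      if "t \<in> K'" for t
      using represents_image[OF R' K'(2)[OF that]] represents_eq[OF R' K'(2)[OF that]] d_eq[OF K'(1)[OF that]]
      by (simp_all add: x_def y_def f1_def)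
  qed
  have x1: "vector_derivative x (at t) = \<sigma>1 t *\<^sub>R f1 (\<sigma> t)" if "t \<in> K'" for t
    unfolding x_def by (rule vector_derivative_at[OF Df[OF that]])
  have y1: "vector_derivative y (at t) = \<sigma> t *\<^sub>R (\<sigma>1 t *\<^sub>R f2 (\<sigma> t)) + \<sigma>1 t *\<^sub>R f1 (\<sigma> t)" if t: "t \<in> K'" for t
    unfolding y_def
    by (rule vector_derivative_at[OF has_vector_derivative_scaleR[OF _ Df1[OF t]]])
      (use D\<sigma>[OF t] in \<open>simp add: has_real_derivative_iff_has_vector_derivative\<close>)
  let ?l = "\<sigma>1 s" and ?v = "f1 0" and ?p = "f 0"
  let ?G1 = "spray_coeff M S\<^sub>1 A" and ?G2 = "spray_coeff M S\<^sub>2 A"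
  have \<sigma>1r: "(\<sigma>1 has_real_derivative \<mu>) (at s)" and \<sigma>r: "(\<sigma> has_real_derivative ?l) (at s)"
    using D\<sigma>1 D\<sigma>[OF sK'] by (simp_all add: has_real_derivative_iff_has_vector_derivative)
  have dx1: "((\<lambda>t. \<sigma>1 t *\<^sub>R f1 (\<sigma> t)) has_vector_derivative ?l *\<^sub>R (?l *\<^sub>R f2 0) + \<mu> *\<^sub>R ?v) (at s)"
    using has_vector_derivative_scaleR[OF \<sigma>1r Df1[OF sK']] by (simp add: s(2))
  have x2: "vector_derivative (\<lambda>t. vector_derivative x (at t)) (at s) = ?l *\<^sub>R (?l *\<^sub>R f2 0) + \<mu> *\<^sub>R ?v"
    using vector_derivative_cong_open[OF openK' sK' x1] vector_derivative_at[OF dx1] by simp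
  \<comment> \<open>The value of \<open>w\<close> is irrelevant: the third derivative of the curve
    enters with the factor \<open>\<sigma> s = 0\<close>.\<close>
  obtain w where w: "((\<lambda>t. f2 (\<sigma> t)) has_vector_derivative w) (at s)" using Df2[OF sK'] by blast
  have "((\<lambda>t. \<sigma> t *\<^sub>R (\<sigma>1 t *\<^sub>R f2 (\<sigma> t))) has_vector_derivative ?l *\<^sub>R (?l *\<^sub>R f2 0)) (at s)"
    using has_vector_derivative_scaleR[OF \<sigma>r has_vector_derivative_scaleR[OF \<sigma>1r w]] by (simp add: s(2))
  from has_vector_derivative_add[OF this dx1]
  have y2: "vector_derivative (\<lambda>t. vector_derivative y (at t)) (at s) =
      ?l *\<^sub>R (?l *\<^sub>R f2 0) + (?l *\<^sub>R (?l *\<^sub>R f2 0) + \<mu> *\<^sub>R ?v)"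
    using vector_derivative_cong_open[OF openK' sK' y1] vector_derivative_at by fastforce
  have p: "?p \<in> chart_image A" by (rule represents_image[OF R U(1)])
  have l: "?l > 0" using \<sigma>_pos[OF s(1)] by (simp add: \<sigma>1_def)
  have v: "?v \<noteq> 0" and f2: "f2 0 = (-2) *\<^sub>R ?G1 ?p ?v"
  proof -
    have "velocity M c 0 \<in> slashed_T M" "velocity (TB M) (velocity M c) 0 = S\<^sub>1 (velocity M c 0)"
      using c 0 by (auto simp: geodesic_on_def)
    then show "?v \<noteq> 0" "f2 0 = (-2) *\<^sub>R ?G1 ?p ?v"
      using geodesic_equation[OF M S1 A(1) R U(1)] by (auto simp: f1_def f2_def)
  qed
  have lv: "?l *\<^sub>R ?v \<noteq> 0" using l v by simp
  have "velocity (TB (TB M)) (velocity (TB M) d) s = complete_lift M S\<^sub>2 (velocity (TB M) d s)"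
    using d s(1) by (simp add: geodesic_on_def)
  \<comment> \<open>Since \<open>\<sigma> s = 0\<close>, the fibre component vanishes and has the
    same derivative as the base component. The coefficient of the lift is therefore differentiated
    along \<open>(0, l v)\<close> at \<open>(p, l v)\<close>, which is the setting of Euler's
    identity.\<close>
  moreover have xs: "x s = ?p" "y s = 0" "vector_derivative x (at s) = ?l *\<^sub>R ?v"
      "vector_derivative y (at s) = ?l *\<^sub>R ?v"
    using x1[OF sK'] y1[OF sK'] by (simp_all add: x_def y_def s(2))
  ultimately have eqs: "?l *\<^sub>R (?l *\<^sub>R f2 0) + \<mu> *\<^sub>R ?v = (-2) *\<^sub>R ?G2 ?p (?l *\<^sub>R ?v)"
    "?l *\<^sub>R (?l *\<^sub>R f2 0) + (?l *\<^sub>R (?l *\<^sub>R f2 0) + \<mu> *\<^sub>R ?v) =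
      (-2) *\<^sub>R frechet_derivative (\<lambda>z. ?G2 (fst z) (snd z)) (at (?p, ?l *\<^sub>R ?v)) (0, ?l *\<^sub>R ?v)"
    using lift_geodesic_equation(2)[OF M S2 A(1) Rd sK', unfolded xs x2 y2, OF lv] by blast+
  have G2: "?G2 ?p (?l *\<^sub>R ?v) = ?l\<^sup>2 *\<^sub>R ?G2 ?p ?v"
    by (rule spray_coeff_homogeneous[OF M S2 A(1) p v l])
  \<comment> \<open>The two equations become \<open>a + b = g\<close> and
    \<open>2 a + b = 2 g\<close>. Subtracting them eliminates the unknown acceleration term
    \<open>b\<close>.\<close>
  define a where "a = ?l *\<^sub>R (?l *\<^sub>R f2 0)"
  define b where "b = \<mu> *\<^sub>R ?v"
  define g where "g = (-2) *\<^sub>R ?G2 ?p (?l *\<^sub>R ?v)"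
  have "a + b = g" using eqs(1) by (simp add: a_def b_def g_def)
  moreover have "a + (a + b) = g + g"
    using eqs(2) unfolding spray_coeff_euler[OF M S2 A(1) p lv]
    by (simp add: a_def b_def g_def scaleR_2 scaleR_add_right)
  ultimately have "a = g" by (metis add_left_cancel add.commute)
  then have "?l\<^sup>2 *\<^sub>R ((-2) *\<^sub>R ?G1 ?p ?v) = ?l\<^sup>2 *\<^sub>R ((-2) *\<^sub>R ?G2 ?p ?v)"
    by (simp add: a_def g_def f2 G2 power2_eq_square mult.commute mult.left_commute)
  then have "(-2) *\<^sub>R ?G1 ?p ?v = (-2) *\<^sub>R ?G2 ?p ?v" using l by simp
  then show ?thesis
    unfolding represents_velocity2(1)[OF M R U(1), folded f1_def]
    using spray_chart_inv[OF M S1 A(1) p v] spray_chart_inv[OF M S2 A(1) p v] by (simp add: f1_def)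
qed

section \<open>The equivalences\<close>

lemma same_up_to_reparameterization_refl:
  assumes "\<And>I c. C\<^sub>1 I c \<longleftrightarrow> C\<^sub>2 I c" and "\<And>I c. C\<^sub>1 I c \<Longrightarrow> open I"
  shows "same_up_to_reparameterization C\<^sub>1 C\<^sub>2"
proof -
  have "reparameterization I c I c" if "C\<^sub>1 I c" for I c
    unfolding reparameterization_def
    by (rule exI[of _ "\<lambda>t. t"]) (use assms(2)[OF that] in \<open>auto intro: smooth_on_ident bij_betw_id[unfolded id_def]\<close>)
  then show ?thesis unfolding same_up_to_reparameterization_def using assms(1) by blast
qed

text \<open>Equality of the sprays is stated on the slashed bundle, since as total functions they
  carry meaningless values elsewhere.\<close>

theorem theorem5p6:
  fixes M :: "('m, 'e::euclidean_space) manifold"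
    and S\<^sub>1 S\<^sub>2 :: "('m, 'e) tvec \<Rightarrow> (('m, 'e) tvec, 'e \<times> 'e) tvec"
  assumes "smooth_manifold M"
    and "spray M (slashed_T M) S\<^sub>1"
    and "spray M (slashed_T M) S\<^sub>2"
  shows
    "((\<forall>\<xi>\<in>slashed_T M. S\<^sub>1 \<xi> = S\<^sub>2 \<xi>) \<longleftrightarrow>
        projectively_related (TB M) (slashed_TT M) (complete_lift M S\<^sub>1) (complete_lift M S\<^sub>2)) \<and>
     ((\<forall>\<xi>\<in>slashed_T M. S\<^sub>1 \<xi> = S\<^sub>2 \<xi>) \<longleftrightarrow>
        (\<forall>I c. geodesic M (slashed_T M) S\<^sub>1 I c \<longleftrightarrow> geodesic M (slashed_T M) S\<^sub>2 I c)) \<and>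
     (projectively_related (TB M) (slashed_TT M) (complete_lift M S\<^sub>1) (complete_lift M S\<^sub>2) \<longleftrightarrow>
        same_up_to_reparameterization (jacobi_field M S\<^sub>1) (jacobi_field M S\<^sub>2))"
proof -
  note M = smooth_manifold_charted[OF assms(1)] and S1 = assms(2) and S2 = assms(3)
  let ?E = "\<forall>\<xi>\<in>slashed_T M. S\<^sub>1 \<xi> = S\<^sub>2 \<xi>"
  let ?P = "projectively_related (TB M) (slashed_TT M) (complete_lift M S\<^sub>1) (complete_lift M S\<^sub>2)"
  let ?J = "same_up_to_reparameterization (jacobi_field M S\<^sub>1) (jacobi_field M S\<^sub>2)"
  let ?G = "\<forall>I c. geodesic M (slashed_T M) S\<^sub>1 I c \<longleftrightarrow> geodesic M (slashed_T M) S\<^sub>2 I c"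
  have G: "?G" if E: ?E
    using geodesic_cong[of "slashed_T M" S\<^sub>1 S\<^sub>2 M] E by simp
  have P: "?P" if E: ?E
    unfolding projectively_related_def
  proof (rule same_up_to_reparameterization_refl)
    show "geodesic (TB M) (slashed_TT M) (complete_lift M S\<^sub>1) I c =
        geodesic (TB M) (slashed_TT M) (complete_lift M S\<^sub>2) I c" for I c
      by (rule lift_geodesic_cong[OF M S1 S2]) (use E in blast)
  qed (simp add: geodesic_def geodesic_on_def open_interval_def)
  have J: "?J" if E: ?E
  proof (rule same_up_to_reparameterization_refl)
    show "jacobi_field M S\<^sub>1 I c = jacobi_field M S\<^sub>2 I c" for I c
      by (rule jacobi_field_cong[OF M S1 S2]) (use E in blast)
  qed (simp add: jacobi_field_iff geodesic_def geodesic_on_def open_interval_def)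
  \<comment> \<open>Each of the three conditions leads back to \<open>?E\<close>, using a maximal
    geodesic of the first spray through \<open>\<xi>\<close>. The equivalence of \<open>?P\<close>
    and \<open>?J\<close> then follows because both are equivalent to \<open>?E\<close>.\<close>
  have "S\<^sub>1 \<xi> = S\<^sub>2 \<xi>" if \<xi>: "\<xi> \<in> slashed_T M" and rel: "?G \<or> ?P \<or> ?J" for \<xi>
  proof -
    obtain I c where c: "geodesic M (slashed_T M) S\<^sub>1 I c" "0 \<in> I" "velocity M c 0 = \<xi>"
      using geodesic_exists[OF M S1 \<xi>] .
    have c': "geodesic_on M (slashed_T M) S\<^sub>1 I c" using c(1) by (simp add: geodesic_def)
    note field = scaled_velocity_jacobi_field[OF M S1 c(1)]
    from rel show ?thesis
    proof (elim disjE)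
      assume ?G
      \<comment> \<open>The same curve is a geodesic of both sprays, so its second velocity at 0 is
        the value of each of them at \<open>\<xi>\<close>.\<close>
      then have "geodesic_on M (slashed_T M) S\<^sub>2 I c" using c(1) by (simp add: geodesic_def)
      then show ?thesis using c' c(2,3) unfolding geodesic_on_def by metis
    next
      assume ?P
      then obtain K d where "geodesic (TB M) (slashed_TT M) (complete_lift M S\<^sub>2) K d"
        "reparameterization I (scaled_velocity M c) K d"
        using jacobi_field_lift_geodesic[OF M S1 field]
        unfolding projectively_related_def same_up_to_reparameterization_def by blast
      then have "geodesic_on (TB M) (slashed_TT M) (complete_lift M S\<^sub>2) K d"
        and r: "reparameterization I (scaled_velocity M c) K d" by (simp_all add: geodesic_def)
      then show ?thesis by (rule scaled_velocity_reparameterization[OF M S1 S2 c' c(2), unfolded c(3)])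
    next
      assume ?J
      then obtain K d where "jacobi_field M S\<^sub>2 K d" and r: "reparameterization I (scaled_velocity M c) K d"
        using field unfolding same_up_to_reparameterization_def by blast
      \<comment> \<open>A Jacobi field of the second spray is a geodesic of its lift, so this case
        is reduced to the previous one.\<close>
      then have "geodesic_on (TB M) (slashed_TT M) (complete_lift M S\<^sub>2) K d"
        using jacobi_field_lift_geodesic[OF M S2] by (simp add: geodesic_def)
      from this r show ?thesis by (rule scaled_velocity_reparameterization[OF M S1 S2 c' c(2), unfolded c(3)])
    qed
  qed
  with G P J show ?thesis by blast
qed

end
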